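(* Let $d\ge 2$ be an integer and $Q^d:=(0,1)^d$. Fix $1<p<d$ and $M>1$. Define $$Y:=\left\{f:Q^d\to Q^d:\ f \text{ is a } W^{1,p} \text{ homeomorphism},\ f_{|\partial Q^d}=\mathrm{Id},\ \int_{Q^d}|Df|^p\le M\right\}$$ with the distance $$d_Y(f,g):=\|f-g\|_\infty+\|f^{-1}-g^{-1}\|_\infty .$$ Then the set $A$ of all homeomorphisms $f\in Y$ with $Jf=0$ almost everywhere is of first category in $(Y,d_Y)$, i.e. $Y\setminus A$ is residual in $Y$.
   Context: A $W^{1,p}$ homeomorphism $f:Q^d\to Q^d$ is a homeomorphism of the open cube onto itself belonging to $W^{1,p}(Q^d;\mathbb{R}^d)$. $Df$ is its weak differential, $|Df|$ its Euclidean (Frobenius) norm, and $Jf=\det Df$. $f_{|\partial Q^d}=\mathrm{Id}$ means that $f$ extends continuously to $\overline{Q^d}$ by the identity on $\partial Q^d$. $\|\cdot\|_\infty$ is the supremum norm on $Q^d$. A subset of a metric space is residual if it contains the intersection of countably many open dense subsets. *)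

theory Defs
  imports "HOL-Analysis.Analysis"
begin

section \<open>Sobolev maps\<close>

definition partial_deriv :: "'n::finite \<Rightarrow> (real^'n \<Rightarrow> real) \<Rightarrow> real^'n \<Rightarrow> real" where
  "partial_deriv j \<phi> x = frechet_derivative \<phi> (at x) (axis j 1)"

primrec Ck :: "nat \<Rightarrow> (real^'n::finite \<Rightarrow> real) \<Rightarrow> bool" where
  "Ck 0 \<phi> \<longleftrightarrow> continuous_on UNIV \<phi>"
| "Ck (Suc k) \<phi> \<longleftrightarrow> \<phi> differentiable_on UNIV \<and> (\<forall>j. Ck k (partial_deriv j \<phi>))"

definition test_functions :: "(real^'n::finite) set \<Rightarrow> (real^'n \<Rightarrow> real) set" where
  "test_functions U =
     {\<phi>. (\<forall>k. Ck k \<phi>) \<and> compact (closure {x. \<phi> x \<noteq> 0}) \<and> closure {x. \<phi> x \<noteq> 0} \<subseteq> U}"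

definition locally_integrable ::
    "(real^'n::finite) set \<Rightarrow> (real^'n \<Rightarrow> 'b::{banach, second_countable_topology}) \<Rightarrow> bool" where
  "locally_integrable U f \<longleftrightarrow> (\<forall>K. compact K \<and> K \<subseteq> U \<longrightarrow> set_integrable lebesgue K f)"

text \<open>\<open>G x $ i $ j\<close> is the \<open>j\<close>-th weak partial derivative of the \<open>i\<close>-th component of \<open>f\<close>.
  On an open set \<open>U\<close> the weak differential is unique only up to null sets, so it is treated as a
  relation; everything said about \<open>G\<close> below is insensitive to null sets.\<close>
definition has_weak_differential ::
    "(real^'n::finite) set \<Rightarrow> (real^'n \<Rightarrow> real^'m::finite) \<Rightarrow> (real^'n \<Rightarrow> real^'n^'m) \<Rightarrow> bool" where
  "has_weak_differential U f G \<longleftrightarrow>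
     locally_integrable U f \<and> locally_integrable U G \<and>
     (\<forall>\<phi>\<in>test_functions U. \<forall>i j.
        (LINT x:U|lebesgue. f x $ i * partial_deriv j \<phi> x) =
        - (LINT x:U|lebesgue. G x $ i $ j * \<phi> x))"

definition in_Lp ::
    "real \<Rightarrow> (real^'n::finite) set \<Rightarrow> (real^'n \<Rightarrow> 'b::{banach, second_countable_topology}) \<Rightarrow> bool" where
  "in_Lp p U f \<longleftrightarrow>
     set_borel_measurable lebesgue U f \<and> set_integrable lebesgue U (\<lambda>x. norm (f x) powr p)"

text \<open>The norm of \<^typ>\<open>real^'n^'m\<close> is the Euclidean norm of all entries, i.e. the Frobenius norm.\<close>
definition sobolev :: "real \<Rightarrow> (real^'n::finite) set \<Rightarrow> (real^'n \<Rightarrow> real^'m::finite) \<Rightarrow> bool" where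
  "sobolev p U f \<longleftrightarrow> in_Lp p U f \<and> (\<exists>G. has_weak_differential U f G \<and> in_Lp p U G)"


section \<open>The space of Sobolev homeomorphisms of the cube\<close>

definition cube :: "(real^'n::finite) set" where
  "cube = {x. \<forall>i. 0 < x $ i \<and> x $ i < 1}"

definition sobolev_homeo :: "real \<Rightarrow> (real^'n::finite \<Rightarrow> real^'n) \<Rightarrow> bool" where
  "sobolev_homeo p f \<longleftrightarrow> (\<exists>g. homeomorphism cube cube f g) \<and> sobolev p cube f"

definition identity_on_boundary :: "(real^'n::finite \<Rightarrow> real^'n) \<Rightarrow> bool" where
  "identity_on_boundary f \<longleftrightarrow>
     continuous_on (closure cube) (\<lambda>x. if x \<in> cube then f x else x)"

text \<open>Maps defined on the cube only are represented by functions with value \<^const>\<open>undefined\<close>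
  outside of it.\<close>
definition Y_space :: "real \<Rightarrow> real \<Rightarrow> (real^'n::finite \<Rightarrow> real^'n) set" where
  "Y_space p M =
     {f \<in> extensional cube. sobolev_homeo p f \<and> identity_on_boundary f \<and>
        (\<exists>G. has_weak_differential cube f G \<and> in_Lp p cube G \<and>
             (LINT x:cube|lebesgue. norm (G x) powr p) \<le> M)}"

text \<open>The library's \<^const>\<open>Met_TC.fdist\<close> is the supremum distance of bounded functions, made
  total by the value 0 for arguments that are not bounded functions on the given set; see
  \<open>dist_Y_eq\<close> below.\<close>
definition dist_Y :: "(real^'n::finite \<Rightarrow> real^'n) \<Rightarrow> (real^'n \<Rightarrow> real^'n) \<Rightarrow> real" where
  "dist_Y f g =
     Met_TC.fdist cube f g +
     Met_TC.fdist cube (restrict (inv_into cube f) cube) (restrict (inv_into cube g) cube)"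

definition zero_jacobian_maps :: "real \<Rightarrow> real \<Rightarrow> (real^'n::finite \<Rightarrow> real^'n) set" where
  "zero_jacobian_maps p M =
     {f \<in> Y_space p M. \<exists>G. has_weak_differential cube f G \<and>
        (AE x in lebesgue. x \<in> cube \<longrightarrow> det (G x) = 0)}"


section \<open>Baire category\<close>

definition residual_in :: "'a topology \<Rightarrow> 'a set \<Rightarrow> bool" where
  "residual_in X S \<longleftrightarrow> S \<subseteq> topspace X \<and>
     (\<exists>U :: nat \<Rightarrow> 'a set.
        (\<forall>n. openin X (U n) \<and> X closure_of (U n) = topspace X) \<and> (\<Inter>n. U n) \<subseteq> S)"

definition first_category_in :: "'a topology \<Rightarrow> 'a set \<Rightarrow> bool" where
  "first_category_in X S \<longleftrightarrow>
     (\<exists>N :: nat \<Rightarrow> 'a set.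
        (\<forall>n. N n \<subseteq> topspace X \<and> X interior_of (X closure_of (N n)) = {}) \<and> S = (\<Union>n. N n))"


section \<open>The distance is a metric\<close>

lemma cube_eq_box: "(cube :: (real^'n::finite) set) = box 0 1"
  by (auto simp: cube_def mem_box_cart)

lemma cube_nonempty: "(cube :: (real^'n::finite) set) \<noteq> {}"
proof -
  have "(\<chi> i. 1/2) \<in> (cube :: (real^'n) set)"
    by (simp add: cube_def)
  then show ?thesis by blast
qed

lemma fspace_cubeI:
  fixes f :: "real^'n::finite \<Rightarrow> real^'n"
  assumes "f ` cube \<subseteq> cube" "f \<in> extensional cube"
  shows "f \<in> Met_TC.fspace cube"
proof -
  have "bounded (f ` cube)"
    using assms(1) by (metis bounded_box bounded_subset cube_eq_box)
  then show ?thesis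
    using assms(2) by (auto simp: Met_TC.fspace_def)
qed

lemma Y_space_bij: "f \<in> Y_space p M \<Longrightarrow> bij_betw f cube cube"
  unfolding Y_space_def sobolev_homeo_def homeomorphism_def
  by (auto intro!: bij_betw_byWitness)

lemma Y_space_fspace:
  assumes "f \<in> Y_space p M"
  shows "f \<in> Met_TC.fspace cube" "restrict (inv_into cube f) cube \<in> Met_TC.fspace cube"
proof -
  note b = Y_space_bij[OF assms]
  show "f \<in> Met_TC.fspace cube"
    using b assms by (intro fspace_cubeI) (auto simp: bij_betw_def Y_space_def)
  have "inv_into cube f ` cube = cube"
    using bij_betw_inv_into[OF b] by (simp add: bij_betw_def)
  then show "restrict (inv_into cube f) cube \<in> Met_TC.fspace cube"
    by (intro fspace_cubeI) (auto simp: image_restrict_eq)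
qed

lemma dist_Y_eq:
  fixes f g :: "real^'n::finite \<Rightarrow> real^'n"
  assumes "f \<in> Y_space p M" "g \<in> Y_space p M"
  shows "dist_Y f g =
    (SUP x\<in>cube. norm (f x - g x)) + (SUP y\<in>cube. norm (inv_into cube f y - inv_into cube g y))"
  using Y_space_fspace[OF assms(1)] Y_space_fspace[OF assms(2)]
  by (simp add: dist_Y_def Met_TC.fdist_def dist_norm cube_nonempty cong: SUP_cong_simp)

lemma Metric_space_Y: "Metric_space (Y_space p M) dist_Y"
proof -
  interpret F: Metric_space "Met_TC.fspace cube" "Met_TC.fdist cube"
    by (rule Met_TC.Metric_space_funspace)
  show ?thesis
  proof
    fix f g h :: "real^'a \<Rightarrow> real^'a"
    show "0 \<le> dist_Y f g" "dist_Y f g = dist_Y g f"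
      by (simp_all add: dist_Y_def F.commute)
    show "dist_Y f g = 0 \<longleftrightarrow> f = g" if "f \<in> Y_space p M" "g \<in> Y_space p M"
      using Y_space_fspace[OF that(1)] Y_space_fspace[OF that(2)]
      by (auto simp: dist_Y_def add_nonneg_eq_0_iff)
    show "dist_Y f h \<le> dist_Y f g + dist_Y g h"
      if "f \<in> Y_space p M" "g \<in> Y_space p M" "h \<in> Y_space p M"
      using F.triangle[of f g h] Y_space_fspace[OF that(1)] Y_space_fspace[OF that(2)]
        Y_space_fspace[OF that(3)]
        F.triangle[of "restrict (inv_into cube f) cube" "restrict (inv_into cube g) cube"
          "restrict (inv_into cube h) cube"]
      by (simp add: dist_Y_def)
  qed
qed

end

theory Submission
  imports Defs
begin

text \<open>The maps with zero Jacobian are even nowhere dense. Since the \<open>p\<close>-energy is lower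
  semicontinuous and strictly convex, a map \<open>g\<close> of maximal energy \<open>M\<close> has the property that
  \<open>h\<^sub>k \<rightarrow> g\<close> in the space forces the weak differentials to converge almost everywhere along a
  subsequence; so if all \<open>h\<^sub>k\<close> have zero Jacobian, then so has \<open>g\<close>. On the other hand,
  the maps of energy exactly \<open>M\<close> whose Jacobian does not vanish almost everywhere are dense:
  shrink a given \<open>f\<close> to the subcube \<open>(0,c)\<^sup>n\<close> with \<open>c\<close> close to 1, put a scaled copy of a
  smooth diffeomorphism into \<open>(c,1)\<^sup>n\<close>, and take the identity elsewhere. By Jensen's inequality
  the identity has least energy, so shrinking does not raise the energy above \<open>M\<close>, and the
  diffeomorphism can be chosen to raise it to \<open>M\<close> exactly.\<close>

text \<open>Below the dimension exponent, weak convergence of differentials does not by itself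
  control determinants, so a vanishing Jacobian survives the limit only if the convergence improves
  to almost everywhere convergence. Failure of that improvement shows up as a drop of energy in the
  limit, and approximants of energy at most \<open>M\<close> cannot drop to a limit of energy
  \<open>M\<close>. The Bregman distance of the p-th power of the norm makes this quantitative: its
  integral over a level set of the limit is the energy difference up to a term that vanishes by weak
  convergence.

  In the density argument the glued map is the identity on the open region where one coordinate is
  below \<open>c\<close> and another is above it. Two distinct coordinates make this region
  nonempty, so the Jacobian equals 1 on an open set whatever \<open>f\<close> is. Energies are
  measured as excess over the identity, for displacements extended by zero to the whole space:
  excess is additive over disjoint supports, and a copy scaled by \<open>c\<close> carries the
  excess multiplied by \<open>c ^ CARD('n)\<close>. This makes the energy of the glued map an
  explicit function of the remaining parameter.\<close>

section \<open>Smooth functions\<close>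

text \<open>One-variable counterpart of \<open>Ck\<close>. The derivative is an existential witness,
  so the closure proofs can exhibit it by a formula.\<close>

primrec smooth_upto :: "nat \<Rightarrow> (real \<Rightarrow> real) \<Rightarrow> bool" where
  "smooth_upto 0 f \<longleftrightarrow> continuous_on UNIV f"
| "smooth_upto (Suc k) f \<longleftrightarrow>
     (\<exists>f'. (\<forall>x. (f has_real_derivative f' x) (at x)) \<and> smooth_upto k f')"

lemma smooth_upto_SucI:
  "(\<And>x. (f has_real_derivative f' x) (at x)) \<Longrightarrow> smooth_upto k f' \<Longrightarrow> smooth_upto (Suc k) f"
  by auto

lemma smooth_upto_Suc_imp: "smooth_upto (Suc k) f \<Longrightarrow> smooth_upto k f"
proof (induction k arbitrary: f)
  case 0
  then show ?case
    by (auto intro!: continuous_at_imp_continuous_on) (metis DERIV_isCont)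
next
  case (Suc k)
  then show ?case by (metis smooth_upto.simps(2))
qed

lemma smooth_upto_const: "smooth_upto k (\<lambda>x. c)"
  by (induction k arbitrary: c) (auto intro!: exI[of _ "\<lambda>x. 0"])

lemma smooth_upto_affine: "smooth_upto k (\<lambda>x. a * x + b)"
proof (cases k)
  case 0
  then show ?thesis by (auto intro!: continuous_intros)
next
  case (Suc l)
  then show ?thesis
    by (auto intro!: smooth_upto_SucI[where f' = "\<lambda>x. a"] derivative_eq_intros smooth_upto_const
        simp del: smooth_upto.simps)
qed

lemma smooth_upto_add:
  "smooth_upto k f \<Longrightarrow> smooth_upto k g \<Longrightarrow> smooth_upto k (\<lambda>x. f x + g x)"
proof (induction k arbitrary: f g)
  case 0
  then show ?case by (auto intro!: continuous_intros)
next
  case (Suc k)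
  obtain f' g' where d: "\<And>x. (f has_real_derivative f' x) (at x)" "smooth_upto k f'"
    "\<And>x. (g has_real_derivative g' x) (at x)" "smooth_upto k g'"
    using Suc.prems by auto
  show ?case
    by (rule smooth_upto_SucI[where f' = "\<lambda>x. f' x + g' x"]) (auto intro!: derivative_intros d Suc.IH)
qed

lemma smooth_upto_mult:
  "smooth_upto k f \<Longrightarrow> smooth_upto k g \<Longrightarrow> smooth_upto k (\<lambda>x. f x * g x)"
proof (induction k arbitrary: f g)
  case 0
  then show ?case by (auto intro!: continuous_intros)
next
  case (Suc k)
  obtain f' g' where d: "\<And>x. (f has_real_derivative f' x) (at x)" "smooth_upto k f'"
    "\<And>x. (g has_real_derivative g' x) (at x)" "smooth_upto k g'"
    using Suc.prems by auto
  have m: "smooth_upto k f" "smooth_upto k g"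
    using Suc.prems smooth_upto_Suc_imp by blast+
  show ?case
    by (rule smooth_upto_SucI[where f' = "\<lambda>x. f' x * g x + g' x * f x"])
      (auto intro!: DERIV_mult d smooth_upto_add Suc.IH m)
qed

text \<open>The derivative of 1/f again contains 1/f, but only at order \<open>k\<close>, which is
  what the induction hypothesis provides.\<close>

lemma smooth_upto_inverse:
  assumes "\<And>x. f x \<noteq> 0"
  shows "smooth_upto k f \<Longrightarrow> smooth_upto k (\<lambda>x. inverse (f x))"
proof (induction k)
  case 0
  then show ?case using assms by (auto intro!: continuous_intros)
next
  case (Suc k)
  obtain f' where d: "\<And>x. (f has_real_derivative f' x) (at x)" "smooth_upto k f'"
    using Suc.prems by auto
  have i: "smooth_upto k (\<lambda>x. inverse (f x))"
    using Suc smooth_upto_Suc_imp by blast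
  show ?case
  proof (rule smooth_upto_SucI)
    show "((\<lambda>x. inverse (f x)) has_real_derivative
        (-1) * (f' x * (inverse (f x) * inverse (f x)))) (at x)" for x
      using DERIV_inverse_fun[OF d(1)[of x] assms] by (simp add: mult_ac)
    show "smooth_upto k (\<lambda>x. (-1) * (f' x * (inverse (f x) * inverse (f x))))"
      by (intro smooth_upto_mult smooth_upto_const d i)
  qed
qed

lemma smooth_upto_compose_affine:
  "smooth_upto k f \<Longrightarrow> smooth_upto k (\<lambda>x. f (a * x + b))"
proof (induction k arbitrary: f)
  case 0
  then show ?case
    by (auto intro!: continuous_on_compose2[of UNIV f] continuous_intros)
next
  case (Suc k)
  obtain f' where d: "\<And>x. (f has_real_derivative f' x) (at x)" "smooth_upto k f'"
    using Suc.prems by auto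
  show ?case
  proof (rule smooth_upto_SucI)
    show "((\<lambda>x. f (a * x + b)) has_real_derivative a * f' (a * x + b)) (at x)" for x
    proof -
      have "((\<lambda>x. a * x + b) has_real_derivative a) (at x)"
        by (auto intro!: derivative_eq_intros)
      from DERIV_chain2[where f = f and g = "\<lambda>x. a * x + b", OF d(1) this] show ?thesis
        by (simp add: mult.commute)
    qed
    show "smooth_upto k (\<lambda>x. a * f' (a * x + b))"
      by (intro smooth_upto_mult smooth_upto_const Suc.IH d)
  qed
qed

text \<open>The case n = 0 is the classical flat function. The powers of 1/x make the family closed
  under differentiation up to linear combinations, so that smoothness follows by induction over all
  \<open>n\<close> at once.\<close>

definition flat_exp :: "nat \<Rightarrow> real \<Rightarrow> real" where
  "flat_exp n x = (if x > 0 then inverse x ^ n * exp (- inverse x) else 0)"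

lemma flat_exp_tendsto_0: "(flat_exp n \<longlongrightarrow> 0) (at 0)"
proof -
  have "((\<lambda>x::real. inverse x ^ n / exp (inverse x)) \<longlongrightarrow> 0) (at_right 0)"
    by (rule filterlim_compose[OF tendsto_power_div_exp_0 filterlim_inverse_at_top_right])
  then have r: "(flat_exp n \<longlongrightarrow> 0) (at_right 0)"
    by (rule Lim_transform_eventually)
      (auto simp: eventually_at_right_field flat_exp_def exp_minus divide_inverse intro!: exI[of _ 1])
  have l: "(flat_exp n \<longlongrightarrow> 0) (at_left 0)"
    by (rule Lim_transform_eventually[OF tendsto_const])
      (auto simp: eventually_at_left_field flat_exp_def intro!: exI[of _ "-1"])
  show ?thesis using l r by (rule filterlim_split_at)
qed

lemma flat_exp_has_derivative:
  "(flat_exp n has_real_derivative (- real n) * flat_exp (Suc n) x + flat_exp (Suc (Suc n)) x) (at x)"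
proof -
  consider "x > 0" | "x < 0" | "x = 0" by linarith
  then show ?thesis
  proof cases
    case 1
    have i: "(inverse has_real_derivative - (inverse x ^ 2)) (at x)"
      using DERIV_inverse[of x] 1 by (simp add: numeral_2_eq_2)
    have p: "((\<lambda>x. inverse x ^ n) has_real_derivative (- real n) * inverse x ^ Suc n) (at x)"
    proof (rule DERIV_cong[OF DERIV_power[OF i]])
      show "real n * (- (inverse x ^ 2) * inverse x ^ (n - Suc 0)) = (- real n) * inverse x ^ Suc n"
        by (cases n) (simp_all add: power2_eq_square algebra_simps)
    qed
    have e: "((\<lambda>x. exp (- inverse x)) has_real_derivative exp (- inverse x) * (inverse x ^ 2)) (at x)"
      using DERIV_fun_exp[OF DERIV_minus[OF i]] by simp
    have "((\<lambda>x. inverse x ^ n * exp (- inverse x)) has_real_derivative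
        (- real n) * flat_exp (Suc n) x + flat_exp (Suc (Suc n)) x) (at x)"
      by (rule DERIV_cong[OF DERIV_mult[OF p e]])
        (use 1 in \<open>simp add: flat_exp_def power2_eq_square\<close>)
    then show ?thesis
      by (rule has_field_derivative_transform_within_open[of _ _ _ "{0<..}"])
        (use 1 in \<open>auto simp: flat_exp_def\<close>)
  next
    case 2
    have "((\<lambda>x. 0) has_real_derivative
        (- real n) * flat_exp (Suc n) x + flat_exp (Suc (Suc n)) x) (at x)"
      using 2 by (auto simp: flat_exp_def)
    then show ?thesis
      by (rule has_field_derivative_transform_within_open[of _ _ _ "{..<0}"])
        (use 2 in \<open>auto simp: flat_exp_def\<close>)
  next
    case 3
    \<comment> \<open>At the origin the difference quotient of one member of the family is the next
      member, which tends to 0.\<close>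
    have "((\<lambda>h. (flat_exp n h - flat_exp n 0) / h) \<longlongrightarrow> 0) (at 0)"
    proof (rule Lim_transform_eventually[OF flat_exp_tendsto_0[of "Suc n"]])
      have "flat_exp (Suc n) h = (flat_exp n h - flat_exp n 0) / h" if "h \<noteq> 0" for h
        by (simp add: flat_exp_def divide_inverse mult.commute)
      then show "\<forall>\<^sub>F h in at 0. flat_exp (Suc n) h = (flat_exp n h - flat_exp n 0) / h"
        by (metis (mono_tags, lifting) eventually_at_filter eventuallyI)
    qed
    then show ?thesis
      by (simp add: 3 DERIV_def) (simp add: flat_exp_def)
  qed
qed

lemma smooth_flat_exp: "smooth_upto k (flat_exp n)"
proof (induction k arbitrary: n)
  case 0
  then show ?case
    by (auto intro!: continuous_at_imp_continuous_on DERIV_isCont flat_exp_has_derivative)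
next
  case (Suc k)
  show ?case
    by (rule smooth_upto_SucI[OF flat_exp_has_derivative])
      (intro smooth_upto_add smooth_upto_mult smooth_upto_const Suc)
qed

text \<open>The quotient f(x) / (f(x) + f(1-x)); the denominator is positive because x or 1-x is.
  Writing 1-x as \<open>(-1) * x + 1\<close> matches
  \<open>smooth_upto_compose_affine\<close>.\<close>

definition smooth_step :: "real \<Rightarrow> real" where
  "smooth_step x = flat_exp 0 x * inverse (flat_exp 0 x + flat_exp 0 ((-1) * x + 1))"

lemma flat_exp_nonneg: "0 \<le> flat_exp n x"
  by (simp add: flat_exp_def)

lemma smooth_step_denominator_pos: "0 < flat_exp 0 x + flat_exp 0 ((-1) * x + 1)"
proof (cases "x > 0")
  case True
  then have "flat_exp 0 x > 0" by (simp add: flat_exp_def)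
  then show ?thesis using flat_exp_nonneg add_pos_nonneg by blast
next
  case False
  then have "flat_exp 0 ((-1) * x + 1) > 0" by (simp add: flat_exp_def)
  then show ?thesis using flat_exp_nonneg add_nonneg_pos by blast
qed

lemma smooth_step_smooth: "smooth_upto k smooth_step"
proof -
  have "smooth_upto k (\<lambda>x. flat_exp 0 x * inverse (flat_exp 0 x + flat_exp 0 ((-1) * x + 1)))"
    by (intro smooth_upto_mult smooth_upto_inverse smooth_upto_add smooth_flat_exp
        smooth_upto_compose_affine) (use smooth_step_denominator_pos in \<open>metis less_irrefl\<close>)
  then show ?thesis by (simp add: smooth_step_def[abs_def])
qed

lemma smooth_step_eq_0: "x \<le> 0 \<Longrightarrow> smooth_step x = 0"
  by (simp add: smooth_step_def flat_exp_def)

lemma smooth_step_eq_1: "1 \<le> x \<Longrightarrow> smooth_step x = 1"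
  by (simp add: smooth_step_def flat_exp_def)

lemma smooth_step_bounds: "0 \<le> smooth_step x" "smooth_step x \<le> 1"
proof -
  let ?a = "flat_exp 0 x" and ?b = "flat_exp 0 ((-1) * x + 1)"
  have "0 \<le> ?a" "0 \<le> ?b" "0 < ?a + ?b"
    by (rule flat_exp_nonneg flat_exp_nonneg smooth_step_denominator_pos)+
  moreover have "smooth_step x = ?a / (?a + ?b)"
    by (simp add: smooth_step_def divide_inverse)
  ultimately show "0 \<le> smooth_step x" "smooth_step x \<le> 1"
    by (simp_all only: divide_le_eq_1 divide_nonneg_pos) simp
qed

lemma smooth_step_derivative:
  obtains s' C where "\<And>x. (smooth_step has_real_derivative s' x) (at x)"
    "\<And>x. \<bar>s' x\<bar> \<le> C" "\<And>x. x < 0 \<or> 1 < x \<Longrightarrow> s' x = 0" "0 \<le> C"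
proof -
  obtain s' where s': "\<And>x. (smooth_step has_real_derivative s' x) (at x)" "continuous_on UNIV s'"
    using smooth_step_smooth[of "Suc 0"] by auto
  have z: "s' x = 0" if "x < 0 \<or> 1 < x" for x
  proof -
    have "(smooth_step has_real_derivative 0) (at x)"
      using that
    proof
      assume "x < 0"
      show ?thesis
        by (rule has_field_derivative_transform_within_open[of "\<lambda>x. 0" _ _ "{..<0}"])
          (use \<open>x < 0\<close> in \<open>auto simp: smooth_step_eq_0\<close>)
    next
      assume "1 < x"
      show ?thesis
        by (rule has_field_derivative_transform_within_open[of "\<lambda>x. 1" _ _ "{1<..}"])
          (use \<open>1 < x\<close> in \<open>auto simp: smooth_step_eq_1\<close>)
    qed
    then show ?thesis by (rule DERIV_unique[OF s'(1)])
  qed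
  have "compact (s' ` {0..1})"
    by (intro compact_continuous_image continuous_on_subset[OF s'(2)]) auto
  then have "bounded (s' ` {0..1})" by (rule compact_imp_bounded)
  then obtain C where "\<forall>y\<in>s' ` {0..1}. norm y \<le> C" unfolding bounded_iff by blast
  then have C: "x \<in> {0..1} \<Longrightarrow> norm (s' x) \<le> C" for x by blast
  have "\<bar>s' x\<bar> \<le> max C 0" for x
    using z[of x] C[of x] by (cases "x < 0 \<or> 1 < x") (simp_all add: le_max_iff_disj)
  then show ?thesis by (rule that[OF s'(1) _ z]) simp_all
qed

subsection \<open>Functions of several variables\<close>

lemma partial_deriv_eq:
  "(\<phi> has_derivative D) (at x) \<Longrightarrow> partial_deriv j \<phi> x = D (axis j 1)"
  using frechet_derivative_at[of \<phi> D x] by (simp add: partial_deriv_def)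

lemma Ck_differentiable: "Ck (Suc k) \<phi> \<Longrightarrow> \<phi> differentiable (at x)"
  by (simp add: differentiable_on_def)

lemma Ck_has_derivative: "Ck (Suc k) \<phi> \<Longrightarrow> (\<phi> has_derivative frechet_derivative \<phi> (at x)) (at x)"
  using Ck_differentiable frechet_derivative_works by blast

lemma Ck_Suc_imp: "Ck (Suc k) \<phi> \<Longrightarrow> Ck k \<phi>"
proof (induction k arbitrary: \<phi>)
  case 0
  then show ?case by (auto intro: differentiable_imp_continuous_on)
next
  case (Suc k)
  then show ?case by (metis Ck.simps(2))
qed

lemma Ck_continuous_on: "Ck k \<phi> \<Longrightarrow> continuous_on S \<phi>"
proof (induction k)
  case 0
  then show ?case using continuous_on_subset by auto
next
  case (Suc k)
  then show ?case using Ck_Suc_imp by blast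
qed

lemma Ck_partial_continuous_on: "Ck (Suc k) \<phi> \<Longrightarrow> continuous_on S (partial_deriv j \<phi>)"
  using Ck_continuous_on[of k] by auto

lemma Ck_SucI:
  assumes "\<And>x. (\<phi> has_derivative D x) (at x)" "\<And>j. Ck k (\<lambda>x. D x (axis j 1))"
  shows "Ck (Suc k) \<phi>"
proof -
  have "partial_deriv j \<phi> = (\<lambda>x. D x (axis j 1))" for j
    using partial_deriv_eq[OF assms(1)] by auto
  moreover have "\<phi> differentiable_on UNIV"
    using assms(1) by (auto simp: differentiable_on_def differentiable_def)
  ultimately show ?thesis using assms(2) by simp
qed

lemma Ck_const: "Ck k (\<lambda>x. c)"
proof (induction k arbitrary: c)
  case (Suc k)
  show ?case by (rule Ck_SucI[where D = "\<lambda>x h. 0"]) (auto simp: Suc)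
qed simp

lemma partial_deriv_add:
  assumes "Ck (Suc k) f" "Ck (Suc l) g"
  shows "partial_deriv j (\<lambda>x. f x + g x) x = partial_deriv j f x + partial_deriv j g x"
  using partial_deriv_eq[OF has_derivative_add[OF Ck_has_derivative[OF assms(1)] Ck_has_derivative[OF assms(2)]]]
  by (simp add: partial_deriv_def)

lemma Ck_add: "Ck k f \<Longrightarrow> Ck k g \<Longrightarrow> Ck k (\<lambda>x. f x + g x)"
proof (induction k arbitrary: f g)
  case 0
  then show ?case by (auto intro!: continuous_intros)
next
  case (Suc k)
  show ?case
    by (rule Ck_SucI[OF has_derivative_add[OF Ck_has_derivative[OF Suc.prems(1)] Ck_has_derivative[OF Suc.prems(2)]]])
      (use Suc in \<open>auto simp flip: partial_deriv_def\<close>)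
qed

lemma partial_deriv_mult:
  assumes "Ck (Suc k) f" "Ck (Suc l) g"
  shows "partial_deriv j (\<lambda>x. f x * g x) x = f x * partial_deriv j g x + partial_deriv j f x * g x"
  using partial_deriv_eq[OF has_derivative_mult[OF Ck_has_derivative[OF assms(1)] Ck_has_derivative[OF assms(2)]]]
  by (simp add: partial_deriv_def)

lemma Ck_mult: "Ck k f \<Longrightarrow> Ck k g \<Longrightarrow> Ck k (\<lambda>x. f x * g x)"
proof (induction k arbitrary: f g)
  case 0
  then show ?case by (auto intro!: continuous_intros)
next
  case (Suc k)
  have m: "Ck k f" "Ck k g" using Suc.prems Ck_Suc_imp by blast+
  show ?case
    by (rule Ck_SucI[OF has_derivative_mult[OF Ck_has_derivative[OF Suc.prems(1)] Ck_has_derivative[OF Suc.prems(2)]]])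
      (use Suc m in \<open>auto simp flip: partial_deriv_def intro!: Ck_add\<close>)
qed

lemma Ck_prod: "(\<And>i. i \<in> I \<Longrightarrow> Ck k (f i)) \<Longrightarrow> Ck k (\<lambda>x. \<Prod>i\<in>I. f i x)"
  by (induction I rule: infinite_finite_induct) (auto intro: Ck_const Ck_mult)

lemma has_derivative_coordinate:
  fixes b :: "real \<Rightarrow> real" and x :: "real^'n::finite"
  assumes "(b has_real_derivative b') (at (x $ i))"
  shows "((\<lambda>x. b (x $ i)) has_derivative (\<lambda>h. b' * h $ i)) (at x)"
  using has_derivative_compose[OF bounded_linear_imp_has_derivative[OF bounded_linear_vec_nth]
      assms[unfolded has_field_derivative_def]] by auto

lemma partial_deriv_coordinate:
  "(b has_real_derivative b') (at (x $ i)) \<Longrightarrow>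
   partial_deriv j (\<lambda>x. b (x $ i)) x = (if i = j then b' else 0)"
  using partial_deriv_eq[OF has_derivative_coordinate, of b b' x i j] by (simp add: axis_def)

lemma Ck_coordinate: "smooth_upto k b \<Longrightarrow> Ck k (\<lambda>x::real^'n::finite. b (x $ i))"
proof (induction k arbitrary: b)
  case 0
  then show ?case
    by (auto intro!: continuous_on_compose2[of UNIV b] continuous_intros)
next
  case (Suc k)
  obtain b' where d: "\<And>x. (b has_real_derivative b' x) (at x)" "smooth_upto k b'"
    using Suc.prems by auto
  show ?case
    by (rule Ck_SucI[OF has_derivative_coordinate[OF d(1)]])
      (intro Ck_mult Ck_const Suc.IH d(2))
qed

lemma has_derivative_scaled:
  fixes f :: "real^'n::finite \<Rightarrow> real"
  assumes "Ck (Suc k) f"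
  shows "((\<lambda>x. f (c *\<^sub>R x + a)) has_derivative (\<lambda>h. frechet_derivative f (at (c *\<^sub>R x + a)) (c *\<^sub>R h))) (at x)"
proof -
  have "((\<lambda>x. c *\<^sub>R x + a) has_derivative (\<lambda>h. c *\<^sub>R h)) (at x)"
    by (auto intro!: derivative_eq_intros)
  from has_derivative_compose[OF this Ck_has_derivative[OF assms]] show ?thesis .
qed

lemma partial_deriv_scaled:
  fixes f :: "real^'n::finite \<Rightarrow> real"
  assumes "Ck (Suc k) f"
  shows "partial_deriv j (\<lambda>x. f (c *\<^sub>R x + a)) x = c * partial_deriv j f (c *\<^sub>R x + a)"
proof -
  have "linear (frechet_derivative f (at (c *\<^sub>R x + a)))"
    using Ck_differentiable[OF assms] linear_frechet_derivative by blast
  then show ?thesis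
    using partial_deriv_eq[OF has_derivative_scaled[OF assms]]
    by (simp add: partial_deriv_def linear_scale)
qed

lemma Ck_scaled:
  fixes f :: "real^'n::finite \<Rightarrow> real"
  shows "Ck k f \<Longrightarrow> Ck k (\<lambda>x. f (c *\<^sub>R x + a))"
proof (induction k arbitrary: f)
  case 0
  then show ?case
    by (auto intro!: continuous_on_compose2[of UNIV f] continuous_intros)
next
  case (Suc k)
  have l: "linear (frechet_derivative f (at y))" for y
    using Ck_differentiable[OF Suc.prems] linear_frechet_derivative by blast
  show ?case
    by (rule Ck_SucI[OF has_derivative_scaled[OF Suc.prems]])
      (use Suc in \<open>auto simp: linear_scale[OF l] simp flip: partial_deriv_def intro!: Ck_mult Ck_const\<close>)
qed

section \<open>Cutoff functions and integration by parts\<close>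

text \<open>The i-th factor rises from 0 to 1 between \<open>a $ i + 1/k\<close> and
  \<open>a $ i + 2/k\<close> and falls back between \<open>b $ i - 2/k\<close> and
  \<open>b $ i - 1/k\<close>. The margin 1/k keeps the support compactly inside the open
  box.\<close>

definition cutoff :: "real \<Rightarrow> real^'n::finite \<Rightarrow> real^'n \<Rightarrow> real^'n \<Rightarrow> real" where
  "cutoff k a b x =
     (\<Prod>i\<in>UNIV. smooth_step (k * x $ i + (- k * a $ i - 1)) * smooth_step ((- k) * x $ i + (k * b $ i - 1)))"

lemma cutoff_bounds: "0 \<le> cutoff k a b x" "cutoff k a b x \<le> 1"
  unfolding cutoff_def
  by (auto intro!: prod_nonneg prod_le_1 mult_nonneg_nonneg mult_le_one smooth_step_bounds)

lemma cutoff_eq_0: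
  fixes x :: "real^'n::finite"
  assumes "0 < k" "x $ i \<le> a $ i + 1 / k \<or> b $ i - 1 / k \<le> x $ i"
  shows "cutoff k a b x = 0"
proof -
  have "k * x $ i + (- k * a $ i - 1) \<le> 0 \<or> (- k) * x $ i + (k * b $ i - 1) \<le> 0"
    using assms by (auto simp: field_simps)
  then have "smooth_step (k * x $ i + (- k * a $ i - 1)) * smooth_step ((- k) * x $ i + (k * b $ i - 1)) = 0"
    using smooth_step_eq_0 by (metis mult_eq_0_iff)
  then show ?thesis unfolding cutoff_def by (intro prod_zero) auto
qed

lemma cutoff_eq_1:
  fixes x :: "real^'n::finite"
  assumes "0 < k" "\<And>i. a $ i + 2 / k \<le> x $ i \<and> x $ i \<le> b $ i - 2 / k"
  shows "cutoff k a b x = 1"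
proof -
  have "smooth_step (k * x $ i + (- k * a $ i - 1)) * smooth_step ((- k) * x $ i + (k * b $ i - 1)) = 1" for i
  proof -
    have "1 \<le> k * x $ i + (- k * a $ i - 1)" "1 \<le> (- k) * x $ i + (k * b $ i - 1)"
      using assms(1) assms(2)[of i] by (auto simp: field_simps)
    then show ?thesis by (simp add: smooth_step_eq_1)
  qed
  then show ?thesis unfolding cutoff_def by simp
qed

lemma cutoff_eq_0_outside: "0 < k \<Longrightarrow> x \<notin> box a b \<Longrightarrow> cutoff k a b x = 0"
proof -
  assume k: "0 < k" and "x \<notin> box a b"
  then obtain i where "x $ i \<le> a $ i \<or> b $ i \<le> x $ i"
    unfolding mem_box_cart by (meson not_le)
  moreover have "0 < 1 / k" using k by simp
  ultimately have "x $ i \<le> a $ i + 1 / k \<or> b $ i - 1 / k \<le> x $ i" by linarith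
  with k show ?thesis by (rule cutoff_eq_0)
qed

lemma Ck_cutoff: "Ck m (cutoff k a b)"
  unfolding cutoff_def[abs_def]
  by (intro Ck_prod Ck_mult Ck_coordinate[where b = "\<lambda>t. smooth_step (c * t + d)" for c d]
      smooth_upto_compose_affine smooth_step_smooth)

lemma cutoff_support:
  assumes "0 < k"
  shows "closure {x. cutoff k a b x \<noteq> 0} \<subseteq> cbox (\<chi> i. a $ i + 1 / k) (\<chi> i. b $ i - 1 / k)"
proof (rule closure_minimal)
  show "{x. cutoff k a b x \<noteq> 0} \<subseteq> cbox (\<chi> i. a $ i + 1 / k) (\<chi> i. b $ i - 1 / k)"
  proof
    fix x assume "x \<in> {x. cutoff k a b x \<noteq> 0}"
    then have "\<not> (x $ i \<le> a $ i + 1 / k \<or> b $ i - 1 / k \<le> x $ i)" for i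
      using cutoff_eq_0[OF assms] by blast
    then show "x \<in> cbox (\<chi> i. a $ i + 1 / k) (\<chi> i. b $ i - 1 / k)"
      by (auto simp: mem_box_cart less_imp_le not_le)
  qed
qed (rule closed_cbox)

lemma cutoff_test_function:
  assumes "0 < k" "box a b \<subseteq> U"
  shows "cutoff k a b \<in> test_functions U"
proof -
  have "cbox (\<chi> i. a $ i + 1 / k) (\<chi> i. b $ i - 1 / k) \<subseteq> box a b"
  proof
    fix x assume x: "x \<in> cbox (\<chi> i. a $ i + 1 / k) (\<chi> i. b $ i - 1 / k)"
    have "a $ i < x $ i \<and> x $ i < b $ i" for i
    proof -
      have "0 < 1 / k" using assms by simp
      moreover have "a $ i + 1 / k \<le> x $ i" "x $ i \<le> b $ i - 1 / k"
        using x by (auto simp: mem_box_cart)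
      ultimately show ?thesis by linarith
    qed
    then show "x \<in> box a b" by (auto simp: mem_box_cart)
  qed
  then have "closure {x. cutoff k a b x \<noteq> 0} \<subseteq> U"
    using cutoff_support[OF assms(1), of a b] assms(2) by blast
  moreover have "compact (closure {x. cutoff k a b x \<noteq> 0})"
    using cutoff_support[OF assms(1), of a b]
    by (metis bounded_cbox bounded_subset closed_closure compact_eq_bounded_closed)
  ultimately show ?thesis unfolding test_functions_def using Ck_cutoff by blast
qed

lemma cutoff_tendsto:
  fixes x :: "real^'n::finite"
  assumes "x \<in> box a b"
  shows "(\<lambda>m. cutoff (real (Suc m)) a b x) \<longlonglongrightarrow> 1"
proof -
  have "\<forall>\<^sub>F m in sequentially. \<forall>i\<in>UNIV. a $ i + 2 / real (Suc m) < x $ i \<and> x $ i < b $ i - 2 / real (Suc m)"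
  proof (intro eventually_ball_finite ballI eventually_conj)
    fix i :: 'n
    have l: "(\<lambda>m. 2 / real (Suc m)) \<longlonglongrightarrow> 0"
      using LIMSEQ_Suc[OF lim_const_over_n[of 2]] by simp
    have "(\<lambda>m. a $ i + 2 / real (Suc m)) \<longlonglongrightarrow> a $ i + 0"
      by (intro tendsto_intros l)
    then show "\<forall>\<^sub>F m in sequentially. a $ i + 2 / real (Suc m) < x $ i"
      using assms order_tendstoD(2) by (fastforce simp: mem_box_cart)
    have "(\<lambda>m. b $ i - 2 / real (Suc m)) \<longlonglongrightarrow> b $ i - 0"
      by (intro tendsto_intros l)
    then show "\<forall>\<^sub>F m in sequentially. x $ i < b $ i - 2 / real (Suc m)"
      using assms order_tendstoD(1) by (fastforce simp: mem_box_cart)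
  qed auto
  then have "\<forall>\<^sub>F m in sequentially. 1 = cutoff (real (Suc m)) a b x"
    by eventually_elim (rule cutoff_eq_1[symmetric], auto simp: less_imp_le)
  then show ?thesis by (rule Lim_transform_eventually[OF tendsto_const])
qed

lemma partial_deriv_prod_coordinates_eq_0:
  fixes \<beta> :: "'n::finite \<Rightarrow> real \<Rightarrow> real"
  assumes "finite I" "j \<notin> I" "\<And>i. smooth_upto (Suc 0) (\<beta> i)"
  shows "partial_deriv j (\<lambda>x. \<Prod>i\<in>I. \<beta> i (x $ i)) x = 0"
  using assms(1,2)
proof (induction I rule: finite_induct)
  case empty
  show ?case using partial_deriv_eq[where \<phi> = "\<lambda>x. 1" and D = "\<lambda>h. 0" and x = x and j = j] by simp
next
  case (insert i I)
  obtain b' where b': "\<And>x. (\<beta> i has_real_derivative b' x) (at x)" using assms(3)[of i] by auto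
  have "partial_deriv j (\<lambda>x. \<beta> i (x $ i) * (\<Prod>i\<in>I. \<beta> i (x $ i))) x = 0"
    using insert partial_deriv_coordinate[where b = "\<beta> i" and b' = "b' (x $ i)" and x = x and i = i and j = j, OF b']
    by (subst partial_deriv_mult[where k = 0 and l = 0])
      (auto intro!: Ck_coordinate Ck_prod assms(3) simp del: Ck.simps smooth_upto.simps)
  then show ?case using insert by simp
qed

text \<open>Only the j-th factor depends on the j-th coordinate, and the other factors are at most
  1. The constant is uniform in \<open>k\<close>, \<open>a\<close> and \<open>b\<close>: the
  gradient has size of order k on slabs of width 1/k, a balance exploited in
  \<open>cutoff_boundary_term_tendsto_0\<close>.\<close>

lemma partial_deriv_cutoff:
  obtains C where "0 \<le> C"
    "\<And>k a b j (x::real^'n::finite). 0 < k \<Longrightarrow> \<bar>partial_deriv j (cutoff k a b) x\<bar> \<le> C * k"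
    "\<And>k a b j (x::real^'n::finite). 0 < k \<Longrightarrow>
        x $ j \<notin> {a $ j + 1 / k .. a $ j + 2 / k} \<union> {b $ j - 2 / k .. b $ j - 1 / k} \<Longrightarrow>
        partial_deriv j (cutoff k a b) x = 0"
proof -
  obtain s' C where s': "\<And>x. (smooth_step has_real_derivative s' x) (at x)"
    "\<And>x. \<bar>s' x\<bar> \<le> C" "\<And>x. x < 0 \<or> 1 < x \<Longrightarrow> s' x = 0" "0 \<le> C"
    using smooth_step_derivative by blast
  have bound: "\<bar>partial_deriv j (cutoff k a b) x\<bar> \<le>
      k * \<bar>s' (k * x $ j + (- k * a $ j - 1))\<bar> + k * \<bar>s' ((- k) * x $ j + (k * b $ j - 1))\<bar>"
    if k: "0 < k" for k a b j and x :: "real^'n"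
  proof -
    define \<beta> where "\<beta> i t = smooth_step (k * t + (- k * a $ i - 1)) * smooth_step ((- k) * t + (k * b $ i - 1))"
      for i t
    define d where "d = k * s' (k * x $ j + (- k * a $ j - 1)) * smooth_step ((- k) * x $ j + (k * b $ j - 1))
      + (- k) * s' ((- k) * x $ j + (k * b $ j - 1)) * smooth_step (k * x $ j + (- k * a $ j - 1))"
    have sm: "smooth_upto (Suc 0) (\<beta> i)" for i
      unfolding \<beta>_def[abs_def] by (intro smooth_upto_mult smooth_upto_compose_affine smooth_step_smooth)
    have c: "((\<lambda>t. smooth_step (c * t + e)) has_real_derivative c * s' (c * t + e)) (at t)" for c e t
    proof -
      have "((\<lambda>t. c * t + e) has_real_derivative c) (at t)" by (auto intro!: derivative_eq_intros)
      from DERIV_chain2[where f = smooth_step and g = "\<lambda>t. c * t + e", OF s'(1) this]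
      show ?thesis by (simp add: mult_ac)
    qed
    have d: "(\<beta> j has_real_derivative d) (at (x $ j))"
      unfolding \<beta>_def[abs_def] d_def by (rule DERIV_mult[OF c c])
    have "cutoff k a b = (\<lambda>x. \<beta> j (x $ j) * (\<Prod>i\<in>UNIV - {j}. \<beta> i (x $ i)))"
      unfolding cutoff_def[abs_def] \<beta>_def by (auto simp: prod.remove[of UNIV j])
    then have "partial_deriv j (cutoff k a b) x = d * (\<Prod>i\<in>UNIV - {j}. \<beta> i (x $ i))"
      using partial_deriv_coordinate[OF d] partial_deriv_prod_coordinates_eq_0[of "UNIV - {j}" j \<beta> x] sm
        partial_deriv_mult[where k = 0 and l = 0, of "\<lambda>x. \<beta> j (x $ j)" "\<lambda>x. \<Prod>i\<in>UNIV - {j}. \<beta> i (x $ i)" j x]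
      by (simp add: Ck_coordinate Ck_prod del: Ck.simps smooth_upto.simps)
    moreover have "\<bar>\<Prod>i\<in>UNIV - {j}. \<beta> i (x $ i)\<bar> \<le> 1"
      unfolding abs_prod \<beta>_def
      by (intro prod_le_1) (auto simp: abs_mult smooth_step_bounds intro!: mult_le_one)
    moreover have "\<bar>d\<bar> \<le> k * \<bar>s' (k * x $ j + (- k * a $ j - 1))\<bar> + k * \<bar>s' ((- k) * x $ j + (k * b $ j - 1))\<bar>"
    proof -
      have *: "\<bar>c * s * t\<bar> \<le> k * \<bar>s\<bar>" if "\<bar>c\<bar> = k" "0 \<le> t" "t \<le> 1" for c s t :: real
        using that k mult_left_mono[of t 1 "k * \<bar>s\<bar>"] by (simp add: abs_mult)
      show ?thesis unfolding d_def
        by (rule order_trans[OF abs_triangle_ineq]) (intro add_mono * smooth_step_bounds; use k in simp)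
    qed
    moreover have "\<bar>d * P\<bar> \<le> \<bar>d\<bar>" if "\<bar>P\<bar> \<le> 1" for P
      using mult_left_mono[OF that, of "\<bar>d\<bar>"] by (simp add: abs_mult)
    ultimately show ?thesis by fastforce
  qed
  show ?thesis
  proof (rule that[of "2 * C"])
    show "\<bar>partial_deriv j (cutoff k a b) x\<bar> \<le> 2 * C * k" if "0 < k" for k a b j and x :: "real^'n"
    proof -
      have "k * \<bar>s' t\<bar> \<le> k * C" for t
        using s'(2) that by (intro mult_left_mono) auto
      from add_mono[OF this[of "k * x $ j + (- k * a $ j - 1)"] this[of "(- k) * x $ j + (k * b $ j - 1)"]]
      show ?thesis
        by (intro order_trans[OF bound[OF that, of j a b x]]) (simp add: mult_ac)
    qed
    show "partial_deriv j (cutoff k a b) x = 0"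
      if k: "0 < k" and x: "x $ j \<notin> {a $ j + 1 / k .. a $ j + 2 / k} \<union> {b $ j - 2 / k .. b $ j - 1 / k}"
      for k a b j and x :: "real^'n"
    proof -
      have "s' (k * x $ j + (- k * a $ j - 1)) = 0"
      proof (rule s'(3))
        have "x $ j < a $ j + 1 / k \<or> a $ j + 2 / k < x $ j" using x by auto
        then show "k * x $ j + (- k * a $ j - 1) < 0 \<or> 1 < k * x $ j + (- k * a $ j - 1)"
          using k by (auto simp: field_simps)
      qed
      moreover have "s' ((- k) * x $ j + (k * b $ j - 1)) = 0"
      proof (rule s'(3))
        have "x $ j < b $ j - 2 / k \<or> b $ j - 1 / k < x $ j" using x by auto
        then show "(- k) * x $ j + (k * b $ j - 1) < 0 \<or> 1 < (- k) * x $ j + (k * b $ j - 1)"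
          using k by (auto simp: field_simps)
      qed
      ultimately show ?thesis using bound[OF k, of j a b x] by simp
    qed
  qed (use s' in auto)
qed

section \<open>Test functions: supports, bounds and products\<close>

lemma test_functions_mono: "U \<subseteq> V \<Longrightarrow> test_functions U \<subseteq> test_functions V"
  unfolding test_functions_def by blast

lemma test_function_Ck: "\<phi> \<in> test_functions U \<Longrightarrow> Ck k \<phi>"
  by (simp add: test_functions_def)

lemma test_function_mult:
  assumes "\<xi> \<in> test_functions U" "\<And>k. Ck k \<phi>"
  shows "(\<lambda>x. \<xi> x * \<phi> x) \<in> test_functions U"
proof -
  have sub: "closure {x. \<xi> x * \<phi> x \<noteq> 0} \<subseteq> closure {x. \<xi> x \<noteq> 0}"
    by (rule closure_mono) auto
  have c: "compact (closure {x. \<xi> x \<noteq> 0})" "closure {x. \<xi> x \<noteq> 0} \<subseteq> U"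
    using assms(1) by (auto simp: test_functions_def)
  have "compact (closure {x. \<xi> x * \<phi> x \<noteq> 0})"
    using bounded_subset[OF compact_imp_bounded[OF c(1)] sub] by (simp add: compact_eq_bounded_closed)
  moreover have "Ck k (\<lambda>x. \<xi> x * \<phi> x)" for k
    by (rule Ck_mult[OF test_function_Ck[OF assms(1)] assms(2)])
  ultimately show ?thesis
    using sub c(2) by (simp add: test_functions_def)
qed

lemma partial_deriv_eq_0_outside:
  assumes "closed K" "\<And>x. x \<notin> K \<Longrightarrow> \<phi> x = 0" "x \<notin> K"
  shows "partial_deriv j \<phi> x = 0"
proof -
  have "(\<phi> has_derivative (\<lambda>h. 0)) (at x)"
    by (rule has_derivative_transform_within_open[of "\<lambda>x. 0" _ _ _ "- K"]) (use assms in auto)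
  from partial_deriv_eq[OF this] show ?thesis .
qed

lemma test_function_eq_0:
  assumes "x \<notin> closure {x. \<phi> x \<noteq> 0}"
  shows "\<phi> x = 0" "partial_deriv j \<phi> x = 0"
proof -
  have z: "\<phi> x = 0" if "x \<notin> closure {x. \<phi> x \<noteq> 0}" for x
    using contra_subsetD[OF closure_subset that] by simp
  show "\<phi> x = 0" by (rule z[OF assms])
  show "partial_deriv j \<phi> x = 0" by (rule partial_deriv_eq_0_outside[OF closed_closure z assms])
qed

lemma continuous_compact_support_bounded:
  fixes f :: "'a::euclidean_space \<Rightarrow> real"
  assumes "continuous_on UNIV f" "compact K" "\<And>x. x \<notin> K \<Longrightarrow> f x = 0"
  shows "\<exists>B\<ge>0. \<forall>x. \<bar>f x\<bar> \<le> B"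
proof -
  have "bounded (f ` K)"
    by (intro compact_imp_bounded compact_continuous_image continuous_on_subset[OF assms(1)] assms(2)) auto
  then obtain B where "\<forall>y\<in>f ` K. norm y \<le> B" unfolding bounded_iff by blast
  then have "\<bar>f x\<bar> \<le> max B 0" for x
    using assms(3)[of x] by (cases "x \<in> K") (auto simp: le_max_iff_disj)
  then show ?thesis by (intro exI[of _ "max B 0"]) simp
qed

lemma continuous_compact_support_integrable:
  fixes f :: "'a::euclidean_space \<Rightarrow> real"
  assumes "continuous_on UNIV f" "compact K" "\<And>x. x \<notin> K \<Longrightarrow> f x = 0"
  shows "integrable lebesgue f"
proof -
  have "(\<lambda>x. indicator K x *\<^sub>R f x) = f" using assms(3) by (auto simp: indicator_def fun_eq_iff)
  then have "integrable lborel f"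
    using borel_integrable_compact[OF assms(2) continuous_on_subset[OF assms(1)]] by simp
  then show ?thesis by (subst integrable_completion) (auto dest: borel_measurable_integrable)
qed

lemma test_function_bounded:
  assumes "\<phi> \<in> test_functions U"
  shows "\<exists>B\<ge>0. \<forall>x. \<bar>\<phi> x\<bar> \<le> B"
proof -
  have "compact (closure {x. \<phi> x \<noteq> 0})" using assms by (simp add: test_functions_def)
  from continuous_compact_support_bounded[where f = "\<phi>", OF
      Ck_continuous_on[OF test_function_Ck[OF assms]] this test_function_eq_0(1)[where \<phi> = \<phi>]]
  show ?thesis .
qed

lemma test_function_partial_bounded:
  assumes "\<phi> \<in> test_functions U"
  shows "\<exists>B\<ge>0. \<forall>x. \<bar>partial_deriv j \<phi> x\<bar> \<le> B"
proof -
  have "compact (closure {x. \<phi> x \<noteq> 0})" using assms by (simp add: test_functions_def)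
  from continuous_compact_support_bounded[where f = "partial_deriv j \<phi>", OF
      Ck_partial_continuous_on[OF test_function_Ck[OF assms]] this test_function_eq_0(2)[where \<phi> = \<phi>]]
  show ?thesis .
qed

section \<open>Scaling of integrals and classical integration by parts\<close>

lemma integrable_scaleR_iff:
  fixes f :: "'a \<Rightarrow> 'b::{banach, second_countable_topology}"
  assumes "c \<noteq> 0"
  shows "integrable M (\<lambda>x. c *\<^sub>R f x) \<longleftrightarrow> integrable M f"
  using assms integrable_scaleR_right[of "inverse c" M "\<lambda>x. c *\<^sub>R f x"] by auto

lemma integral_scaled:
  fixes f :: "'a::euclidean_space \<Rightarrow> 'b::{banach, second_countable_topology}"
  assumes c: "c \<noteq> 0"
  shows "(\<lambda>x. t + c *\<^sub>R x) \<in> lebesgue \<rightarrow>\<^sub>M lebesgue"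
    and "f \<in> borel_measurable lebesgue \<Longrightarrow>
      integral\<^sup>L lebesgue f = \<bar>c\<bar> ^ DIM('a) *\<^sub>R (LINT x|lebesgue. f (t + c *\<^sub>R x))"
    and "f \<in> borel_measurable lebesgue \<Longrightarrow>
      integrable lebesgue f \<longleftrightarrow> integrable lebesgue (\<lambda>x. f (t + c *\<^sub>R x))"
proof -
  \<comment> \<open>The affine change of variables for Lebesgue measure allows a separate factor for
    each coordinate; with all factors equal to \<open>c\<close> its map collapses to
    \<open>t + c *\<^sub>R x\<close>.\<close>
  have T: "t + (\<Sum>j\<in>Basis. (c * (x \<bullet> j)) *\<^sub>R j) = t + c *\<^sub>R x" for x :: 'a
    by (simp add: euclidean_representation flip: scaleR_scaleR scaleR_sum_right)
  have m: "(\<lambda>x. t + c *\<^sub>R x) \<in> lebesgue \<rightarrow>\<^sub>M lebesgue"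
    using lebesgue_affine_measurable[of "\<lambda>_. c" t] c by (simp add: T)
  have d: "lebesgue = density (distr lebesgue lebesgue (\<lambda>x. t + c *\<^sub>R x)) (\<lambda>_. ennreal (\<bar>c\<bar> ^ DIM('a)))"
    using lebesgue_affine_euclidean[of "\<lambda>_. c" t] c by (simp add: T)
  show "(\<lambda>x. t + c *\<^sub>R x) \<in> lebesgue \<rightarrow>\<^sub>M lebesgue" by (rule m)
  show "integral\<^sup>L lebesgue f = \<bar>c\<bar> ^ DIM('a) *\<^sub>R (LINT x|lebesgue. f (t + c *\<^sub>R x))"
    if f: "f \<in> borel_measurable lebesgue"
    by (subst d, subst integral_density) (use f m c in \<open>auto simp: integral_distr\<close>)
  show "integrable lebesgue f \<longleftrightarrow> integrable lebesgue (\<lambda>x. f (t + c *\<^sub>R x))"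
    if f: "f \<in> borel_measurable lebesgue"
    by (subst d, subst integrable_density) (use f m c in \<open>auto simp: integrable_distr_eq integrable_scaleR_iff\<close>)
qed

text \<open>Translation invariance makes the integrals of the difference quotients of
  \<open>g\<close> zero, and dominated convergence carries this to the derivative.\<close>

lemma integral_partial_deriv_eq_0:
  fixes g :: "real^'n::finite \<Rightarrow> real"
  assumes g: "Ck (Suc 0) g" and K: "compact K" "\<And>x. x \<notin> K \<Longrightarrow> g x = 0"
  shows "integral\<^sup>L lebesgue (partial_deriv j g) = 0"
proof -
  define e :: "real^'n" where "e = axis j 1"
  define h where "h m x = real (Suc m) * (g (x + inverse (real (Suc m)) *\<^sub>R e) - g x)" for m x
  have gc: "continuous_on UNIV g" "continuous_on UNIV (partial_deriv j g)"
    using Ck_continuous_on[OF g] Ck_partial_continuous_on[OF g] by auto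
  have z: "partial_deriv j g x = 0" if "x \<notin> K" for x
    using partial_deriv_eq_0_outside[OF compact_imp_closed[OF K(1)] K(2) that] .
  obtain B where B: "\<And>x. \<bar>partial_deriv j g x\<bar> \<le> B" "0 \<le> B"
    using continuous_compact_support_bounded[OF gc(2) K(1) z] by blast
  have der: "((\<lambda>t. g (x + t *\<^sub>R e)) has_real_derivative partial_deriv j g (x + t *\<^sub>R e)) (at t)" for x t
  proof -
    have "((\<lambda>t. x + t *\<^sub>R e) has_derivative (\<lambda>s. s *\<^sub>R e)) (at t)"
      by (auto intro!: derivative_eq_intros)
    from has_derivative_compose[OF this Ck_has_derivative[OF g]]
    have "((\<lambda>t. g (x + t *\<^sub>R e)) has_derivative
        (\<lambda>s. frechet_derivative g (at (x + t *\<^sub>R e)) (s *\<^sub>R e))) (at t)" .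
    moreover have "linear (frechet_derivative g (at (x + t *\<^sub>R e)))"
      using Ck_differentiable[OF g] linear_frechet_derivative by blast
    ultimately show ?thesis
      by (simp add: has_field_derivative_def partial_deriv_def e_def linear_scale mult_commute_abs)
  qed
  obtain R where R: "\<And>x. x \<in> K \<Longrightarrow> norm x \<le> R"
    using compact_imp_bounded[OF K(1)] unfolding bounded_iff by blast
  have ne: "norm e = 1" by (simp add: e_def)
  \<comment> \<open>The step length is at most 1, so both points of the difference quotient miss
    \<open>K\<close> outside the ball of radius \<open>R + 1\<close>; inside, the mean value theorem
    gives the bound \<open>B\<close>.\<close>
  have hb: "\<bar>h m x\<bar> \<le> B * indicator (cball 0 (R + 1)) x" for m x
  proof (cases "x \<in> cball 0 (R + 1)")
    case True
    let ?d = "inverse (real (Suc m))"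
    have "\<exists>t>0. t < ?d \<and> g (x + ?d *\<^sub>R e) - g (x + 0 *\<^sub>R e) = (?d - 0) * partial_deriv j g (x + t *\<^sub>R e)"
      by (rule MVT2) (use der in auto)
    then obtain t where "g (x + ?d *\<^sub>R e) - g x = ?d * partial_deriv j g (x + t *\<^sub>R e)" by auto
    then have "h m x = partial_deriv j g (x + t *\<^sub>R e)"
      unfolding h_def by (simp add: field_simps del: of_nat_Suc)
    then show ?thesis using B True by simp
  next
    case False
    have "norm (inverse (real (Suc m)) *\<^sub>R e) \<le> 1"
      using ne by (simp add: inverse_eq_divide)
    then have "norm (x + inverse (real (Suc m)) *\<^sub>R e) > R" "norm x > R"
      using False norm_triangle_ineq2[of x "- (inverse (real (Suc m)) *\<^sub>R e)"] by auto
    then have "x + inverse (real (Suc m)) *\<^sub>R e \<notin> K" "x \<notin> K"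
      using R[of x] R[of "x + inverse (real (Suc m)) *\<^sub>R e"] by (meson not_le)+
    then show ?thesis using B(2) by (simp add: h_def K(2))
  qed
  have hl: "(\<lambda>m. h m x) \<longlonglongrightarrow> partial_deriv j g x" for x
  proof -
    have "((\<lambda>t. (g (x + t *\<^sub>R e) - g x) / t) \<longlongrightarrow> partial_deriv j g x) (at 0)"
      using der[of x 0] by (simp add: DERIV_def)
    moreover have "filterlim (\<lambda>m. inverse (real (Suc m))) (at 0) sequentially"
      unfolding filterlim_at using LIMSEQ_inverse_real_of_nat by auto
    ultimately have "((\<lambda>m. (g (x + inverse (real (Suc m)) *\<^sub>R e) - g x) / inverse (real (Suc m))) \<longlongrightarrow> partial_deriv j g x) sequentially"
      by (rule filterlim_compose)
    then show ?thesis by (simp add: h_def divide_inverse mult.commute)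
  qed
  have gi: "integrable lebesgue g"
    by (rule continuous_compact_support_integrable[OF gc(1) K])
  have sh: "(LINT x|lebesgue. g (x + v)) = integral\<^sup>L lebesgue g"
      "integrable lebesgue (\<lambda>x. g (x + v))" for v
    using integral_scaled(2,3)[of 1 g v] gi borel_measurable_integrable[OF gi]
    by (simp_all add: add.commute[of v])
  have "integral\<^sup>L lebesgue (h m) = 0" for m
    unfolding h_def by (simp add: sh gi del: of_nat_Suc)
  moreover have "(\<lambda>m. integral\<^sup>L lebesgue (h m)) \<longlonglongrightarrow> integral\<^sup>L lebesgue (partial_deriv j g)"
  proof (rule integral_dominated_convergence[where w = "\<lambda>x. B * indicator (cball 0 (R + 1)) x"])
    show "partial_deriv j g \<in> borel_measurable lebesgue"
      using continuous_compact_support_integrable[OF gc(2) K(1) z] by auto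
    show "h m \<in> borel_measurable lebesgue" for m
      unfolding h_def using sh(2) gi by auto
    show "integrable lebesgue (\<lambda>x. B * indicator (cball 0 (R + 1)) x)"
      by (intro integrable_mult_right integrable_real_indicator) (auto simp: emeasure_lborel_cball_finite[unfolded infinity_ennreal_def])
  qed (use hl hb in auto)
  ultimately show ?thesis by (simp add: LIMSEQ_const_iff)
qed

text \<open>The product of \<open>w\<close> and \<open>\<phi>\<close> has compact support, so no
  growth condition on \<open>w\<close> enters. This allows \<open>w\<close> to be a coordinate
  function or a component of a smooth map.\<close>

lemma integral_by_parts:
  fixes w \<phi> :: "real^'n::finite \<Rightarrow> real"
  assumes w: "Ck (Suc 0) w" and \<phi>: "\<phi> \<in> test_functions UNIV"
  shows "(LINT x|lebesgue. w x * partial_deriv j \<phi> x) = - (LINT x|lebesgue. partial_deriv j w x * \<phi> x)"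
    "integrable lebesgue (\<lambda>x. w x * partial_deriv j \<phi> x)"
    "integrable lebesgue (\<lambda>x. partial_deriv j w x * \<phi> x)"
proof -
  define K where "K = closure {x. \<phi> x \<noteq> 0}"
  have p: "Ck (Suc 0) \<phi>" by (rule test_function_Ck[OF \<phi>])
  have K: "compact K" using \<phi> by (simp add: test_functions_def K_def)
  have z: "\<phi> x = 0" "partial_deriv j \<phi> x = 0" if "x \<notin> K" for x
    using test_function_eq_0[of x \<phi>] that unfolding K_def by blast+
  show i: "integrable lebesgue (\<lambda>x. w x * partial_deriv j \<phi> x)"
    "integrable lebesgue (\<lambda>x. partial_deriv j w x * \<phi> x)"
    by (rule continuous_compact_support_integrable[OF _ K];
        simp add: z continuous_on_mult Ck_continuous_on[OF w] Ck_continuous_on[OF p]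
          Ck_partial_continuous_on[OF w] Ck_partial_continuous_on[OF p])+
  have "integral\<^sup>L lebesgue (partial_deriv j (\<lambda>x. w x * \<phi> x)) = 0"
    by (rule integral_partial_deriv_eq_0[OF Ck_mult[OF w p] K]) (simp add: z)
  moreover have "partial_deriv j (\<lambda>x. w x * \<phi> x) = (\<lambda>x. w x * partial_deriv j \<phi> x + partial_deriv j w x * \<phi> x)"
    using partial_deriv_mult[OF w p] by auto
  ultimately have "(LINT x|lebesgue. w x * partial_deriv j \<phi> x + partial_deriv j w x * \<phi> x) = 0"
    by simp
  then show "(LINT x|lebesgue. w x * partial_deriv j \<phi> x) = - (LINT x|lebesgue. partial_deriv j w x * \<phi> x)"
    using i by simp
qed

section \<open>From testing with smooth functions to testing with bounded measurable
  functions\<close>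

section \<open>Weak convergence\<close>

lemma integrable_bounded_mult:
  fixes w f :: "'a \<Rightarrow> real"
  assumes "integrable M f" "w \<in> borel_measurable M" "\<And>x. \<bar>w x\<bar> \<le> B"
  shows "integrable M (\<lambda>x. w x * f x)"
proof (rule Bochner_Integration.integrable_bound)
  show "integrable M (\<lambda>x. B * \<bar>f x\<bar>)" using assms(1) by auto
  show "AE x in M. norm (w x * f x) \<le> norm (B * \<bar>f x\<bar>)"
  proof (intro AE_I2)
    fix x
    have "\<bar>w x\<bar> * \<bar>f x\<bar> \<le> B * \<bar>f x\<bar>" using assms(3) by (intro mult_right_mono) auto
    then have "\<bar>w x * f x\<bar> \<le> \<bar>B * \<bar>f x\<bar>\<bar>"
      unfolding abs_mult by (rule order_trans) (auto intro: mult_right_mono)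
    then show "norm (w x * f x) \<le> norm (B * \<bar>f x\<bar>)" by simp
  qed
qed (use assms in measurable)

text \<open>Uniform integrability enters as a dominated convergence property that holds uniformly
  along the sequence \<open>D\<close>.\<close>

lemma set_integrals_tendsto_0:
  fixes D :: "nat \<Rightarrow> real^'n::finite \<Rightarrow> real"
  assumes int: "\<And>k. integrable lebesgue (D k)"
    and zero: "\<And>k x. x \<notin> box c d \<Longrightarrow> D k x = 0"
    and equi: "\<And>w e. \<lbrakk>\<And>m. w m \<in> borel_measurable lebesgue; \<And>m x. 0 \<le> w m x \<and> w m x \<le> (1::real);
        \<And>x. (\<lambda>m. w m x) \<longlonglongrightarrow> 0; 0 < e\<rbrakk> \<Longrightarrow>
        \<exists>m. \<forall>k. (LINT x|lebesgue. w m x * \<bar>D k x\<bar>) \<le> e"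
    and test: "\<And>\<phi>. \<phi> \<in> test_functions (box c d) \<Longrightarrow>
        (\<lambda>k. (LINT x|lebesgue. \<phi> x * D k x)) \<longlonglongrightarrow> 0"
    and S: "S \<in> sets lebesgue"
  shows "(\<lambda>k. (LINT x|lebesgue. indicator S x * D k x)) \<longlonglongrightarrow> 0"
proof -
  let ?I = "\<lambda>S k. (LINT x|lebesgue. indicator S x * D k x)"
  have ii: "integrable lebesgue (\<lambda>x. indicator A x * D k x)" if "A \<in> sets lebesgue" for A k
    using that by (intro integrable_bounded_mult[where B = 1] int) (auto simp: indicator_def)
  \<comment> \<open>An inner approximation \<open>v m\<close> of an indicator suffices:
    \<open>equi\<close> applied to \<open>indicator A - v m\<close> yields one \<open>m\<close>
    whose error is small for all \<open>k\<close>, which permits exchanging the two limits. It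
    serves for cutoffs of boxes as well as for partial unions.\<close>
  have approx: "?I A \<longlonglongrightarrow> 0"
    if A: "A \<in> sets lebesgue"
      and v: "\<And>m. v m \<in> borel_measurable lebesgue" "\<And>m x. 0 \<le> v m x" "\<And>m x. v m x \<le> indicator A x"
        "\<And>x. (\<lambda>m. v m x) \<longlonglongrightarrow> indicator A x"
        "\<And>m. (\<lambda>k. (LINT x|lebesgue. v m x * D k x)) \<longlonglongrightarrow> 0" for A and v :: "nat \<Rightarrow> real^'n \<Rightarrow> real"
  proof (rule LIMSEQ_I)
    fix r :: real assume "0 < r"
    have "\<exists>m. \<forall>k. (LINT x|lebesgue. (indicator A x - v m x) * \<bar>D k x\<bar>) \<le> r / 2"
    proof (rule equi)
      show "(\<lambda>x. indicator A x - v m x) \<in> borel_measurable lebesgue" for m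
        using A v(1) by measurable
      show "0 \<le> indicator A x - v m x \<and> indicator A x - v m x \<le> 1" for m x
        using v(2,3)[of m x] by (cases "x \<in> A") auto
      show "(\<lambda>m. indicator A x - v m x) \<longlonglongrightarrow> 0" for x
        using tendsto_diff[OF tendsto_const v(4)[of x], of "indicator A x"] by simp
    qed (use \<open>0 < r\<close> in simp)
    then obtain m where m: "(LINT x|lebesgue. (indicator A x - v m x) * \<bar>D k x\<bar>) \<le> r / 2" for k
      by blast
    have vb: "\<bar>v m x\<bar> \<le> 1" for x
      using v(2,3)[of m x] by (cases "x \<in> A") auto
    have vi: "integrable lebesgue (\<lambda>x. v m x * D k x)" for k
      by (intro integrable_bounded_mult[where B = 1] int v(1) vb)
    have wi: "integrable lebesgue (\<lambda>x. (indicator A x - v m x) * D k x)" for k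
      using Bochner_Integration.integrable_diff[OF ii[OF A] vi, of k k] by (simp add: left_diff_distrib)
    have bnd: "\<bar>?I A k\<bar> \<le> \<bar>(LINT x|lebesgue. v m x * D k x)\<bar> + r / 2" for k
    proof -
      have "?I A k = (LINT x|lebesgue. v m x * D k x + (indicator A x - v m x) * D k x)"
        by (simp add: algebra_simps)
      also have "\<dots> = (LINT x|lebesgue. v m x * D k x) + (LINT x|lebesgue. (indicator A x - v m x) * D k x)"
        by (rule Bochner_Integration.integral_add[OF vi wi])
      finally have split: "?I A k = \<dots>" .
      have "norm ((indicator A x - v m x) * D k x) = (indicator A x - v m x) * \<bar>D k x\<bar>" for x
        using v(3)[of m x] by (simp add: abs_mult)
      then have "\<bar>(LINT x|lebesgue. (indicator A x - v m x) * D k x)\<bar>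
          \<le> (LINT x|lebesgue. (indicator A x - v m x) * \<bar>D k x\<bar>)"
        using integral_norm_bound[of lebesgue "\<lambda>x. (indicator A x - v m x) * D k x"] by simp
      then show ?thesis using m[of k] split by linarith
    qed
    obtain k0 where k0: "\<And>k. k \<ge> k0 \<Longrightarrow> \<bar>(LINT x|lebesgue. v m x * D k x)\<bar> < r / 2"
      using LIMSEQ_D[OF v(5)[of m], of "r / 2"] \<open>0 < r\<close> by (metis diff_zero half_gt_zero real_norm_def)
    have "\<bar>?I A k\<bar> < r" if "k \<ge> k0" for k
      using bnd[of k] k0[OF that] by linarith
    then show "\<exists>k0. \<forall>k\<ge>k0. norm (?I A k - 0) < r" by auto
  qed
  have boxes: "?I (box a b) \<longlonglongrightarrow> 0" if ab: "box a b \<subseteq> box c d" for a b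
  proof (rule approx[where v = "\<lambda>m. cutoff (real (Suc m)) a b"])
    show "cutoff (real (Suc m)) a b \<in> borel_measurable lebesgue" for m
      using Ck_continuous_on[OF Ck_cutoff[of 0], of UNIV]
      by (intro measurable_completion) (auto intro: borel_measurable_continuous_onI)
    show "cutoff (real (Suc m)) a b x \<le> indicator (box a b) x" for m x
      using cutoff_bounds(2)[of "real (Suc m)" a b x] cutoff_eq_0_outside[of "real (Suc m)" x a b]
      by (auto simp: indicator_def)
    show "(\<lambda>m. cutoff (real (Suc m)) a b x) \<longlonglongrightarrow> indicator (box a b) x" for x
    proof (cases "x \<in> box a b")
      case True
      then show ?thesis using cutoff_tendsto by simp
    next
      case False
      then show ?thesis using cutoff_eq_0_outside[of "real (Suc _)" x a b] by simp
    qed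
    show "(\<lambda>k. (LINT x|lebesgue. cutoff (real (Suc m)) a b x * D k x)) \<longlonglongrightarrow> 0" for m
      by (intro test cutoff_test_function ab) simp
  qed (auto simp: cutoff_bounds)
  have whole: "(\<lambda>k. integral\<^sup>L lebesgue (D k)) \<longlonglongrightarrow> 0"
  proof -
    have "(\<lambda>x. indicator (box c d) x * D k x) = D k" for k
      by (rule ext) (use zero in \<open>auto simp: indicator_def\<close>)
    then show ?thesis using boxes[of c d] by simp
  qed
  have st: "Int_stable (range (\<lambda>(a, b). box a b :: (real^'n) set))"
    by (auto simp: Int_stable_def box_Int_box)
  have pw: "range (\<lambda>(a, b). box a b :: (real^'n) set) \<subseteq> Pow UNIV" by simp
  \<comment> \<open>Boxes are stable under intersection and generate the Borel sets, so Dynkin's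
    theorem applies. Complements are handled by the convergence of the total integrals,
    \<open>whole\<close>.\<close>
  have "?I A \<longlonglongrightarrow> 0" if "A \<in> sigma_sets UNIV (range (\<lambda>(a, b). box a b :: (real^'n) set))" for A
    using st pw that
  proof (induct rule: sigma_sets_induct_disjoint)
    fix A assume "A \<in> range (\<lambda>(a, b). box a b :: (real^'n) set)"
    then obtain a b where A: "A = box a b" by auto
    obtain a' b' where i: "box a b \<inter> box c d = box a' b'" by (auto simp: box_Int_box)
    have eq: "(\<lambda>x. indicator A x * D k x) = (\<lambda>x. indicator (box a' b') x * D k x)" for k
    proof
      show "indicator A x * D k x = indicator (box a' b') x * D k x" for x
        using zero[of x k] unfolding A i[symmetric] by (auto simp: indicator_def)
    qed
    have "box a' b' \<subseteq> box c d" unfolding i[symmetric] by (rule Int_lower2)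
    from boxes[OF this] show "?I A \<longlonglongrightarrow> 0" unfolding eq .
  next
    fix A assume A: "A \<in> sigma_sets UNIV (range (\<lambda>(a, b). box a b :: (real^'n) set))" and IH: "?I A \<longlonglongrightarrow> 0"
    have "A \<in> sets borel" using A by (simp add: borel_eq_box)
    then have Al: "A \<in> sets lebesgue" by auto
    have "?I (UNIV - A) k = integral\<^sup>L lebesgue (D k) - ?I A k" for k
      by (subst Bochner_Integration.integral_diff[symmetric, OF int ii[OF Al]])
        (auto intro!: Bochner_Integration.integral_cong simp: indicator_def)
    then show "?I (UNIV - A) \<longlonglongrightarrow> 0" using tendsto_diff[OF whole IH] by simp
  next
    fix A :: "nat \<Rightarrow> (real^'n) set"
    assume dj: "disjoint_family A" and A: "range A \<subseteq> sigma_sets UNIV (range (\<lambda>(a, b). box a b))"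
      and IH: "\<And>i. ?I (A i) \<longlonglongrightarrow> 0"
    have Ab: "A i \<in> sets borel" for i
      unfolding borel_eq_box using range_subsetD[OF A, of i] by simp
    then have Al: "A i \<in> sets lebesgue" for i by auto
    have Ul: "(\<Union>i. A i) \<in> sets lebesgue" using Al by auto
    show "?I (\<Union>i. A i) \<longlonglongrightarrow> 0"
    proof (rule approx[where v = "\<lambda>m. indicator (\<Union>i<m. A i)", OF Ul])
      have ul: "(\<Union>i<m. A i) \<in> sets lebesgue" for m using Al by auto
      then show "indicator (\<Union>i<m. A i) \<in> borel_measurable lebesgue" for m by measurable
      show "(\<lambda>m. indicator (\<Union>i<m. A i) x :: real) \<longlonglongrightarrow> indicator (\<Union>i. A i) x" for x
      proof (cases "x \<in> (\<Union>i. A i)")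
        case True
        then obtain i where "x \<in> A i" by auto
        then have "\<forall>\<^sub>F m in sequentially. indicator (\<Union>i. A i) x = (indicator (\<Union>i<m. A i) x :: real)"
          by (intro eventually_sequentiallyI[of "Suc i"]) (auto simp: indicator_def)
        then show ?thesis by (rule Lim_transform_eventually[OF tendsto_const])
      next
        case False
        then have "indicator (\<Union>i<m. A i) x = (0::real)" for m by (auto simp: indicator_def)
        then show ?thesis using False by simp
      qed
      show "?I (\<Union>i<m. A i) \<longlonglongrightarrow> 0" for m
      proof (induction m)
        case (Suc m)
        have "?I (\<Union>i<Suc m. A i) k = ?I (\<Union>i<m. A i) k + ?I (A m) k" for k
        proof (subst Bochner_Integration.integral_add[symmetric, OF ii[OF ul] ii[OF Al]],
            rule Bochner_Integration.integral_cong[OF refl])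
          fix x
          have "A m \<inter> A i = {}" if "i < m" for i
            using dj that by (intro disjoint_family_onD[OF dj]) auto
          then have "A m \<inter> (\<Union>i<m. A i) = {}" by blast
          then show "indicator (\<Union>i<Suc m. A i) x * D k x =
              indicator (\<Union>i<m. A i) x * D k x + indicator (A m) x * D k x"
            by (auto simp: indicator_def lessThan_Suc)
        qed
        then show ?case using tendsto_add[OF Suc IH[of m]] by simp
      qed simp
    qed (auto simp: indicator_def)
  qed simp
  then have borel: "?I A \<longlonglongrightarrow> 0" if "A \<in> sets borel" for A
    using that by (simp add: borel_eq_box)
  \<comment> \<open>A Lebesgue set differs from a Borel set only inside a null set, which the
    integrals do not see.\<close>
  obtain A N N' where A: "S = A \<union> N" "N \<subseteq> N'" "N' \<in> null_sets lborel" "A \<in> sets lborel"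
    using S by (rule sets_completionE)
  have ae: "AE x in lebesgue. x \<notin> N'"
    using null_sets_completionI[OF A(3)] by (rule AE_not_in)
  have "?I S k = ?I A k" for k
  proof (rule integral_cong_AE)
    show "AE x in lebesgue. indicator S x * D k x = indicator A x * D k x"
      using ae by eventually_elim (use A in \<open>auto simp: indicator_def\<close>)
    have "integrable lebesgue (\<lambda>x. indicator A x * D k x)" by (rule ii) (use A in auto)
    then show "(\<lambda>x. indicator A x * D k x) \<in> borel_measurable lebesgue"
      by (rule borel_measurable_integrable)
  qed (rule borel_measurable_integrable[OF ii[OF S]])
  then show ?thesis using borel[of A] A(4) by simp
qed

text \<open>Where |D| exceeds \<open>K\<close>, it is at most K^(1-p) |D|^p, whose integral is small
  uniformly in \<open>k\<close> for large \<open>K\<close>. Where |D| is at most \<open>K\<close>,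
  the integrand is at most \<open>K\<close> times \<open>w m\<close> on a box, and this no longer
  depends on \<open>k\<close>.\<close>

lemma uniformly_integrable_if_bounded_Lp:
  fixes D :: "nat \<Rightarrow> 'a::euclidean_space \<Rightarrow> real"
  assumes p: "1 < p"
    and int: "\<And>k. integrable lebesgue (D k)"
    and zero: "\<And>k x. x \<notin> box c d \<Longrightarrow> D k x = 0"
    and Lp: "\<And>k. integrable lebesgue (\<lambda>x. \<bar>D k x\<bar> powr p)"
      "\<And>k. (LINT x|lebesgue. \<bar>D k x\<bar> powr p) \<le> C"
    and w: "\<And>m. w m \<in> borel_measurable lebesgue" "\<And>m x. 0 \<le> w m x \<and> w m x \<le> (1::real)"
      "\<And>x. (\<lambda>m. w m x) \<longlonglongrightarrow> 0" and "0 < e"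
  shows "\<exists>m. \<forall>k. (LINT x|lebesgue. w m x * \<bar>D k x\<bar>) \<le> e"
proof -
  have "((\<lambda>K. K powr (1 - p)) \<longlongrightarrow> 0) at_top"
    using tendsto_neg_powr[of "1 - p" "\<lambda>K. K" at_top] p by (auto simp: filterlim_ident)
  from tendsto_mult[OF this tendsto_const[of C]]
  have "((\<lambda>K. K powr (1 - p) * C) \<longlongrightarrow> 0) at_top" by simp
  then have "\<forall>\<^sub>F K in at_top. K powr (1 - p) * C < e / 2"
    using \<open>0 < e\<close> by (intro order_tendstoD) auto
  then obtain K0 where K0: "\<And>K. K \<ge> K0 \<Longrightarrow> K powr (1 - p) * C < e / 2"
    unfolding eventually_at_top_linorder by blast
  define K where "K = max K0 1"
  have K: "0 < K" "K powr (1 - p) * C < e / 2" using K0[of K] by (auto simp: K_def)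
  let ?w = "\<lambda>m x. indicator (box c d) x * w m x"
  have wi: "integrable lebesgue (?w m)" for m
  proof (rule Bochner_Integration.integrable_bound)
    show "integrable lebesgue (indicat_real (box c d))"
      by (intro integrable_real_indicator) (auto simp: emeasure_lborel_box_finite[unfolded infinity_ennreal_def])
    show "AE x in lebesgue. norm (?w m x) \<le> norm (indicat_real (box c d) x)"
      using w(2)[of m] by (auto simp: indicator_def)
    show "?w m \<in> borel_measurable lebesgue"
      by (intro borel_measurable_times borel_measurable_indicator w(1)) simp
  qed
  have "(\<lambda>m. integral\<^sup>L lebesgue (?w m)) \<longlonglongrightarrow> integral\<^sup>L lebesgue (\<lambda>x::'a. 0 :: real)"
  proof (rule integral_dominated_convergence[where w = "indicat_real (box c d)"])
    show "integrable lebesgue (indicat_real (box c d))"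
      by (intro integrable_real_indicator) (auto simp: emeasure_lborel_box_finite[unfolded infinity_ennreal_def])
    show "AE x in lebesgue. (\<lambda>m. ?w m x) \<longlonglongrightarrow> 0"
      using tendsto_mult[OF tendsto_const w(3)] by simp
    show "AE x in lebesgue. norm (?w m x) \<le> indicat_real (box c d) x" for m
      using w(2)[of m] by (auto simp: indicator_def)
  qed (use wi in auto)
  then have "\<forall>\<^sub>F m in sequentially. integral\<^sup>L lebesgue (?w m) < e / 2 / K"
    using \<open>0 < e\<close> K(1) by (intro order_tendstoD) auto
  then obtain m where m: "integral\<^sup>L lebesgue (?w m) < e / 2 / K"
    by (auto simp: eventually_sequentially)
  have "(LINT x|lebesgue. w m x * \<bar>D k x\<bar>) \<le> e" for k
  proof -
    have pt: "w m x * \<bar>D k x\<bar> \<le> K * ?w m x + K powr (1 - p) * \<bar>D k x\<bar> powr p" for x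
    proof (cases "\<bar>D k x\<bar> \<le> K")
      case True
      have "w m x * \<bar>D k x\<bar> \<le> K * ?w m x"
        using zero[of x k] w(2)[of m x] mult_left_mono[OF True, of "w m x"]
        by (cases "x \<in> box c d") (auto simp: mult.commute)
      then show ?thesis by (rule order_trans) simp
    next
      case False
      then have D: "0 < \<bar>D k x\<bar>" "K \<le> \<bar>D k x\<bar>" using K(1) by auto
      have "w m x * \<bar>D k x\<bar> \<le> \<bar>D k x\<bar>" using w(2)[of m x] by (simp add: mult_left_le_one_le)
      also have "\<dots> = \<bar>D k x\<bar> powr (1 - p) * \<bar>D k x\<bar> powr p"
        using D by (simp flip: powr_add)
      also have "\<dots> \<le> K powr (1 - p) * \<bar>D k x\<bar> powr p"
        using D K(1) p by (intro mult_right_mono powr_mono2') auto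
      also have "\<dots> \<le> K * ?w m x + K powr (1 - p) * \<bar>D k x\<bar> powr p"
        using K(1) w(2)[of m x] by simp
      finally show ?thesis .
    qed
    have "(LINT x|lebesgue. w m x * \<bar>D k x\<bar>)
        \<le> (LINT x|lebesgue. K * ?w m x + K powr (1 - p) * \<bar>D k x\<bar> powr p)"
    proof (rule integral_mono')
      show "0 \<le> K * ?w m x + K powr (1 - p) * \<bar>D k x\<bar> powr p" for x
        using K(1) w(2)[of m x] by simp
    qed (use wi Lp pt in auto)
    also have "\<dots> = K * integral\<^sup>L lebesgue (?w m) + K powr (1 - p) * (LINT x|lebesgue. \<bar>D k x\<bar> powr p)"
      using wi Lp by (subst Bochner_Integration.integral_add) auto
    also have "\<dots> \<le> K * (e / 2 / K) + K powr (1 - p) * C"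
      using m Lp(2)[of k] K(1) by (intro add_mono mult_left_mono) auto
    also have "\<dots> \<le> e" using K by simp
    finally show ?thesis .
  qed
  then show ?thesis by blast
qed

text \<open>The version for a single function, which lets \<open>set_integrals_tendsto_0\<close> be
  used on constant sequences.\<close>

lemma integrable_uniformly_integrable:
  fixes D :: "'a \<Rightarrow> real"
  assumes int: "integrable M D"
    and w: "\<And>m. w m \<in> borel_measurable M" "\<And>m x. 0 \<le> w m x \<and> w m x \<le> (1::real)"
      "\<And>x. (\<lambda>m. w m x) \<longlonglongrightarrow> 0" and "0 < e"
  shows "\<exists>m. (LINT x|M. w m x * \<bar>D x\<bar>) \<le> e"
proof -
  have "(\<lambda>m. (LINT x|M. w m x * \<bar>D x\<bar>)) \<longlonglongrightarrow> integral\<^sup>L M (\<lambda>x::'a. 0 :: real)"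
  proof (rule integral_dominated_convergence[where w = "\<lambda>x. \<bar>D x\<bar>"])
    show "AE x in M. (\<lambda>m. w m x * \<bar>D x\<bar>) \<longlonglongrightarrow> 0"
      using tendsto_mult[OF w(3) tendsto_const] by simp
    show "AE x in M. norm (w m x * \<bar>D x\<bar>) \<le> \<bar>D x\<bar>" for m
      using w(2)[of m] by (auto simp: abs_mult intro!: AE_I2 mult_left_le_one_le)
  qed (use int w(1) in auto)
  then have "\<forall>\<^sub>F m in sequentially. (LINT x|M. w m x * \<bar>D x\<bar>) < e"
    using \<open>0 < e\<close> by (intro order_tendstoD) auto
  then show ?thesis by (auto simp: eventually_sequentially intro: less_imp_le)
qed

text \<open>The fundamental lemma of the calculus of variations, read off from
  \<open>set_integrals_tendsto_0\<close> for a constant sequence.\<close>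

lemma AE_eq_0_if_test_integrals_eq_0:
  fixes D :: "real^'n::finite \<Rightarrow> real"
  assumes int: "integrable lebesgue D"
    and zero: "\<And>x. x \<notin> box c d \<Longrightarrow> D x = 0"
    and test: "\<And>\<phi>. \<phi> \<in> test_functions (box c d) \<Longrightarrow> (LINT x|lebesgue. \<phi> x * D x) = 0"
  shows "AE x in lebesgue. D x = 0"
proof (rule density_unique_real[OF int integrable_zero])
  fix S :: "(real^'n) set" assume "S \<in> sets lebesgue"
  then have "(\<lambda>k::nat. (LINT x|lebesgue. indicator S x * D x)) \<longlonglongrightarrow> 0"
    using integrable_uniformly_integrable[OF int] test
    by (intro set_integrals_tendsto_0[where c = c and d = d]) (auto simp: int zero)
  then show "(\<integral>x\<in>S. D x \<partial>lebesgue) = (\<integral>x\<in>S. 0 \<partial>lebesgue)"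
    by (simp add: set_lebesgue_integral_def LIMSEQ_const_iff)
qed

text \<open>Rounding \<open>N * \<Psi>\<close> down to integers gives a simple function within 1/N
  of \<open>\<Psi>\<close>. The bound on the L1 norms controls the error uniformly in
  \<open>k\<close>, and the simple function reduces to finitely many sets.\<close>

lemma bounded_integrals_tendsto_0:
  fixes D :: "nat \<Rightarrow> 'a \<Rightarrow> real"
  assumes int: "\<And>k. integrable M (D k)"
    and L1: "\<And>k. (LINT x|M. \<bar>D k x\<bar>) \<le> C"
    and sets: "\<And>S. S \<in> sets M \<Longrightarrow> (\<lambda>k. (LINT x|M. indicator S x * D k x)) \<longlonglongrightarrow> 0"
    and \<Psi>: "\<Psi> \<in> borel_measurable M" "\<And>x. \<bar>\<Psi> x\<bar> \<le> (B::real)"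
  shows "(\<lambda>k. (LINT x|M. \<Psi> x * D k x)) \<longlonglongrightarrow> 0"
proof (rule LIMSEQ_I)
  fix r :: real assume r: "0 < r"
  have C: "0 \<le> C" using L1[of 0] by (rule order_trans[rotated]) simp
  \<comment> \<open>Chosen so that C/N < r/2; the added 1 keeps \<open>N\<close> positive when
    \<open>C\<close> is 0.\<close>
  define N where "N = (C + 1) * 2 / r"
  have N: "0 < N" using C r by (simp add: N_def)
  define J where "J = {\<lfloor>- (N * B)\<rfloor> .. \<lfloor>N * B\<rfloor>}"
  define A where "A j = {x \<in> space M. \<lfloor>N * \<Psi> x\<rfloor> = j}" for j
  define P where "P x = (\<Sum>j\<in>J. (of_int j / N) * indicator (A j) x)" for x
  have Am: "A j \<in> sets M" for j unfolding A_def using \<Psi>(1) by measurable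
  have P: "P x = of_int \<lfloor>N * \<Psi> x\<rfloor> / N" if "x \<in> space M" for x
  proof -
    have "- (N * B) \<le> N * \<Psi> x" "N * \<Psi> x \<le> N * B"
      using \<Psi>(2)[of x] N mult_left_mono[of "- B" "\<Psi> x" N] by (auto simp: abs_le_iff)
    then have "\<lfloor>N * \<Psi> x\<rfloor> \<in> J" unfolding J_def by (auto intro: floor_mono)
    then have "P x = (\<Sum>j\<in>{\<lfloor>N * \<Psi> x\<rfloor>}. (of_int j / N) * indicator (A j) x)"
      unfolding P_def using that by (intro sum.mono_neutral_right) (auto simp: J_def A_def indicator_def)
    then show ?thesis using that by (simp add: A_def)
  qed
  have close: "\<bar>\<Psi> x - P x\<bar> \<le> 1 / N" if "x \<in> space M" for x
  proof -
    have "\<bar>N * \<Psi> x - of_int \<lfloor>N * \<Psi> x\<rfloor>\<bar> \<le> 1" by linarith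
    moreover have "\<Psi> x - P x = (N * \<Psi> x - of_int \<lfloor>N * \<Psi> x\<rfloor>) / N"
      using P[OF that] N by (simp add: field_simps)
    ultimately show ?thesis using N by (simp add: abs_divide divide_right_mono)
  qed
  have ii: "integrable M (\<lambda>x. indicator (A j) x * D k x)" for j k
    using Am by (intro integrable_bounded_mult[where B = 1] int) (auto simp: indicator_def)
  have Pe: "P x * D k x = (\<Sum>j\<in>J. (of_int j / N) * (indicator (A j) x * D k x))" for k x
    by (simp add: P_def sum_distrib_right mult.assoc)
  have Pi: "integrable M (\<lambda>x. P x * D k x)" for k
    unfolding Pe by (intro Bochner_Integration.integrable_sum integrable_mult_right ii)
  have \<Psi>i: "integrable M (\<lambda>x. \<Psi> x * D k x)" for k
    by (intro integrable_bounded_mult[where B = B] int \<Psi>)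
  have "(\<lambda>k. \<Sum>j\<in>J. (of_int j / N) * (LINT x|M. indicator (A j) x * D k x)) \<longlonglongrightarrow> (\<Sum>j\<in>J. (of_int j / N) * 0)"
    by (intro tendsto_intros sets Am)
  moreover have "(LINT x|M. P x * D k x) = (\<Sum>j\<in>J. (of_int j / N) * (LINT x|M. indicator (A j) x * D k x))" for k
    unfolding Pe by (subst Bochner_Integration.integral_sum) (use ii in auto)
  ultimately have "(\<lambda>k. (LINT x|M. P x * D k x)) \<longlonglongrightarrow> 0" by simp
  then obtain k0 where k0: "\<And>k. k \<ge> k0 \<Longrightarrow> \<bar>(LINT x|M. P x * D k x)\<bar> < r / 2"
    using LIMSEQ_D[of _ 0 "r / 2"] r by fastforce
  have "\<bar>(LINT x|M. \<Psi> x * D k x)\<bar> < r" if "k \<ge> k0" for k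
  proof -
    have "\<bar>(LINT x|M. \<Psi> x * D k x - P x * D k x)\<bar> \<le> (LINT x|M. norm (\<Psi> x * D k x - P x * D k x))"
      using integral_norm_bound[of M "\<lambda>x. \<Psi> x * D k x - P x * D k x"] by simp
    also have "\<dots> \<le> (LINT x|M. 1 / N * \<bar>D k x\<bar>)"
    proof (rule integral_mono)
      show "norm (\<Psi> x * D k x - P x * D k x) \<le> 1 / N * \<bar>D k x\<bar>" if "x \<in> space M" for x
        using mult_right_mono[OF close[OF that], of "\<bar>D k x\<bar>"]
        by (simp add: left_diff_distrib[symmetric] abs_mult)
    qed (use \<Psi>i Pi int in auto)
    also have "\<dots> \<le> 1 / N * C"
      using L1[of k] N by (simp add: divide_right_mono)
    also have "\<dots> < r / 2"
    proof -
      have "C * r < (C + 1) * r" using r by simp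
      then show ?thesis using C r by (simp add: N_def field_simps)
    qed
    finally have "\<bar>(LINT x|M. \<Psi> x * D k x) - (LINT x|M. P x * D k x)\<bar> < r / 2"
      using \<Psi>i Pi by simp
    then show ?thesis using k0[OF that] by linarith
  qed
  then show "\<exists>k0. \<forall>k\<ge>k0. norm ((LINT x|M. \<Psi> x * D k x) - 0) < r" by auto
qed

section \<open>Strict convexity of the energy and the resulting almost everywhere
  convergence\<close>

section \<open>The Bregman distance of the p-th power of the norm\<close>

text \<open>The p-th power of the norm at \<open>b\<close> minus its first-order Taylor expansion at
  \<open>a\<close>. The gradient p |a|^(p-2) a reads as 0 at a = 0 also for p < 2, which is its
  correct value for p > 1.\<close>

definition bregman :: "real \<Rightarrow> 'a::real_inner \<Rightarrow> 'a \<Rightarrow> real" where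
  "bregman p a b = norm b powr p - norm a powr p - p * norm a powr (p - 2) * (a \<bullet> (b - a))"

lemma powr_tangent_less:
  fixes s t p :: real
  assumes "1 < p" "0 < s" "0 \<le> t" "s \<noteq> t"
  shows "s powr p + p * s powr (p - 1) * (t - s) < t powr p"
proof (cases "t = 0")
  case True
  have "s powr p = s powr (p - 1) * s" using assms by (simp add: powr_diff)
  then have "s powr p + p * s powr (p - 1) * (t - s) = (1 - p) * s powr p"
    using True by (simp add: algebra_simps)
  also have "\<dots> < 0" using assms by (simp add: mult_neg_pos)
  finally show ?thesis using True by simp
next
  case False
  then have t: "0 < t" using assms by simp
  have d: "((\<lambda>x. x powr p) has_real_derivative p * x powr (p - 1)) (at x)" if "0 < x" for x
    using has_real_derivative_powr[OF that] .
  consider "s < t" | "t < s" using assms by linarith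
  then show ?thesis
  proof cases
    case 1
    obtain z where z: "s < z" "z < t" "t powr p - s powr p = (t - s) * (p * z powr (p - 1))"
      using MVT2[OF 1, of "\<lambda>x. x powr p" "\<lambda>x. p * x powr (p - 1)"] d assms by force
    have "s powr (p - 1) < z powr (p - 1)" using z assms by (intro powr_less_mono2) auto
    then have "(t - s) * (p * s powr (p - 1)) < (t - s) * (p * z powr (p - 1))"
      using 1 assms by (intro mult_strict_left_mono) auto
    then show ?thesis using z(3) by (simp add: algebra_simps)
  next
    case 2
    obtain z where z: "t < z" "z < s" "s powr p - t powr p = (s - t) * (p * z powr (p - 1))"
      using MVT2[OF 2, of "\<lambda>x. x powr p" "\<lambda>x. p * x powr (p - 1)"] d t by force
    have "z powr (p - 1) < s powr (p - 1)" using z t assms by (intro powr_less_mono2) auto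
    then have "(s - t) * (p * z powr (p - 1)) < (s - t) * (p * s powr (p - 1))"
      using 2 assms by (intro mult_strict_left_mono) auto
    then show ?thesis using z(3) by (simp add: algebra_simps)
  qed
qed

text \<open>The Cauchy-Schwarz inequality reduces the claim to the tangent inequality for the norms.
  If the norms differ, strictness comes from \<open>powr_tangent_less\<close>; if they agree, it
  comes from |b - a|^2 = 2 (|a|^2 - a . b) > 0.\<close>

lemma bregman_pos:
  assumes p: "1 < p" and ne: "b \<noteq> a"
  shows "0 < bregman p a b"
proof (cases "a = 0")
  case True
  then show ?thesis using ne p by (simp add: bregman_def)
next
  case False
  define s t where "s = norm a" and "t = norm b"
  have s: "0 < s" "0 \<le> t" using False by (auto simp: s_def t_def)
  have c: "p * s powr (p - 2) * (s * t - s\<^sup>2) = p * s powr (p - 1) * (t - s)"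
  proof -
    have "s powr (p - 1) = s powr (p - 2) * s powr 1" by (subst powr_add[symmetric]) simp
    then show ?thesis using s by (simp add: algebra_simps power2_eq_square)
  qed
  have in_eq: "a \<bullet> (b - a) = a \<bullet> b - s\<^sup>2"
    by (simp add: inner_diff_right s_def power2_norm_eq_inner)
  have cs: "a \<bullet> b \<le> s * t" using norm_cauchy_schwarz by (simp add: s_def t_def)
  have pos: "0 < p * s powr (p - 2)" using p s by simp
  show ?thesis
  proof (cases "s = t")
    case True
    have "0 < (norm (b - a))\<^sup>2" using ne by simp
    also have "(norm (b - a))\<^sup>2 = 2 * (s\<^sup>2 - a \<bullet> b)"
      using True unfolding power2_norm_eq_inner s_def t_def
      by (simp add: inner_diff inner_commute norm_eq algebra_simps)
    finally have "a \<bullet> (b - a) < 0" unfolding in_eq by simp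
    then have "p * s powr (p - 2) * (a \<bullet> (b - a)) < 0" using pos by (rule mult_pos_neg[rotated])
    then show ?thesis using True by (simp add: bregman_def s_def t_def)
  next
    case False
    have "p * s powr (p - 2) * (a \<bullet> (b - a)) \<le> p * s powr (p - 1) * (t - s)"
      unfolding c[symmetric] in_eq using pos cs by (intro mult_left_mono) auto
    then show ?thesis
      using powr_tangent_less[OF p s False] by (simp add: bregman_def flip: s_def t_def)
  qed
qed

lemma bregman_nonneg: "1 < p \<Longrightarrow> 0 \<le> bregman p a b"
  using bregman_pos[of p b a] by (cases "b = a") (auto simp: bregman_def)

text \<open>Convexity in the second argument, together with the value 0 at \<open>a\<close>. The
  convexity of the p-th power is itself obtained from \<open>bregman_nonneg\<close>: the tangent
  inequalities at the intermediate point \<open>c\<close> are averaged and their linear terms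
  cancel.\<close>

lemma bregman_scale_le:
  assumes p: "1 < p" and \<theta>: "0 \<le> \<theta>" "\<theta> \<le> 1"
  shows "bregman p a (a + \<theta> *\<^sub>R (b - a)) \<le> \<theta> * bregman p a b"
proof -
  define c where "c = a + \<theta> *\<^sub>R (b - a)"
  define l where "l h = p * norm c powr (p - 2) * (c \<bullet> h)" for h
  have l: "norm c powr p + l (a - c) \<le> norm a powr p" "norm c powr p + l (b - c) \<le> norm b powr p"
    using bregman_nonneg[OF p, of c a] bregman_nonneg[OF p, of c b] by (auto simp: bregman_def l_def)
  have "(1 - \<theta>) *\<^sub>R (a - c) + \<theta> *\<^sub>R (b - c) = 0"
    by (simp add: c_def algebra_simps)
  then have "l ((1 - \<theta>) *\<^sub>R (a - c) + \<theta> *\<^sub>R (b - c)) = 0" by (simp add: l_def)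
  then have "(1 - \<theta>) * l (a - c) + \<theta> * l (b - c) = 0"
    by (simp add: l_def inner_add_right algebra_simps)
  moreover have "(1 - \<theta>) * (norm c powr p + l (a - c)) \<le> (1 - \<theta>) * norm a powr p"
    using l(1) \<theta> by (intro mult_left_mono) auto
  moreover have "\<theta> * (norm c powr p + l (b - c)) \<le> \<theta> * norm b powr p"
    using l(2) \<theta> by (intro mult_left_mono) auto
  ultimately have "norm c powr p \<le> (1 - \<theta>) * norm a powr p + \<theta> * norm b powr p"
    by (simp add: algebra_simps)
  moreover have "a \<bullet> (c - a) = \<theta> * (a \<bullet> (b - a))" by (simp add: c_def)
  then have bc: "bregman p a c =
      norm c powr p - norm a powr p - \<theta> * (p * norm a powr (p - 2) * (a \<bullet> (b - a)))"
    by (simp only: bregman_def mult_ac)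
  ultimately show ?thesis
    unfolding c_def[symmetric] bc by (simp add: bregman_def left_diff_distrib right_diff_distrib)
qed

text \<open>By \<open>bregman_scale_le\<close> the minimum over a sphere around \<open>a\<close>,
  positive by compactness, is also a lower bound outside the sphere. This excludes escape to
  infinity along with convergence to another point.\<close>

lemma tendsto_if_bregman_tendsto_0:
  fixes a :: "'a::euclidean_space"
  assumes p: "1 < p" and b: "(\<lambda>k. bregman p a (b k)) \<longlonglongrightarrow> 0"
  shows "b \<longlonglongrightarrow> a"
proof (rule metric_LIMSEQ_I)
  fix r :: real assume r: "0 < r"
  have "continuous_on (sphere a r) (\<lambda>c. bregman p a c)"
    unfolding bregman_def using p by (intro continuous_intros continuous_on_powr') auto
  moreover have "sphere a r \<noteq> {}" using r by simp
  ultimately obtain c0 where c0: "c0 \<in> sphere a r" "\<And>c. c \<in> sphere a r \<Longrightarrow> bregman p a c0 \<le> bregman p a c"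
    using continuous_attains_inf[OF compact_sphere] by metis
  have "0 < bregman p a c0" using c0(1) r by (intro bregman_pos[OF p]) auto
  from order_tendstoD(2)[OF b this]
  obtain k0 where k0: "\<And>k. k \<ge> k0 \<Longrightarrow> bregman p a (b k) < bregman p a c0"
    by (auto simp: eventually_sequentially)
  have "dist (b k) a < r" if "k \<ge> k0" for k
  proof (rule ccontr)
    assume "\<not> dist (b k) a < r"
    then have n: "r \<le> norm (b k - a)" by (simp add: dist_norm)
    define \<theta> where "\<theta> = r / norm (b k - a)"
    have "0 < norm (b k - a)" using n r by linarith
    then have \<theta>: "0 \<le> \<theta>" "\<theta> \<le> 1" using n r by (simp_all add: \<theta>_def del: zero_less_norm_iff)
    have "norm (\<theta> *\<^sub>R (b k - a)) = r" using \<open>0 < norm (b k - a)\<close> r by (simp add: \<theta>_def)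
    then have "bregman p a c0 \<le> bregman p a (a + \<theta> *\<^sub>R (b k - a))"
      by (intro c0(2)) (simp add: dist_norm norm_minus_commute)
    also have "\<dots> \<le> \<theta> * bregman p a (b k)" by (rule bregman_scale_le[OF p \<theta>])
    also have "\<dots> \<le> bregman p a (b k)"
      using \<theta> bregman_nonneg[OF p, of a "b k"] by (intro mult_left_le_one_le)
    finally show False using k0[OF that] by simp
  qed
  then show "\<exists>k0. \<forall>k\<ge>k0. dist (b k) a < r" by blast
qed

section \<open>Lower semicontinuity and strong convergence\<close>

text \<open>Weak convergence is tested against bounded functions only, which is the form that
  \<open>bounded_integrals_tendsto_0\<close> delivers; integrability of \<open>H\<close> and
  \<open>Hk\<close> makes these pairings finite.\<close>

locale weakly_convergent =
  fixes p :: real and M :: "'a measure" and H :: "'a \<Rightarrow> 'b::euclidean_space" and Hk :: "nat \<Rightarrow> 'a \<Rightarrow> 'b"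
  assumes p: "1 < p"
    and integrable_H: "integrable M H" "\<And>k. integrable M (Hk k)"
    and Lp: "integrable M (\<lambda>x. norm (H x) powr p)" "\<And>k. integrable M (\<lambda>x. norm (Hk k x) powr p)"
    and weak: "\<And>\<Psi>. \<Psi> \<in> borel_measurable M \<Longrightarrow> bounded (range \<Psi>) \<Longrightarrow>
      (\<lambda>k. (LINT x|M. \<Psi> x \<bullet> (Hk k x - H x))) \<longlonglongrightarrow> 0"
begin

text \<open>The gradient of the p-th power of the norm at \<open>H x\<close>, truncated to a level
  set so that it is bounded and thus admissible in \<open>weak\<close>.\<close>

definition slope :: "real \<Rightarrow> 'a set \<Rightarrow> 'a \<Rightarrow> 'b" where
  "slope n S x = (if x \<in> S \<and> norm (H x) \<le> n then (p * norm (H x) powr (p - 2)) *\<^sub>R H x else 0)"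

lemma measurable_H [measurable]: "H \<in> borel_measurable M" "Hk k \<in> borel_measurable M"
  using integrable_H by auto

lemma level_set [measurable]: "S \<in> sets M \<Longrightarrow> {x \<in> S. norm (H x) \<le> n} \<in> sets M"
proof -
  assume S: "S \<in> sets M"
  have "{x \<in> space M. norm (H x) \<le> n} \<in> sets M" by measurable
  then have "S \<inter> {x \<in> space M. norm (H x) \<le> n} \<in> sets M" using S by blast
  moreover have "S \<inter> {x \<in> space M. norm (H x) \<le> n} = {x \<in> S. norm (H x) \<le> n}"
    using sets.sets_into_space[OF S] by blast
  ultimately show ?thesis by simp
qed

lemma slope_bounded:
  assumes "0 \<le> n"
  shows "norm (slope n S x) \<le> p * n powr (p - 1)"
proof (cases "x \<in> S \<and> norm (H x) \<le> n \<and> H x \<noteq> 0")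
  case True
  have "norm (slope n S x) = p * (norm (H x) powr (p - 2) * norm (H x) powr 1)"
    using True p by (simp add: slope_def)
  also have "\<dots> = p * norm (H x) powr (p - 1)" by (subst powr_add[symmetric]) simp
  also have "\<dots> \<le> p * n powr (p - 1)" using True p by (intro mult_left_mono powr_mono2) auto
  finally show ?thesis .
next
  case False
  then have "slope n S x = 0" by (auto simp: slope_def)
  then show ?thesis using p by simp
qed

lemma slope_tendsto:
  assumes S: "S \<in> sets M" and n: "0 \<le> n"
  shows "(\<lambda>k. (LINT x|M. slope n S x \<bullet> (Hk k x - H x))) \<longlonglongrightarrow> 0"
    and "integrable M (\<lambda>x. slope n S x \<bullet> (Hk k x - H x))"
proof -
  have e: "slope n S = (\<lambda>x. indicator {x \<in> S. norm (H x) \<le> n} x *\<^sub>R ((p * norm (H x) powr (p - 2)) *\<^sub>R H x))"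
    by (auto simp: slope_def indicator_def fun_eq_iff)
  have m: "slope n S \<in> borel_measurable M"
    unfolding e using level_set[OF S, of n] by measurable
  show "(\<lambda>k. (LINT x|M. slope n S x \<bullet> (Hk k x - H x))) \<longlonglongrightarrow> 0"
    by (rule weak[OF m]) (use slope_bounded[OF n] in \<open>auto simp: bounded_iff\<close>)
  show "integrable M (\<lambda>x. slope n S x \<bullet> (Hk k x - H x))"
  proof (rule Bochner_Integration.integrable_bound)
    show "integrable M (\<lambda>x. (p * n powr (p - 1)) * norm (Hk k x - H x))"
      using integrable_H by auto
    show "AE x in M. norm (slope n S x \<bullet> (Hk k x - H x)) \<le> norm ((p * n powr (p - 1)) * norm (Hk k x - H x))"
    proof (intro AE_I2)
      fix x
      have "norm (slope n S x \<bullet> (Hk k x - H x)) \<le> norm (slope n S x) * norm (Hk k x - H x)"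
        by (simp add: Cauchy_Schwarz_ineq2)
      also have "\<dots> \<le> (p * n powr (p - 1)) * norm (Hk k x - H x)"
        by (intro mult_right_mono slope_bounded n) simp
      finally show "norm (slope n S x \<bullet> (Hk k x - H x)) \<le> norm ((p * n powr (p - 1)) * norm (Hk k x - H x))"
        by simp
    qed
  qed (use m in measurable)
qed

definition energy_on :: "'a set \<Rightarrow> ('a \<Rightarrow> 'b) \<Rightarrow> real" where
  "energy_on S F = (LINT x|M. indicator S x * norm (F x) powr p)"

lemma integrable_energy:
  assumes "S \<in> sets M"
  shows "integrable M (\<lambda>x. indicator S x * norm (H x) powr p)"
    "integrable M (\<lambda>x. indicator S x * norm (Hk k x) powr p)"
  using integrable_mult_indicator[OF assms Lp(1)] integrable_mult_indicator[OF assms Lp(2)[of k]] by simp_all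

lemma bregman_integral:
  assumes S: "S \<in> sets M" and n: "0 \<le> n" and T: "T = {x \<in> S. norm (H x) \<le> n}"
  shows "integrable M (\<lambda>x. indicator T x * bregman p (H x) (Hk k x))"
    and "(LINT x|M. indicator T x * bregman p (H x) (Hk k x)) =
      energy_on T (Hk k) - energy_on T H - (LINT x|M. slope n S x \<bullet> (Hk k x - H x))"
proof -
  have Ts: "T \<in> sets M" unfolding T by (rule level_set[OF S])
  have e: "(\<lambda>x. indicator T x * bregman p (H x) (Hk k x)) =
    (\<lambda>x. indicator T x * norm (Hk k x) powr p - indicator T x * norm (H x) powr p - slope n S x \<bullet> (Hk k x - H x))"
    by (auto simp: T bregman_def slope_def indicator_def fun_eq_iff)
  show "integrable M (\<lambda>x. indicator T x * bregman p (H x) (Hk k x))"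
    unfolding e by (intro Bochner_Integration.integrable_diff integrable_energy Ts slope_tendsto S n)
  show "(LINT x|M. indicator T x * bregman p (H x) (Hk k x)) =
      energy_on T (Hk k) - energy_on T H - (LINT x|M. slope n S x \<bullet> (Hk k x - H x))"
    unfolding e energy_on_def
    by (simp add: integrable_energy Ts slope_tendsto S n Bochner_Integration.integrable_diff)
qed

lemma energy_on_levels_tendsto:
  assumes S: "S \<in> sets M"
  shows "(\<lambda>n. energy_on {x \<in> S. norm (H x) \<le> real n} H) \<longlonglongrightarrow> energy_on S H"
  unfolding energy_on_def
proof (rule integral_dominated_convergence[where w = "\<lambda>x. norm (H x) powr p"])
  show "AE x in M. (\<lambda>n. indicator {x \<in> S. norm (H x) \<le> real n} x * norm (H x) powr p)
      \<longlonglongrightarrow> indicator S x * norm (H x) powr p"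
  proof (intro AE_I2)
    fix x
    have "\<forall>\<^sub>F n in sequentially. indicator S x * norm (H x) powr p =
        indicator {x \<in> S. norm (H x) \<le> real n} x * norm (H x) powr p"
      using eventually_ge_at_top[of "nat \<lceil>norm (H x)\<rceil>"]
    proof eventually_elim
      case (elim n)
      then have "norm (H x) \<le> real n" by linarith
      then show ?case by (auto simp: indicator_def)
    qed
    then show "(\<lambda>n. indicator {x \<in> S. norm (H x) \<le> real n} x * norm (H x) powr p)
      \<longlonglongrightarrow> indicator S x * norm (H x) powr p"
      by (rule Lim_transform_eventually[OF tendsto_const])
  qed
  show "AE x in M. norm (indicator {x \<in> S. norm (H x) \<le> real n} x * norm (H x) powr p) \<le> norm (H x) powr p" for n
    by (auto simp: indicator_def)
qed (use integrable_energy level_set S Lp in \<open>auto intro: borel_measurable_integrable\<close>)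

text \<open>On a level set of \<open>H\<close> the Bregman distance is nonnegative and its linear
  term tends to 0; the passage to the level set costs at most e/2. The set \<open>S\<close> is
  arbitrary because the lemma is later applied to the complement of a level set.\<close>

lemma energy_lower_semicontinuous:
  assumes S: "S \<in> sets M" and e: "0 < e"
  shows "\<forall>\<^sub>F k in sequentially. energy_on S H - e < energy_on S (Hk k)"
proof -
  have "\<forall>\<^sub>F n in sequentially. energy_on S H - e / 2 < energy_on {x \<in> S. norm (H x) \<le> real n} H"
    using e by (intro order_tendstoD(1)[OF energy_on_levels_tendsto[OF S]]) simp
  then obtain n where n: "energy_on S H - e / 2 < energy_on {x \<in> S. norm (H x) \<le> real n} H"
    by (auto simp: eventually_sequentially)
  define T where "T = {x \<in> S. norm (H x) \<le> real n}"
  have Ts: "T \<in> sets M" unfolding T_def by (rule level_set[OF S])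
  have "\<forall>\<^sub>F k in sequentially. - (e / 2) < (LINT x|M. slope (real n) S x \<bullet> (Hk k x - H x))"
    using e by (intro order_tendstoD(1)[OF slope_tendsto(1)[OF S]]) auto
  then show ?thesis
  proof eventually_elim
    case (elim k)
    have "0 \<le> (LINT x|M. indicator T x * bregman p (H x) (Hk k x))"
      by (intro Bochner_Integration.integral_nonneg) (simp add: bregman_nonneg[OF p])
    then have "energy_on T H - e / 2 < energy_on T (Hk k)"
      using elim bregman_integral(2)[OF S _ T_def, of k] by simp
    also have "energy_on T (Hk k) \<le> energy_on S (Hk k)"
      unfolding energy_on_def by (intro integral_mono integrable_energy S Ts) (auto simp: T_def indicator_def)
    finally show ?case using n by (simp flip: T_def)
  qed
qed

text \<open>The total energies of the \<open>Hk\<close> do not exceed that of \<open>H\<close>, and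
  by lower semicontinuity little energy can be lost on the complement of the level set
  \<open>T\<close>. Hence the energy on \<open>T\<close> cannot exceed that of \<open>H\<close> in
  the limit, the Bregman integral over \<open>T\<close> tends to 0, and L1 convergence yields the
  subsequence.\<close>

lemma AE_convergent_subsequence:
  assumes "\<And>k. (LINT x|M. norm (Hk k x) powr p) \<le> (LINT x|M. norm (H x) powr p)"
  shows "\<exists>r. strict_mono r \<and> (AE x in M. norm (H x) \<le> real n \<longrightarrow> (\<lambda>k. Hk (r k) x) \<longlonglongrightarrow> H x)"
proof -
  define T where "T = {x \<in> space M. norm (H x) \<le> real n}"
  have Ts: "T \<in> sets M" unfolding T_def by (rule level_set) simp
  have split: "energy_on T F + energy_on (space M - T) F = (LINT x|M. norm (F x) powr p)"
    if "integrable M (\<lambda>x. norm (F x) powr p)" for F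
  proof -
    have "integrable M (\<lambda>x. indicator A x * norm (F x) powr p)" if "A \<in> sets M" for A
      using integrable_mult_indicator[OF that \<open>integrable M (\<lambda>x. norm (F x) powr p)\<close>] by simp
    then have "energy_on T F + energy_on (space M - T) F =
        (LINT x|M. indicator T x * norm (F x) powr p + indicator (space M - T) x * norm (F x) powr p)"
      unfolding energy_on_def using Ts by (intro Bochner_Integration.integral_add[symmetric]) auto
    also have "\<dots> = (LINT x|M. norm (F x) powr p)"
      by (intro Bochner_Integration.integral_cong) (auto simp: indicator_def)
    finally show ?thesis .
  qed
  let ?d = "\<lambda>k x. indicator T x * bregman p (H x) (Hk k x)"
  have "(\<lambda>k. integral\<^sup>L M (?d k)) \<longlonglongrightarrow> 0"
  proof (rule LIMSEQ_I)
    fix e :: real assume e: "0 < e"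
    have "\<forall>\<^sub>F k in sequentially. energy_on (space M - T) H - e / 2 < energy_on (space M - T) (Hk k)"
      using Ts e by (intro energy_lower_semicontinuous) auto
    moreover have "\<forall>\<^sub>F k in sequentially. - (e / 2) < (LINT x|M. slope (real n) (space M) x \<bullet> (Hk k x - H x))"
      using e by (intro order_tendstoD(1)[OF slope_tendsto(1)]) auto
    ultimately have "\<forall>\<^sub>F k in sequentially. norm (integral\<^sup>L M (?d k) - 0) < e"
    proof eventually_elim
      case (elim k)
      have "0 \<le> integral\<^sup>L M (?d k)"
        by (intro Bochner_Integration.integral_nonneg) (simp add: bregman_nonneg[OF p])
      moreover have "integral\<^sup>L M (?d k) < e"
        using elim bregman_integral(2)[OF _ _ T_def, of k] split[OF Lp(1)] split[OF Lp(2)[of k]] assms[of k]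
        by simp
      ultimately show ?case by simp
    qed
    then show "\<exists>k0. \<forall>k\<ge>k0. norm (integral\<^sup>L M (?d k) - 0) < e"
      by (simp add: eventually_sequentially)
  qed
  moreover have "norm (?d k x) = ?d k x" for k x
    using bregman_nonneg[OF p, of "H x" "Hk k x"] by simp
  ultimately have "(\<lambda>k. (LINT x|M. norm (?d k x))) \<longlonglongrightarrow> 0" by simp
  then obtain r where r: "strict_mono r" "AE x in M. (\<lambda>k. ?d (r k) x) \<longlonglongrightarrow> 0"
    using tendsto_L1_AE_subseq[of M ?d, OF bregman_integral(1)[OF _ _ T_def]] by auto
  have "AE x in M. norm (H x) \<le> real n \<longrightarrow> (\<lambda>k. Hk (r k) x) \<longlonglongrightarrow> H x"
    using r(2) AE_space
  proof eventually_elim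
    case (elim x)
    show ?case
    proof
      assume "norm (H x) \<le> real n"
      then have "(\<lambda>k. bregman p (H x) (Hk (r k) x)) \<longlonglongrightarrow> 0"
        using elim by (simp add: T_def)
      then show "(\<lambda>k. Hk (r k) x) \<longlonglongrightarrow> H x" by (rule tendsto_if_bregman_tendsto_0[OF p])
    qed
  qed
  then show ?thesis using r(1) by blast
qed

end

section \<open>Sobolev maps of the cube as displacements of the whole space\<close>

section \<open>Weak differentials on the cube\<close>

lemma cube_open: "open (cube :: (real^'n::finite) set)"
  unfolding cube_eq_box by (rule open_box)

lemma cube_sets [measurable]: "(cube :: (real^'n::finite) set) \<in> sets lebesgue"
  by (simp add: cube_eq_box)

lemma closure_cube: "closure (cube :: (real^'n::finite) set) = cbox 0 1"
  using cube_nonempty closure_box[of "0 :: real^'n" 1] unfolding cube_eq_box by blast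

lemma cube_subset_cbox: "(cube :: (real^'n::finite) set) \<subseteq> cbox 0 1"
  by (simp add: cube_eq_box box_subset_cbox)

lemma measure_cube: "measure lebesgue (cube :: (real^'n::finite) set) = 1"
proof -
  have "cbox (0::real^'n) 1 \<noteq> {}" using cube_subset_cbox cube_nonempty by auto
  then have "measure lborel (cbox (0::real^'n) 1) = 1" by (simp add: content_cbox_cart)
  then have "measure lborel (box (0::real^'n) 1) = 1" by (metis measure_lborel_box_eq measure_lborel_cbox_eq)
  then show ?thesis by (simp add: cube_eq_box)
qed

lemma integrable_indicator_cube: "integrable lebesgue (indicat_real (cube :: (real^'n::finite) set))"
  unfolding cube_eq_box
  by (intro integrable_real_indicator) (simp_all add: emeasure_lborel_box_finite[unfolded infinity_ennreal_def])

lemma norm_entry_le: "\<bar>(A :: real^'n::finite^'m::finite) $ i $ j\<bar> \<le> norm A"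
  by (rule order_trans[OF component_le_norm_cart Finite_Cartesian_Product.norm_nth_le])

lemma integrable_entry:
  "integrable M (f :: 'a \<Rightarrow> real^'n::finite^'m::finite) \<Longrightarrow> integrable M (\<lambda>x. f x $ i $ j)"
  using integrable_bounded_linear[OF bounded_linear_compose[OF bounded_linear_vec_nth bounded_linear_vec_nth], of M f]
  by simp

lemma measurable_test_function:
  assumes "\<phi> \<in> test_functions U"
  shows "\<phi> \<in> borel_measurable lebesgue" "partial_deriv j \<phi> \<in> borel_measurable lebesgue"
proof -
  have "continuous_on UNIV \<phi>" "continuous_on UNIV (partial_deriv j \<phi>)"
    using Ck_continuous_on[OF test_function_Ck[OF assms, of 0]]
      Ck_partial_continuous_on[OF test_function_Ck[OF assms, of "Suc 0"]] by auto
  then show "\<phi> \<in> borel_measurable lebesgue" "partial_deriv j \<phi> \<in> borel_measurable lebesgue"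
    by (auto intro!: measurable_completion borel_measurable_continuous_onI)
qed

text \<open>The linear functional \<open>l\<close> lets one statement cover the components of a map
  and the entries of its differential.\<close>

lemma locally_integrable_test:
  fixes g :: "real^'n::finite \<Rightarrow> 'b::{banach, second_countable_topology}"
  assumes g: "locally_integrable cube g" and \<phi>: "\<phi> \<in> test_functions cube" and l: "bounded_linear l"
  shows "integrable lebesgue (\<lambda>x. indicator cube x * (\<phi> x * (l (g x) :: real)))"
    "integrable lebesgue (\<lambda>x. indicator cube x * (partial_deriv j \<phi> x * l (g x)))"
proof -
  define K where "K = closure {x. \<phi> x \<noteq> 0}"
  have K: "compact K" "K \<subseteq> cube" using \<phi> by (simp_all add: test_functions_def K_def)
  interpret l: bounded_linear l by (rule l)
  have "integrable lebesgue (\<lambda>x. l (indicator K x *\<^sub>R g x))"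
    using g K integrable_bounded_linear[OF l] unfolding locally_integrable_def set_integrable_def by blast
  then have gi: "integrable lebesgue (\<lambda>x. indicator K x * l (g x))" by (simp add: l.scaleR)
  have *: "integrable lebesgue (\<lambda>x. indicator cube x * (\<psi> x * l (g x)))"
    if "\<psi> \<in> borel_measurable lebesgue" "\<And>x. \<bar>\<psi> x\<bar> \<le> B" "\<And>x. x \<notin> K \<Longrightarrow> \<psi> x = 0" for \<psi> B
  proof -
    have eq: "indicator cube x * (\<psi> x * l (g x)) = \<psi> x * (indicator K x * l (g x))" for x
      using that(3)[of x] K(2) by (auto simp: indicator_def)
    show ?thesis unfolding eq by (rule integrable_bounded_mult[OF gi that(1,2)])
  qed
  note z = test_function_eq_0[of _ \<phi>, folded K_def]
  show "integrable lebesgue (\<lambda>x. indicator cube x * (\<phi> x * l (g x)))"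
    using test_function_bounded[OF \<phi>] *[OF measurable_test_function(1)[OF \<phi>] _ z(1)] by blast
  show "integrable lebesgue (\<lambda>x. indicator cube x * (partial_deriv j \<phi> x * l (g x)))"
    using test_function_partial_bounded[OF \<phi>, of j] *[OF measurable_test_function(2)[OF \<phi>] _ z(2)] by blast
qed

lemma bounded_linear_entry: "bounded_linear (\<lambda>A :: real^'n::finite^'m::finite. A $ i $ j)"
  by (rule bounded_linear_compose[of "\<lambda>x. x $ j" "\<lambda>A. A $ i"]) (rule bounded_linear_vec_nth)+

lemma weak_differential_test:
  assumes "has_weak_differential cube f G" "\<phi> \<in> test_functions cube"
  shows "(LINT x|lebesgue. indicator cube x * (partial_deriv j \<phi> x * f x $ i)) =
      - (LINT x|lebesgue. indicator cube x * (\<phi> x * G x $ i $ j))"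
    "integrable lebesgue (\<lambda>x. indicator cube x * (partial_deriv j \<phi> x * f x $ i))"
    "integrable lebesgue (\<lambda>x. indicator cube x * (\<phi> x * G x $ i $ j))"
  using assms locally_integrable_test(2)[OF _ assms(2) bounded_linear_vec_nth[of i], of f j]
    locally_integrable_test(1)[OF _ assms(2) bounded_linear_entry[of i j], of G]
  by (auto simp: has_weak_differential_def set_lebesgue_integral_def mult.commute)

text \<open>Weak differentials are only locally integrable, so the fundamental lemma is applied on
  an exhaustion of the cube by boxes whose closures are compact in it.\<close>

lemma weak_differential_unique:
  fixes f :: "real^'n::finite \<Rightarrow> real^'m::finite"
  assumes G: "has_weak_differential cube f G" and H: "has_weak_differential cube f H"
  shows "AE x in lebesgue. x \<in> cube \<longrightarrow> G x = H x"
proof -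
  define a b :: "nat \<Rightarrow> real^'n"
    where "a m = (\<chi> i. 1 / real (Suc (Suc m)))" and "b m = (\<chi> i. 1 - 1 / real (Suc (Suc m)))"
    for m
  have sub: "cbox (a m) (b m) \<subseteq> (cube :: (real^'n) set)" for m
  proof
    fix x :: "real^'n" assume x: "x \<in> cbox (a m) (b m)"
    have "0 < x $ i \<and> x $ i < 1" for i
    proof -
      have "1 / real (Suc (Suc m)) \<le> x $ i" "x $ i \<le> 1 - 1 / real (Suc (Suc m))"
        using x by (simp_all add: mem_box_cart a_def b_def del: of_nat_Suc)
      moreover have "0 < 1 / real (Suc (Suc m))" by simp
      ultimately show ?thesis by linarith
    qed
    then show "x \<in> cube" by (simp add: cube_def)
  qed
  have cover: "\<exists>m. x \<in> box (a m) (b m)" if x: "x \<in> cube" for x :: "real^'n"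
  proof -
    have l: "(\<lambda>m. 1 / real (Suc (Suc m))) \<longlonglongrightarrow> 0"
      using LIMSEQ_Suc[OF LIMSEQ_Suc[OF lim_const_over_n[of 1]]] by simp
    have "\<forall>\<^sub>F m in sequentially. \<forall>i\<in>UNIV. 1 / real (Suc (Suc m)) < x $ i \<and> 1 / real (Suc (Suc m)) < 1 - x $ i"
      using x by (intro eventually_ball_finite ballI eventually_conj order_tendstoD(2)[OF l]) (auto simp: cube_def)
    then obtain m where "\<And>i. 1 / real (Suc (Suc m)) < x $ i \<and> 1 / real (Suc (Suc m)) < 1 - x $ i"
      by (auto simp: eventually_sequentially)
    then have "x \<in> box (a m) (b m)" by (simp add: mem_box_cart a_def b_def) (smt (verit))
    then show ?thesis by blast
  qed
  have ae: "AE x in lebesgue. indicator (box (a m) (b m)) x * (G x $ i $ j - H x $ i $ j) = 0" for m i j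
  proof (rule AE_eq_0_if_test_integrals_eq_0[where c = "a m" and d = "b m"])
    have K: "set_integrable lebesgue (cbox (a m) (b m)) F" if "has_weak_differential cube f F" for F
      using that sub[of m] by (auto simp: has_weak_differential_def locally_integrable_def)
    have e: "set_integrable lebesgue (box (a m) (b m)) F" if "has_weak_differential cube f F" for F
      by (rule set_integrable_subset[OF K[OF that]]) (auto simp: box_subset_cbox)
    have "integrable lebesgue (\<lambda>x. indicator (box (a m) (b m)) x * F x $ i $ j)"
      if "has_weak_differential cube f F" for F
      using integrable_entry[OF e[OF that, unfolded set_integrable_def], of i j] by simp
    from Bochner_Integration.integrable_diff[OF this[OF G] this[OF H]]
    show "integrable lebesgue (\<lambda>x. indicator (box (a m) (b m)) x * (G x $ i $ j - H x $ i $ j))"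
      by (simp add: right_diff_distrib)
    show "indicator (box (a m) (b m)) x * (G x $ i $ j - H x $ i $ j) = 0" if "x \<notin> box (a m) (b m)" for x
      using that by simp
    fix \<phi> assume \<phi>: "\<phi> \<in> test_functions (box (a m) (b m))"
    have bc: "box (a m) (b m) \<subseteq> cube" using sub[of m] box_subset_cbox by blast
    have \<phi>c: "\<phi> \<in> test_functions cube" using \<phi> test_functions_mono[OF bc] by blast
    have z: "\<phi> x = 0" if "x \<notin> box (a m) (b m)" for x
      by (rule test_function_eq_0(1)) (use \<phi> that in \<open>auto simp: test_functions_def\<close>)
    have "(\<lambda>x. \<phi> x * (indicator (box (a m) (b m)) x * (G x $ i $ j - H x $ i $ j))) =
        (\<lambda>x. indicator cube x * (\<phi> x * G x $ i $ j) - indicator cube x * (\<phi> x * H x $ i $ j))"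
    proof
      show "\<phi> x * (indicator (box (a m) (b m)) x * (G x $ i $ j - H x $ i $ j)) =
          indicator cube x * (\<phi> x * G x $ i $ j) - indicator cube x * (\<phi> x * H x $ i $ j)" for x
        using z[of x] bc by (cases "x \<in> box (a m) (b m)") (auto simp: algebra_simps indicator_def)
    qed
    then show "(LINT x|lebesgue. \<phi> x * (indicator (box (a m) (b m)) x * (G x $ i $ j - H x $ i $ j))) = 0"
      using weak_differential_test[OF G \<phi>c, where i = i and j = j] weak_differential_test[OF H \<phi>c, where i = i and j = j] by simp
  qed
  have "AE x in lebesgue. \<forall>m. \<forall>i\<in>UNIV. \<forall>j\<in>UNIV. indicator (box (a m) (b m)) x * (G x $ i $ j - H x $ i $ j) = 0"
    unfolding AE_all_countable by (intro allI AE_finite_allI ae) auto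
  then show ?thesis
  proof eventually_elim
    case (elim x)
    show ?case
    proof
      assume "x \<in> cube"
      from cover[OF this] obtain m where "x \<in> box (a m) (b m)" by blast
      then show "G x = H x" using elim by (auto simp: vec_eq_iff dest!: spec[of _ m])
    qed
  qed
qed

section \<open>Extension of the displacement by zero\<close>

definition weak_diff_everywhere :: "(real^'n::finite \<Rightarrow> real^'n) \<Rightarrow> (real^'n \<Rightarrow> real^'n^'n) \<Rightarrow> bool" where
  "weak_diff_everywhere v V \<longleftrightarrow> (\<forall>\<phi>\<in>test_functions UNIV. \<forall>i j.
     (LINT x|lebesgue. partial_deriv j \<phi> x * v x $ i) = - (LINT x|lebesgue. \<phi> x * V x $ i $ j))"

text \<open>The intended pair is f - id and its weak differential, both extended by zero. Since the
  weak identity holds against test functions of the whole space, such pairs can be added and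
  rescaled without boundary terms.\<close>

definition displacement :: "(real^'n::finite \<Rightarrow> real^'n) \<Rightarrow> (real^'n \<Rightarrow> real^'n^'n) \<Rightarrow> bool" where
  "displacement v V \<longleftrightarrow> continuous_on UNIV v \<and> (\<forall>x. x \<notin> cube \<longrightarrow> v x = 0) \<and>
     integrable lebesgue V \<and> (\<forall>x. x \<notin> cube \<longrightarrow> V x = 0) \<and> weak_diff_everywhere v V"

lemma displacement_integrable:
  assumes "displacement v V"
  shows "integrable lebesgue (\<lambda>x. v x $ i)" "integrable lebesgue (\<lambda>x. V x $ i $ j)"
proof -
  have "continuous_on UNIV (\<lambda>x. v x $ i)"
    using assms by (intro continuous_intros) (simp add: displacement_def)
  then show "integrable lebesgue (\<lambda>x. v x $ i)"
    by (rule continuous_compact_support_integrable[OF _ compact_cbox[of 0 1]])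
      (use assms cube_subset_cbox in \<open>auto simp: displacement_def\<close>)
  show "integrable lebesgue (\<lambda>x. V x $ i $ j)"
    using assms integrable_entry by (auto simp: displacement_def)
qed

lemma displacement_add:
  assumes v: "displacement v V" and w: "displacement w W"
  shows "displacement (\<lambda>x. v x + w x) (\<lambda>x. V x + W x)"
proof -
  have "weak_diff_everywhere (\<lambda>x. v x + w x) (\<lambda>x. V x + W x)"
    unfolding weak_diff_everywhere_def
  proof (intro ballI allI)
    fix \<phi> :: "real^'a \<Rightarrow> real" and i j :: 'a assume \<phi>: "\<phi> \<in> test_functions UNIV"
    obtain B where B: "\<And>x. \<bar>\<phi> x\<bar> \<le> B" using test_function_bounded[OF \<phi>] by blast
    obtain B' where B': "\<And>x. \<bar>partial_deriv j \<phi> x\<bar> \<le> B'" using test_function_partial_bounded[OF \<phi>, of j] by blast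
    have "integrable lebesgue (\<lambda>x. partial_deriv j \<phi> x * u x $ i)" "integrable lebesgue (\<lambda>x. \<phi> x * U x $ i $ j)"
      if "displacement u U" for u U
      by (auto intro!: integrable_bounded_mult[OF _ _ B] integrable_bounded_mult[OF _ _ B']
          displacement_integrable[OF that] measurable_test_function[OF \<phi>])
    from this[OF v] this[OF w]
    show "(LINT x|lebesgue. partial_deriv j \<phi> x * (v x + w x) $ i) =
        - (LINT x|lebesgue. \<phi> x * (V x + W x) $ i $ j)"
      using v w \<phi> by (simp add: distrib_left displacement_def weak_diff_everywhere_def)
  qed
  then show ?thesis using v w by (auto simp: displacement_def intro!: continuous_intros)
qed

lemma test_function_scaled:
  assumes \<phi>: "\<phi> \<in> test_functions UNIV" and c: "0 < c"
  shows "(\<lambda>x::real^'n::finite. \<phi> (c *\<^sub>R x + a)) \<in> test_functions UNIV"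
proof -
  have "bounded {x. \<phi> x \<noteq> 0}"
    using \<phi> by (auto simp: test_functions_def dest!: compact_imp_bounded intro: bounded_subset[OF _ closure_subset])
  then obtain R where R: "\<And>x. \<phi> x \<noteq> 0 \<Longrightarrow> norm x \<le> R" unfolding bounded_iff by blast
  have "norm x \<le> (R + norm a) / c" if "\<phi> (c *\<^sub>R x + a) \<noteq> 0" for x
  proof -
    have "norm (c *\<^sub>R x) \<le> norm (c *\<^sub>R x + a) + norm a" using norm_triangle_ineq4[of "c *\<^sub>R x + a" a] by simp
    also have "\<dots> \<le> R + norm a" using R[OF that] by simp
    finally show ?thesis using c by (simp add: field_simps)
  qed
  then have "bounded {x. \<phi> (c *\<^sub>R x + a) \<noteq> 0}" unfolding bounded_iff by blast
  moreover have "Ck k (\<lambda>x. \<phi> (c *\<^sub>R x + a))" for k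
    by (rule Ck_scaled[OF test_function_Ck[OF \<phi>]])
  ultimately show ?thesis by (simp add: test_functions_def bounded_closure compact_eq_bounded_closed)
qed

text \<open>A change of variables moves the scaling to the test function. The factor
  \<open>c\<close> in front of \<open>v\<close> cancels the derivative of the inner map, so
  \<open>V\<close> is merely transported; the copied cube lies in \<open>cube\<close>, so the result
  still vanishes outside.\<close>

lemma displacement_scaled:
  fixes v :: "real^'n::finite \<Rightarrow> real^'n"
  assumes v: "displacement v V" and c: "0 < c" and a: "\<And>x. x \<in> cube \<Longrightarrow> a + c *\<^sub>R x \<in> cube"
  shows "displacement (\<lambda>x. c *\<^sub>R v (inverse c *\<^sub>R (x - a))) (\<lambda>x. V (inverse c *\<^sub>R (x - a)))"
proof -
  have inv: "inverse c *\<^sub>R (a + c *\<^sub>R x - a) = x" "inverse c *\<^sub>R (a + c *\<^sub>R x) - inverse c *\<^sub>R a = x" for x :: "real^'n"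
    using c by (simp_all add: scaleR_add_right)
  have out: "inverse c *\<^sub>R (x - a) \<notin> cube" if "x \<notin> cube" for x
    using a[of "inverse c *\<^sub>R (x - a)"] that c by auto
  have vc: "continuous_on UNIV v" using v by (simp add: displacement_def)
  have cont: "continuous_on UNIV (\<lambda>x. c *\<^sub>R v (inverse c *\<^sub>R (x - a)))"
    by (intro continuous_intros continuous_on_compose2[OF vc]) auto
  have Vi: "integrable lebesgue V" using v by (simp add: displacement_def)
  have VV: "integrable lebesgue (\<lambda>x. V (inverse c *\<^sub>R (x - a)))"
  proof -
    have "integrable lebesgue (\<lambda>x. V ((- inverse c *\<^sub>R a) + inverse c *\<^sub>R x))"
      using integral_scaled(3)[of "inverse c" V "- inverse c *\<^sub>R a"] c Vi by auto
    then show ?thesis by (simp add: algebra_simps)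
  qed
  have "weak_diff_everywhere (\<lambda>x. c *\<^sub>R v (inverse c *\<^sub>R (x - a))) (\<lambda>x. V (inverse c *\<^sub>R (x - a)))"
    unfolding weak_diff_everywhere_def
  proof (intro ballI allI)
    fix \<phi> :: "real^'n \<Rightarrow> real" and i j :: 'n assume \<phi>: "\<phi> \<in> test_functions UNIV"
    let ?d = "\<bar>c\<bar> ^ DIM(real^'n)"
    have m1: "(\<lambda>x. partial_deriv j \<phi> x * (c *\<^sub>R v (inverse c *\<^sub>R (x - a))) $ i) \<in> borel_measurable lebesgue"
    proof (intro borel_measurable_times measurable_test_function[OF \<phi>])
      show "(\<lambda>x. (c *\<^sub>R v (inverse c *\<^sub>R (x - a))) $ i) \<in> borel_measurable lebesgue"
        by (intro measurable_completion)
          (use continuous_on_component[OF cont, of i] in \<open>auto intro: borel_measurable_continuous_onI\<close>)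
    qed
    have m2: "(\<lambda>x. \<phi> x * V (inverse c *\<^sub>R (x - a)) $ i $ j) \<in> borel_measurable lebesgue"
      by (intro borel_measurable_times measurable_test_function[OF \<phi>]
          borel_measurable_integrable[OF integrable_entry[OF VV]])
    have pd: "partial_deriv j (\<lambda>x. \<phi> (c *\<^sub>R x + a)) x = c * partial_deriv j \<phi> (a + c *\<^sub>R x)" for x
      using partial_deriv_scaled[OF test_function_Ck[OF \<phi>], of j c a x] by (simp add: add.commute)
    have "(LINT x|lebesgue. partial_deriv j \<phi> x * (c *\<^sub>R v (inverse c *\<^sub>R (x - a))) $ i) =
        ?d * (LINT x|lebesgue. partial_deriv j (\<lambda>x. \<phi> (c *\<^sub>R x + a)) x * v x $ i)"
      using c by (subst integral_scaled(2)[OF _ m1, where c = c and t = a]) (auto simp: pd mult_ac inv)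
    also have "\<dots> = - (?d * (LINT x|lebesgue. \<phi> (c *\<^sub>R x + a) * V x $ i $ j))"
      using v test_function_scaled[OF \<phi> c, of a] by (simp add: displacement_def weak_diff_everywhere_def)
    also have "?d * (LINT x|lebesgue. \<phi> (c *\<^sub>R x + a) * V x $ i $ j) =
        (LINT x|lebesgue. \<phi> x * V (inverse c *\<^sub>R (x - a)) $ i $ j)"
      using c by (subst integral_scaled(2)[OF _ m2, where c = c and t = a]) (auto simp: inv add.commute)
    finally show "(LINT x|lebesgue. partial_deriv j \<phi> x * (c *\<^sub>R v (inverse c *\<^sub>R (x - a))) $ i) =
        - (LINT x|lebesgue. \<phi> x * V (inverse c *\<^sub>R (x - a)) $ i $ j)" .
  qed
  then show ?thesis using v out cont VV by (auto simp: displacement_def)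
qed

lemma partial_deriv_component: "partial_deriv j (\<lambda>x::real^'n::finite. x $ i) x = (mat 1 :: real^'n^'n) $ i $ j"
  using partial_deriv_coordinate[where b = "\<lambda>t. t" and b' = 1 and x = x and i = i and j = j]
  by (simp add: mat_def)

lemma Ck_component: "Ck k (\<lambda>x::real^'n::finite. x $ i)"
  using Ck_coordinate[OF smooth_upto_affine[of k 1 0], of i] by simp

text \<open>The identity has weak differential \<open>mat 1\<close> against test functions of the
  whole space. Adding or subtracting it converts between maps and displacements.\<close>

lemma component_by_parts:
  fixes \<phi> :: "real^'n::finite \<Rightarrow> real"
  assumes "\<phi> \<in> test_functions UNIV"
  shows "(LINT x|lebesgue. partial_deriv j \<phi> x * x $ i) =
      - (LINT x|lebesgue. \<phi> x * (mat 1 :: real^'n^'n) $ i $ j)"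
    "integrable lebesgue (\<lambda>x. partial_deriv j \<phi> x * x $ i)"
    "integrable lebesgue (\<lambda>x. \<phi> x * (mat 1 :: real^'n^'n) $ i $ j)"
  using integral_by_parts[OF Ck_component[of _ i] assms, where j = j]
  by (simp_all add: partial_deriv_component mult.commute)

text \<open>The slabs that contain, within the unit cube, all points where a partial derivative of a
  cutoff can be nonzero.\<close>

definition strip :: "'n::finite \<Rightarrow> real \<Rightarrow> real \<Rightarrow> (real^'n) set" where
  "strip j s t = {x \<in> cbox 0 1. s \<le> x $ j \<and> x $ j \<le> t}"

lemma strip_measure:
  fixes j :: "'n::finite"
  assumes st: "0 \<le> s" "s \<le> t" "t \<le> 1"
  shows "integral\<^sup>L lebesgue (indicat_real (strip j s t)) = t - s"
    "integrable lebesgue (indicat_real (strip j s t))"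
proof -
  define a b :: "real^'n" where "a = (\<chi> i. if i = j then s else 0)" and "b = (\<chi> i. if i = j then t else 1)"
  have S: "strip j s t = cbox a b"
  proof (rule set_eqI)
    fix x :: "real^'n"
    have "x \<in> cbox a b" if "x \<in> strip j s t"
      using that by (simp add: strip_def mem_box_cart a_def b_def)
    moreover have "x \<in> strip j s t" if x: "x \<in> cbox a b"
    proof -
      have xi: "a $ i \<le> x $ i" "x $ i \<le> b $ i" for i using x by (simp_all add: mem_box_cart)
      have xj: "s \<le> x $ j" "x $ j \<le> t" using xi[of j] by (simp_all add: a_def b_def)
      have "0 \<le> x $ i \<and> x $ i \<le> 1" for i
        using xi[of i] xj st by (cases "i = j") (simp_all add: a_def b_def)
      then show ?thesis using xj by (simp add: strip_def mem_box_cart)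
    qed
    ultimately show "x \<in> strip j s t \<longleftrightarrow> x \<in> cbox a b" by blast
  qed
  have "a \<in> cbox a b" using st by (simp add: mem_box_cart a_def b_def)
  then have "measure lborel (cbox a b) = (\<Prod>i\<in>UNIV. b $ i - a $ i)"
    by (subst content_cbox_cart) auto
  also have "\<dots> = (\<Prod>i\<in>UNIV. if i = j then t - s else 1)"
    by (rule prod.cong) (auto simp: a_def b_def)
  finally have "measure lborel (cbox a b) = t - s" by simp
  then show "integral\<^sup>L lebesgue (indicat_real (strip j s t)) = t - s" unfolding S by simp
  show "integrable lebesgue (indicat_real (strip j s t))"
    unfolding S by (intro integrable_real_indicator) (simp_all add: emeasure_lborel_cbox_finite[unfolded infinity_ennreal_def])
qed

text \<open>The closed cube and the complement of the open cube are closed and overlap exactly in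
  the boundary, where both formulas give 0.\<close>

lemma displacement_continuous:
  fixes f :: "real^'n::finite \<Rightarrow> real^'n"
  assumes "identity_on_boundary f"
  shows "continuous_on UNIV (\<lambda>x. if x \<in> cube then f x - x else 0)"
proof -
  have c: "continuous_on (closure cube) (\<lambda>x. (if x \<in> cube then f x else x) - x)"
    using assms unfolding identity_on_boundary_def by (intro continuous_intros)
  have "continuous_on (closure cube \<union> - cube) (\<lambda>x. if x \<in> cube then f x - x else 0)"
  proof (rule continuous_on_closed_Un)
    show "continuous_on (closure cube) (\<lambda>x. if x \<in> cube then f x - x else 0)"
      using c by (rule continuous_on_eq) simp
    show "continuous_on (- cube) (\<lambda>x. if x \<in> cube then f x - x else 0)"
      by (rule continuous_on_eq[OF continuous_on_const[of _ 0]]) simp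
  qed (auto simp: cube_open)
  moreover have "closure cube \<union> - cube = (UNIV :: (real^'n) set)"
    using closure_subset[of "cube :: (real^'n) set"] by blast
  ultimately show ?thesis by (simp only:)
qed

text \<open>Near the boundary the displacement is small, which compensates the growth of the derivatives
  of the cutoff functions there.\<close>

lemma cutoff_boundary_term_tendsto_0:
  fixes v :: "real^'n::finite \<Rightarrow> real^'n" and \<phi> :: "real^'n \<Rightarrow> real"
  assumes v: "continuous_on UNIV v" and out: "\<And>x. x \<notin> cube \<Longrightarrow> v x = 0"
    and \<phi>: "\<And>x. \<bar>\<phi> x\<bar> \<le> B" "0 \<le> B"
  shows "(\<lambda>m. (LINT x|lebesgue. partial_deriv j (cutoff (real (Suc m)) 0 1) x * (\<phi> x * v x $ i))) \<longlonglongrightarrow> 0"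
proof (rule LIMSEQ_I)
  fix r :: real assume r: "0 < r"
  obtain C where C: "0 \<le> C"
    "\<And>k a b j (x::real^'n::finite). 0 < k \<Longrightarrow> \<bar>partial_deriv j (cutoff k a b) x\<bar> \<le> C * k"
    "\<And>k a b j (x::real^'n::finite). 0 < k \<Longrightarrow>
        x $ j \<notin> {a $ j + 1 / k .. a $ j + 2 / k} \<union> {b $ j - 2 / k .. b $ j - 1 / k} \<Longrightarrow>
        partial_deriv j (cutoff k a b) x = 0"
    using partial_deriv_cutoff by blast
  \<comment> \<open>The final bound is 2 * B * C * e, which this choice makes at most r/2; the added
    1 avoids a zero denominator.\<close>
  define e where "e = r / 4 / (B * C + 1)"
  have BC: "0 \<le> B * C" using C(1) \<phi>(2) by simp
  have e: "0 < e" using r BC by (simp add: e_def)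
  have "uniformly_continuous_on (cbox 0 1) v"
    by (intro compact_uniformly_continuous continuous_on_subset[OF v]) auto
  then obtain \<delta> where \<delta>: "0 < \<delta>" "\<And>x y. x \<in> cbox 0 1 \<Longrightarrow> y \<in> cbox 0 1 \<Longrightarrow> dist x y < \<delta> \<Longrightarrow> dist (v x) (v y) < e"
    unfolding uniformly_continuous_on_def using e by metis
  obtain m0 where m0: "2 / real (Suc m0) < \<delta>" "2 / real (Suc m0) < 1"
  proof -
    have l: "(\<lambda>m. 2 / real (Suc m)) \<longlonglongrightarrow> 0" using LIMSEQ_Suc[OF lim_const_over_n[of 2]] by simp
    have "\<forall>\<^sub>F m in sequentially. 2 / real (Suc m) < \<delta> \<and> 2 / real (Suc m) < 1"
      by (intro eventually_conj order_tendstoD(2)[OF l]) (use \<delta>(1) in auto)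
    then show ?thesis using that by (auto simp: eventually_sequentially)
  qed
  have "norm ((LINT x|lebesgue. partial_deriv j (cutoff (real (Suc m)) 0 1) x * (\<phi> x * v x $ i))) < r"
    if m: "m \<ge> m0" for m
  proof -
    define k where "k = real (Suc m)"
    have k: "0 < k" "2 / k < \<delta>" "2 / k < 1"
    proof -
      have "2 / k \<le> 2 / real (Suc m0)" unfolding k_def using m by (intro divide_left_mono) auto
      then show "2 / k < \<delta>" "2 / k < 1" using m0 by linarith+
      show "0 < k" by (simp add: k_def)
    qed
    have k12: "1 / k \<le> 2 / k" using k by (simp add: divide_right_mono)
    let ?I = "\<lambda>x. indicat_real (strip j (1 / k) (2 / k)) x + indicat_real (strip j (1 - 2 / k) (1 - 1 / k)) x"
    \<comment> \<open>The cutoff derivative is at most C * k and the displacement at most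
      \<open>e\<close> there. The two slabs have total measure 2/k, so \<open>k\<close> cancels upon
      integration.\<close>
    have pt: "norm (partial_deriv j (cutoff k 0 1) x * (\<phi> x * v x $ i)) \<le> (C * k * (B * e)) * ?I x" for x
    proof (cases "x \<in> cube \<and> x $ j \<in> {1 / k .. 2 / k} \<union> {1 - 2 / k .. 1 - 1 / k}")
      case True
      then have xc: "x \<in> cbox 0 1" using cube_subset_cbox by blast
      have small: "norm (v x) \<le> e"
      proof -
        \<comment> \<open>The projection of \<open>x\<close> to the face of its slab: at distance at
          most 2/k from \<open>x\<close>, and on the boundary, where \<open>v\<close>
          vanishes.\<close>
        define y where "y = x + (if x $ j \<in> {1 / k .. 2 / k} then - x $ j else 1 - x $ j) *\<^sub>R axis j 1"
        have yj: "y $ j = (if x $ j \<in> {1 / k .. 2 / k} then 0 else 1)" by (simp add: y_def)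
        have yi: "y $ l = x $ l" if "l \<noteq> j" for l using that by (simp add: y_def axis_def)
        have "y \<notin> cube" using yj by (auto simp: cube_def split: if_splits intro!: exI[of _ j])
        moreover have "y \<in> cbox 0 1"
          unfolding mem_box_cart
        proof
          show "0 $ l \<le> y $ l \<and> y $ l \<le> 1 $ l" for l
            using yj yi[of l] xc by (cases "l = j") (auto simp: mem_box_cart)
        qed
        moreover have "dist x y < \<delta>"
        proof -
          have "norm (x - y) = \<bar>if x $ j \<in> {1 / k .. 2 / k} then - x $ j else 1 - x $ j\<bar>"
            by (simp add: y_def)
          also have "\<dots> \<le> 2 / k" using True by (auto simp: cube_def)
          finally show ?thesis using k(2) by (simp add: dist_norm)
        qed
        ultimately have "dist (v x) 0 < e" using \<delta>(2)[OF xc, of y] out[of y] by simp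
        then show ?thesis by simp
      qed
      have "\<bar>v x $ i\<bar> \<le> e" using component_le_norm_cart[of "v x" i] small by linarith
      then have "\<bar>\<phi> x\<bar> * \<bar>v x $ i\<bar> \<le> B * e" using \<phi> by (intro mult_mono) auto
      then have "\<bar>partial_deriv j (cutoff k 0 1) x\<bar> * (\<bar>\<phi> x\<bar> * \<bar>v x $ i\<bar>) \<le> C * k * (B * e)"
        by (rule mult_mono[OF C(2)[OF k(1)]]) (use C(1) k in auto)
      moreover have "1 \<le> ?I x"
      proof -
        have "x \<in> strip j (1 / k) (2 / k) \<or> x \<in> strip j (1 - 2 / k) (1 - 1 / k)"
          using True by (auto simp: strip_def mem_box_cart cube_def less_imp_le)
        then show ?thesis by (auto simp: indicator_def)
      qed
      then have "C * k * (B * e) * 1 \<le> C * k * (B * e) * ?I x"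
        using C(1) k \<phi>(2) e by (intro mult_left_mono) auto
      ultimately have "\<bar>partial_deriv j (cutoff k 0 1) x\<bar> * (\<bar>\<phi> x\<bar> * \<bar>v x $ i\<bar>) \<le> C * k * (B * e) * ?I x"
        by linarith
      then show ?thesis by (simp add: abs_mult)
    next
      case False
      have z: "partial_deriv j (cutoff k 0 1) x * (\<phi> x * v x $ i) = 0"
      proof (cases "x \<in> cube")
        case True
        then have "partial_deriv j (cutoff k 0 1) x = 0" using False k(1) by (intro C(3)) auto
        then show ?thesis by simp
      qed (simp add: out)
      have "0 \<le> C * k * (B * e)" using C(1) k \<phi>(2) e by simp
      then show ?thesis unfolding z by simp
    qed
    have S1: "integrable lebesgue (indicat_real (strip j (1 / k) (2 / k)))"
        "integral\<^sup>L lebesgue (indicat_real (strip j (1 / k) (2 / k))) = 1 / k"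
      using strip_measure[of "1 / k" "2 / k" j] k12 k by simp_all
    have S2: "integrable lebesgue (indicat_real (strip j (1 - 2 / k) (1 - 1 / k)))"
        "integral\<^sup>L lebesgue (indicat_real (strip j (1 - 2 / k) (1 - 1 / k))) = 1 / k"
      using strip_measure[of "1 - 2 / k" "1 - 1 / k" j] k12 k by simp_all
    have "norm ((LINT x|lebesgue. partial_deriv j (cutoff k 0 1) x * (\<phi> x * v x $ i)))
        \<le> (LINT x|lebesgue. norm (partial_deriv j (cutoff k 0 1) x * (\<phi> x * v x $ i)))"
      by (rule integral_norm_bound)
    also have "\<dots> \<le> (LINT x|lebesgue. (C * k * (B * e)) * ?I x)"
      by (rule integral_mono') (use pt S1 S2 C(1) k \<phi>(2) e in auto)
    also have "\<dots> = (C * k * (B * e)) * (1 / k + 1 / k)"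
      using S1 S2 by (simp add: Bochner_Integration.integral_add)
    also have "\<dots> = 2 * (B * C * e)" using k by (simp add: field_simps)
    also have "\<dots> < r"
    proof -
      have "B * C * e \<le> (B * C + 1) * e" using e by simp
      also have "(B * C + 1) * e = r / 4"
      proof -
        have "B * C + 1 \<noteq> 0" using BC by linarith
        then have "e * (B * C + 1) = r / 4" using nonzero_eq_divide_eq[of "B * C + 1" e "r / 4"] e_def by blast
        then show ?thesis by (simp only: mult.commute)
      qed
      finally show ?thesis using r by simp
    qed
    finally show ?thesis unfolding k_def .
  qed
  then show "\<exists>m0. \<forall>m\<ge>m0. norm ((LINT x|lebesgue. partial_deriv j (cutoff (real (Suc m)) 0 1) x * (\<phi> x * v x $ i)) - 0) < r"
    by auto
qed

text \<open>The weak identity in the cube is applied to a cutoff times \<open>\<phi>\<close>. As the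
  cutoffs increase to 1 in the cube, dominated convergence treats two of the three terms, and the
  term with the derivative of the cutoff disappears by
  \<open>cutoff_boundary_term_tendsto_0\<close>.\<close>

lemma displacement_zero_extension:
  fixes f :: "real^'n::finite \<Rightarrow> real^'n"
  assumes f: "identity_on_boundary f" and G: "has_weak_differential cube f G"
    and int: "set_integrable lebesgue cube G"
  shows "displacement (\<lambda>x. if x \<in> cube then f x - x else 0) (\<lambda>x. if x \<in> cube then G x - mat 1 else 0)"
proof -
  define v where "v x = (if x \<in> cube then f x - x else 0)" for x
  define V where "V x = (if x \<in> cube then G x - mat 1 else 0)" for x
  have vc: "continuous_on UNIV v" unfolding v_def[abs_def] by (rule displacement_continuous[OF f])
  have out: "v x = 0" "V x = 0" if "x \<notin> cube" for x using that by (simp_all add: v_def V_def)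
  have VI: "integrable lebesgue V"
  proof -
    have "integrable lebesgue (\<lambda>x. indicator cube x *\<^sub>R G x - indicat_real cube x *\<^sub>R mat 1)"
      using int integrable_indicator_cube unfolding set_integrable_def
      by (intro Bochner_Integration.integrable_diff integrable_scaleR_left) auto
    moreover have "(\<lambda>x. indicator cube x *\<^sub>R G x - indicat_real cube x *\<^sub>R mat 1) = V"
      by (auto simp: V_def fun_eq_iff indicator_def)
    ultimately show ?thesis by simp
  qed
  have Vi: "integrable lebesgue (\<lambda>x. V x $ i $ j)" for i j using integrable_entry[OF VI] .
  have vi: "integrable lebesgue (\<lambda>x. v x $ i)" for i
    by (rule continuous_compact_support_integrable[OF continuous_on_component[OF vc] compact_cbox[of 0 1]])
      (metis cube_subset_cbox out(1) subsetD zero_index)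
  \<comment> \<open>Inside the cube the identity for \<open>f\<close> minus the one for the identity
    map gives the identity for \<open>v\<close>.\<close>
  have inner: "(LINT x|lebesgue. partial_deriv j \<xi> x * v x $ i) = - (LINT x|lebesgue. \<xi> x * V x $ i $ j)"
    if \<xi>: "\<xi> \<in> test_functions cube" for \<xi> i j
  proof -
    have \<xi>U: "\<xi> \<in> test_functions UNIV" using \<xi> test_functions_mono[of cube UNIV] by blast
    have z: "\<xi> x = 0" "partial_deriv j \<xi> x = 0" if "x \<notin> cube" for x
      using test_function_eq_0[of x \<xi>] \<xi> that by (auto simp: test_functions_def)
    have e1: "partial_deriv j \<xi> x * v x $ i =
        indicator cube x * (partial_deriv j \<xi> x * f x $ i) - partial_deriv j \<xi> x * x $ i" for x
      using z(2)[of x] by (simp add: v_def right_diff_distrib)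
    have e2: "\<xi> x * V x $ i $ j =
        indicator cube x * (\<xi> x * G x $ i $ j) - \<xi> x * (mat 1 :: real^'n^'n) $ i $ j" for x
      using z(1)[of x] by (simp add: V_def right_diff_distrib)
    note w = weak_differential_test[OF G \<xi>, where i = i and j = j]
    note c = component_by_parts[OF \<xi>U, where i = i and j = j]
    have "(LINT x|lebesgue. partial_deriv j \<xi> x * v x $ i) =
        (LINT x|lebesgue. indicator cube x * (partial_deriv j \<xi> x * f x $ i))
        - (LINT x|lebesgue. partial_deriv j \<xi> x * x $ i)"
      unfolding e1 by (rule Bochner_Integration.integral_diff[OF w(2) c(2)])
    moreover have "(LINT x|lebesgue. \<xi> x * V x $ i $ j) =
        (LINT x|lebesgue. indicator cube x * (\<xi> x * G x $ i $ j))
        - (LINT x|lebesgue. \<xi> x * (mat 1 :: real^'n^'n) $ i $ j)"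
      unfolding e2 by (rule Bochner_Integration.integral_diff[OF w(3) c(3)])
    ultimately show ?thesis using w(1) c(1) by linarith
  qed
  have "weak_diff_everywhere v V"
    unfolding weak_diff_everywhere_def
  proof (intro ballI allI)
    fix \<phi> :: "real^'n \<Rightarrow> real" and i j :: 'n assume \<phi>: "\<phi> \<in> test_functions UNIV"
    obtain B where B: "\<And>x. \<bar>\<phi> x\<bar> \<le> B" "0 \<le> B" using test_function_bounded[OF \<phi>] by blast
    obtain B' where B': "\<And>x. \<bar>partial_deriv j \<phi> x\<bar> \<le> B'" using test_function_partial_bounded[OF \<phi>, of j] by blast
    let ?\<xi> = "\<lambda>m::nat. cutoff (real (Suc m)) (0::real^'n) 1"
    have \<xi>: "?\<xi> m \<in> test_functions cube" for m by (rule cutoff_test_function) (simp_all add: cube_eq_box)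
    have \<xi>m: "?\<xi> m \<in> borel_measurable lebesgue" "partial_deriv j (?\<xi> m) \<in> borel_measurable lebesgue" for m
      using measurable_test_function[OF \<xi>] by auto
    have \<xi>b: "\<bar>?\<xi> m x\<bar> \<le> 1" for m x using cutoff_bounds[of "real (Suc m)" 0 1 x] by simp
    have \<xi>t: "(\<lambda>m. ?\<xi> m x) \<longlonglongrightarrow> 1" if "x \<in> cube" for x
      using that cutoff_tendsto by (simp add: cube_eq_box)
    have pvi: "integrable lebesgue (\<lambda>x. partial_deriv j \<phi> x * v x $ i)"
      by (rule integrable_bounded_mult[OF vi measurable_test_function(2)[OF \<phi>] B'])
    have pVi: "integrable lebesgue (\<lambda>x. \<phi> x * V x $ i $ j)"
      by (rule integrable_bounded_mult[OF Vi measurable_test_function(1)[OF \<phi>] B(1)])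
    have fvi: "integrable lebesgue (\<lambda>x. \<phi> x * v x $ i)"
      by (rule integrable_bounded_mult[OF vi measurable_test_function(1)[OF \<phi>] B(1)])
    have lim: "(\<lambda>m. (LINT x|lebesgue. ?\<xi> m x * h x)) \<longlonglongrightarrow> integral\<^sup>L lebesgue h"
      if h: "integrable lebesgue h" and "\<And>x. x \<notin> cube \<Longrightarrow> h x = 0" for h
    proof (rule integral_dominated_convergence[where w = "\<lambda>x. \<bar>h x\<bar>"])
      show "AE x in lebesgue. (\<lambda>m. ?\<xi> m x * h x) \<longlonglongrightarrow> h x"
      proof (intro AE_I2)
        fix x
        show "(\<lambda>m. ?\<xi> m x * h x) \<longlonglongrightarrow> h x"
          using tendsto_mult[OF \<xi>t[of x] tendsto_const[of "h x"]] that(2)[of x] by (cases "x \<in> cube") auto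
      qed
      show "AE x in lebesgue. norm (?\<xi> m x * h x) \<le> \<bar>h x\<bar>" for m
        using \<xi>b[of m] by (intro AE_I2) (simp add: abs_mult mult_left_le_one_le)
    qed (use h \<xi>m in auto)
    have eq: "(LINT x|lebesgue. ?\<xi> m x * (partial_deriv j \<phi> x * v x $ i)) +
        (LINT x|lebesgue. partial_deriv j (?\<xi> m) x * (\<phi> x * v x $ i)) =
        - (LINT x|lebesgue. ?\<xi> m x * (\<phi> x * V x $ i $ j))" for m
    proof -
      obtain B2 where B2: "\<And>x. \<bar>partial_deriv j (?\<xi> m) x\<bar> \<le> B2"
        using test_function_partial_bounded[OF \<xi>, of j m] by blast
      have i1: "integrable lebesgue (\<lambda>x. ?\<xi> m x * (partial_deriv j \<phi> x * v x $ i))"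
        by (rule integrable_bounded_mult[OF pvi \<xi>m(1) \<xi>b])
      have i2: "integrable lebesgue (\<lambda>x. partial_deriv j (?\<xi> m) x * (\<phi> x * v x $ i))"
        by (rule integrable_bounded_mult[OF fvi \<xi>m(2) B2])
      have pm: "partial_deriv j (\<lambda>x. ?\<xi> m x * \<phi> x) x * v x $ i =
          ?\<xi> m x * (partial_deriv j \<phi> x * v x $ i) + partial_deriv j (?\<xi> m) x * (\<phi> x * v x $ i)" for x
        using partial_deriv_mult[OF Ck_cutoff[of "Suc 0"] test_function_Ck[OF \<phi>, of "Suc 0"]]
        by (simp add: algebra_simps)
      have t: "(\<lambda>x. ?\<xi> m x * \<phi> x) \<in> test_functions cube"
        by (rule test_function_mult[OF \<xi> test_function_Ck[OF \<phi>]])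
      show ?thesis
        using inner[OF t, where i = i and j = j]
        unfolding pm mult.assoc Bochner_Integration.integral_add[OF i1 i2] .
    qed
    have a: "(\<lambda>m. (LINT x|lebesgue. ?\<xi> m x * (partial_deriv j \<phi> x * v x $ i)) +
        (LINT x|lebesgue. partial_deriv j (?\<xi> m) x * (\<phi> x * v x $ i)))
        \<longlonglongrightarrow> (LINT x|lebesgue. partial_deriv j \<phi> x * v x $ i) + 0"
      by (intro tendsto_add lim pvi cutoff_boundary_term_tendsto_0[OF vc out(1) B]) (simp add: out)
    have b: "(\<lambda>m. - (LINT x|lebesgue. ?\<xi> m x * (\<phi> x * V x $ i $ j)))
        \<longlonglongrightarrow> - (LINT x|lebesgue. \<phi> x * V x $ i $ j)"
      by (intro tendsto_minus lim pVi) (simp add: out)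
    from LIMSEQ_unique[OF a[unfolded eq] b]
    show "(LINT x|lebesgue. partial_deriv j \<phi> x * v x $ i) = - (LINT x|lebesgue. \<phi> x * V x $ i $ j)"
      by simp
  qed
  then have "displacement v V" using vc out VI by (simp add: displacement_def)
  then show ?thesis by (simp add: v_def[abs_def] V_def[abs_def])
qed

lemma locally_integrable_continuous:
  fixes f :: "real^'n::finite \<Rightarrow> 'b::{banach, second_countable_topology}"
  assumes "continuous_on UNIV f"
  shows "locally_integrable U f"
  unfolding locally_integrable_def set_integrable_def
proof (intro allI impI)
  fix K :: "(real^'n) set" assume K: "compact K \<and> K \<subseteq> U"
  have "integrable lborel (\<lambda>x. indicator K x *\<^sub>R f x)"
    using K borel_integrable_compact continuous_on_subset[OF assms] by blast
  then show "integrable lebesgue (\<lambda>x. indicator K x *\<^sub>R f x)"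
    by (subst integrable_completion) (auto dest: borel_measurable_integrable)
qed

lemma displacement_weak_differential:
  fixes v :: "real^'n::finite \<Rightarrow> real^'n"
  assumes v: "displacement v V"
  shows "has_weak_differential cube (\<lambda>x. x + v x) (\<lambda>x. mat 1 + V x)"
proof -
  have vc: "continuous_on UNIV v" and VI: "integrable lebesgue V" and out: "\<And>x. x \<notin> cube \<Longrightarrow> V x = 0"
    using v by (auto simp: displacement_def)
  have "locally_integrable cube (\<lambda>x. x + v x)"
    by (intro locally_integrable_continuous continuous_intros vc)
  moreover have "locally_integrable cube (\<lambda>x. mat 1 + V x)"
    unfolding locally_integrable_def
  proof (intro allI impI)
    fix K :: "(real^'n) set" assume K: "compact K \<and> K \<subseteq> cube"
    have "set_integrable lebesgue K (\<lambda>x. mat 1 :: real^'n^'n)"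
      using locally_integrable_continuous[OF continuous_on_const[of UNIV "mat 1 :: real^'n^'n"], of cube] K
      unfolding locally_integrable_def by blast
    moreover have "K \<in> sets borel" using K by (intro borel_compact) auto
    then have "set_integrable lebesgue K V"
      unfolding set_integrable_def using VI by (intro integrable_mult_indicator) auto
    ultimately show "set_integrable lebesgue K (\<lambda>x. mat 1 + V x)" by (rule set_integral_add)
  qed
  moreover have "(LINT x:cube|lebesgue. (x + v x) $ i * partial_deriv j \<phi> x) =
      - (LINT x:cube|lebesgue. (mat 1 + V x) $ i $ j * \<phi> x)" if \<phi>: "\<phi> \<in> test_functions cube" for \<phi> i j
  proof -
    have \<phi>U: "\<phi> \<in> test_functions UNIV" using \<phi> test_functions_mono[of cube UNIV] by blast
    have z: "\<phi> x = 0" "partial_deriv j \<phi> x = 0" if "x \<notin> cube" for x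
      using test_function_eq_0[of x \<phi>] \<phi> that by (auto simp: test_functions_def)
    obtain B where B: "\<And>x. \<bar>\<phi> x\<bar> \<le> B" using test_function_bounded[OF \<phi>] by blast
    obtain B' where B': "\<And>x. \<bar>partial_deriv j \<phi> x\<bar> \<le> B'" using test_function_partial_bounded[OF \<phi>, of j] by blast
    have e1: "indicator cube x *\<^sub>R ((x + v x) $ i * partial_deriv j \<phi> x) =
        partial_deriv j \<phi> x * x $ i + partial_deriv j \<phi> x * v x $ i" for x
      using z(2)[of x] by (cases "x \<in> cube") (auto simp: algebra_simps)
    have e2: "indicator cube x *\<^sub>R ((mat 1 + V x) $ i $ j * \<phi> x) =
        \<phi> x * (mat 1 :: real^'n^'n) $ i $ j + \<phi> x * V x $ i $ j" for x
      using z(1)[of x] by (cases "x \<in> cube") (auto simp: algebra_simps)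
    have "integrable lebesgue (\<lambda>x. partial_deriv j \<phi> x * v x $ i)" "integrable lebesgue (\<lambda>x. \<phi> x * V x $ i $ j)"
      by (auto intro!: integrable_bounded_mult[OF _ _ B] integrable_bounded_mult[OF _ _ B']
          displacement_integrable[OF v] measurable_test_function[OF \<phi>])
    then show ?thesis
      unfolding set_lebesgue_integral_def e1 e2
      using component_by_parts[OF \<phi>U, where i = i and j = j] v \<phi>U
      by (simp add: displacement_def weak_diff_everywhere_def)
  qed
  ultimately show ?thesis unfolding has_weak_differential_def by blast
qed

text \<open>Testing with a function that is 1 on the cube leaves the integral of \<open>V\<close>,
  since the derivative of the test function vanishes wherever \<open>v\<close> may be
  nonzero.\<close>

lemma displacement_trace:
  fixes v :: "real^'n::finite \<Rightarrow> real^'n"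
  assumes v: "displacement v V"
  shows "(LINT x|lebesgue. V x $ i $ j) = 0"
proof -
  \<comment> \<open>With k = 1 the plateau of the cutoff of the box (-2,3)^n is the unit cube,
    because the margins on each side have width 2.\<close>
  let ?\<phi> = "cutoff 1 (\<chi> i. -2) (\<chi> i. 3) :: real^'n \<Rightarrow> real"
  have \<phi>: "?\<phi> \<in> test_functions UNIV" by (rule cutoff_test_function) auto
  have one: "?\<phi> x = 1" if "x \<in> cube" for x
    by (rule cutoff_eq_1) (use that in \<open>auto simp: cube_def less_imp_le\<close>)
  have zero: "partial_deriv j ?\<phi> x = 0" if "x \<in> cube" for x
  proof -
    have "(?\<phi> has_derivative (\<lambda>h. 0)) (at x)"
      by (rule has_derivative_transform_within_open[of "\<lambda>x. 1" _ _ _ cube]) (use that one cube_open in auto)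
    from partial_deriv_eq[OF this] show ?thesis .
  qed
  have e: "partial_deriv j ?\<phi> x * v x $ i = 0" "?\<phi> x * V x $ i $ j = V x $ i $ j" for x
    using v zero[of x] one[of x] by (cases "x \<in> cube"; simp add: displacement_def)+
  have "(LINT x|lebesgue. partial_deriv j ?\<phi> x * v x $ i) =
      - (LINT x|lebesgue. ?\<phi> x * V x $ i $ j)"
    using v \<phi> unfolding displacement_def weak_diff_everywhere_def by blast
  then show ?thesis unfolding e by simp
qed

section \<open>Excess energy of a displacement\<close>

text \<open>Subtracting the energy density of the identity makes the value 0 at A = 0. The density
  of a displacement thus vanishes outside the cube and can be integrated over the whole
  space.\<close>

definition excess_density :: "real \<Rightarrow> real^'n::finite^'n \<Rightarrow> real" where
  "excess_density p A = norm (mat 1 + A) powr p - norm (mat 1 :: real^'n^'n) powr p"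

definition excess :: "real \<Rightarrow> (real^'n::finite \<Rightarrow> real^'n^'n) \<Rightarrow> real" where
  "excess p V = (LINT x|lebesgue. excess_density p (V x))"

definition finite_energy :: "real \<Rightarrow> (real^'n::finite \<Rightarrow> real^'n^'n) \<Rightarrow> bool" where
  "finite_energy p V \<longleftrightarrow> integrable lebesgue (\<lambda>x. excess_density p (V x))"

lemma excess_density_0 [simp]: "excess_density p 0 = 0"
  by (simp add: excess_density_def)

lemma energy_eq_excess:
  fixes G V :: "real^'n::finite \<Rightarrow> real^'n^'n"
  assumes GV: "\<And>x. x \<in> cube \<Longrightarrow> G x = mat 1 + V x" and out: "\<And>x. x \<notin> cube \<Longrightarrow> V x = 0"
  shows "set_integrable lebesgue cube (\<lambda>x. norm (G x) powr p) \<longleftrightarrow> finite_energy p V"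
    "finite_energy p V \<Longrightarrow>
      (LINT x:cube|lebesgue. norm (G x) powr p) = norm (mat 1 :: real^'n^'n) powr p + excess p V"
proof -
  let ?c = "norm (mat 1 :: real^'n^'n) powr p"
  have c: "integrable lebesgue (\<lambda>x::real^'n. indicat_real cube x * ?c)"
    by (intro integrable_mult_left integrable_indicator_cube)
  have e: "indicat_real cube x *\<^sub>R norm (G x) powr p = indicat_real cube x * ?c + excess_density p (V x)" for x
    using GV[of x] out[of x] by (cases "x \<in> cube") (auto simp: excess_density_def)
  have "excess_density p (V x) = indicat_real cube x *\<^sub>R norm (G x) powr p - indicat_real cube x * ?c" for x
    using e[of x] by simp
  note e' = this
  show "set_integrable lebesgue cube (\<lambda>x. norm (G x) powr p) \<longleftrightarrow> finite_energy p V"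
  proof
    assume "set_integrable lebesgue cube (\<lambda>x. norm (G x) powr p)"
    then show "finite_energy p V"
      unfolding finite_energy_def e' set_integrable_def by (rule Bochner_Integration.integrable_diff[OF _ c])
  next
    assume "finite_energy p V"
    then show "set_integrable lebesgue cube (\<lambda>x. norm (G x) powr p)"
      unfolding finite_energy_def set_integrable_def e by (rule Bochner_Integration.integrable_add[OF c])
  qed
  assume f: "finite_energy p V"
  have "(LINT x:cube|lebesgue. norm (G x) powr p) =
      integral\<^sup>L lebesgue (\<lambda>x::real^'n. indicat_real cube x * ?c) + excess p V"
    unfolding set_lebesgue_integral_def e excess_def
    by (rule Bochner_Integration.integral_add[OF c f[unfolded finite_energy_def]])
  then show "(LINT x:cube|lebesgue. norm (G x) powr p) = ?c + excess p V"
    by (simp add: measure_cube)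
qed

lemma finite_energy_in_Lp:
  assumes v: "displacement v V" and "finite_energy p V" and GV: "\<And>x. x \<in> cube \<Longrightarrow> G x = mat 1 + V x"
  shows "in_Lp p cube G"
proof -
  have V: "V \<in> borel_measurable lebesgue" and out: "\<And>x. x \<notin> cube \<Longrightarrow> V x = 0"
    using v by (auto simp: displacement_def)
  have "set_borel_measurable lebesgue cube G"
  proof -
    have "(\<lambda>x. indicat_real cube x *\<^sub>R G x) = (\<lambda>x. indicat_real cube x *\<^sub>R (mat 1 + V x))"
      using GV by (auto simp: indicator_def fun_eq_iff)
    moreover have "(\<lambda>x. indicat_real cube x *\<^sub>R (mat 1 + V x)) \<in> borel_measurable lebesgue"
      using V by (intro borel_measurable_scaleR borel_measurable_indicator borel_measurable_add) auto
    ultimately show ?thesis unfolding set_borel_measurable_def by simp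
  qed
  then show ?thesis using energy_eq_excess(1)[of G V p] assms out by (auto simp: in_Lp_def)
qed

lemma le_one_plus_powr: "1 \<le> p \<Longrightarrow> 0 \<le> t \<Longrightarrow> t \<le> 1 + t powr p" for t p :: real
proof (cases "t \<le> 1")
  case True
  then show ?thesis by (rule order_trans) simp
next
  case False
  assume "1 \<le> p"
  with False have "t powr 1 \<le> t powr p" by (intro powr_mono) auto
  then show ?thesis using False by simp
qed

lemma in_Lp_integrable:
  fixes G :: "real^'n::finite \<Rightarrow> 'b::{banach, second_countable_topology}"
  assumes "1 \<le> p" "in_Lp p cube G"
  shows "set_integrable lebesgue cube G"
  unfolding set_integrable_def
proof (rule Bochner_Integration.integrable_bound)
  show "integrable lebesgue (\<lambda>x. indicat_real cube x + indicat_real cube x *\<^sub>R norm (G x) powr p)"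
    using assms(2) integrable_indicator_cube by (auto simp: in_Lp_def set_integrable_def)
  show "(\<lambda>x. indicat_real cube x *\<^sub>R G x) \<in> borel_measurable lebesgue"
    using assms(2) by (simp add: in_Lp_def set_borel_measurable_def)
  note le_one_plus_powr[OF assms(1)]
  then show "AE x in lebesgue. norm (indicat_real cube x *\<^sub>R G x)
      \<le> norm (indicat_real cube x + indicat_real cube x *\<^sub>R norm (G x) powr p)"
    by (intro AE_I2) (auto simp: indicator_def)
qed

text \<open>Jensen's inequality in tangent form: the linear part of the tangent at
  \<open>mat 1\<close> has integral zero by \<open>displacement_trace\<close>.\<close>

lemma excess_nonneg:
  fixes V :: "real^'n::finite \<Rightarrow> real^'n^'n"
  assumes p: "1 < p" and v: "displacement v V" and fe: "finite_energy p V"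
  shows "0 \<le> excess p V"
proof -
  let ?c = "p * norm (mat 1 :: real^'n^'n) powr (p - 2)"
  let ?L = "\<lambda>x. \<Sum>i\<in>UNIV. \<Sum>j\<in>UNIV. (?c * (mat 1 :: real^'n^'n) $ i $ j) * V x $ i $ j"
  have L: "integrable lebesgue ?L" "integral\<^sup>L lebesgue ?L = 0"
    using displacement_integrable(2)[OF v] displacement_trace[OF v] by auto
  have "?L x \<le> excess_density p (V x)" for x
  proof -
    have "?L x = ?c * (mat 1 \<bullet> V x)"
      by (simp add: inner_vec_def sum_distrib_left mult.assoc)
    then show ?thesis
      using bregman_nonneg[OF p, of "mat 1" "mat 1 + V x"] by (simp add: bregman_def excess_density_def)
  qed
  then have "integral\<^sup>L lebesgue ?L \<le> excess p V"
    unfolding excess_def using L fe by (intro integral_mono) (auto simp: finite_energy_def)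
  then show ?thesis using L by simp
qed

text \<open>Rescaling transports the differential without changing its values, so only the volume
  contributes a factor.\<close>

lemma excess_scaled:
  fixes V :: "real^'n::finite \<Rightarrow> real^'n^'n"
  assumes V: "integrable lebesgue V" and fe: "finite_energy p V" and c: "0 < c"
  shows "finite_energy p (\<lambda>x. V (inverse c *\<^sub>R (x - a)))"
    "excess p (\<lambda>x. V (inverse c *\<^sub>R (x - a))) = c ^ CARD('n) * excess p V"
proof -
  have e: "- (inverse c *\<^sub>R a) + inverse c *\<^sub>R x = inverse c *\<^sub>R (x - a)" for x :: "real^'n"
    by (simp add: algebra_simps)
  have inv: "inverse c *\<^sub>R (a + c *\<^sub>R x - a) = x" for x :: "real^'n" using c by simp
  have m: "(\<lambda>x. excess_density p (V x)) \<in> borel_measurable lebesgue"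
    using fe by (auto simp: finite_energy_def)
  show f: "finite_energy p (\<lambda>x. V (inverse c *\<^sub>R (x - a)))"
    using integral_scaled(3)[OF _ m, of "inverse c" "- (inverse c *\<^sub>R a)"] fe c
    unfolding finite_energy_def e by simp
  have "excess p (\<lambda>x. V (inverse c *\<^sub>R (x - a))) = \<bar>c\<bar> ^ DIM(real^'n) *\<^sub>R
      (LINT x|lebesgue. excess_density p (V (inverse c *\<^sub>R (a + c *\<^sub>R x - a))))"
    unfolding excess_def
    by (rule integral_scaled(2)) (use c f in \<open>auto simp: finite_energy_def\<close>)
  then show "excess p (\<lambda>x. V (inverse c *\<^sub>R (x - a))) = c ^ CARD('n) * excess p V"
    using c unfolding inv by (simp add: excess_def)
qed

lemma excess_add_disjoint:
  assumes fe: "finite_energy p V" "finite_energy p W" and dj: "\<And>x. V x = 0 \<or> W x = 0"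
  shows "finite_energy p (\<lambda>x. V x + W x)" "excess p (\<lambda>x. V x + W x) = excess p V + excess p W"
proof -
  have e: "excess_density p (V x + W x) = excess_density p (V x) + excess_density p (W x)" for x
    using dj[of x] by auto
  show "finite_energy p (\<lambda>x. V x + W x)" "excess p (\<lambda>x. V x + W x) = excess p V + excess p W"
    using fe unfolding finite_energy_def excess_def e by auto
qed

section \<open>Construction of homeomorphisms with prescribed energy\<close>

section \<open>Smooth maps of large energy\<close>

lemma smooth_weak_differential:
  fixes F :: "real^'n::finite \<Rightarrow> real^'m::finite"
  assumes F: "\<And>i. Ck (Suc 0) (\<lambda>x. F x $ i)"
  shows "has_weak_differential cube F (\<lambda>x. \<chi> i j. partial_deriv j (\<lambda>x. F x $ i) x)"
    "continuous_on UNIV (\<lambda>x. \<chi> i j. partial_deriv j (\<lambda>x. F x $ i) x)"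
proof -
  show gc: "continuous_on UNIV (\<lambda>x. \<chi> i j. partial_deriv j (\<lambda>x. F x $ i) x)"
    by (intro continuous_on_vec_lambda Ck_partial_continuous_on[OF F])
  have "continuous_on UNIV (\<lambda>x. \<chi> i. F x $ i)"
    by (intro continuous_on_vec_lambda Ck_continuous_on[OF F])
  then have fc: "continuous_on UNIV F" by (simp add: vec_lambda_eta)
  have "(LINT x:cube|lebesgue. F x $ i * partial_deriv j \<phi> x) =
      - (LINT x:cube|lebesgue. (\<chi> i j. partial_deriv j (\<lambda>x. F x $ i) x) $ i $ j * \<phi> x)"
    if \<phi>: "\<phi> \<in> test_functions cube" for \<phi> i j
  proof -
    have \<phi>U: "\<phi> \<in> test_functions UNIV" using \<phi> test_functions_mono[of cube UNIV] by blast
    have z: "\<phi> x = 0" "partial_deriv j \<phi> x = 0" if "x \<notin> cube" for x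
      using test_function_eq_0[of x \<phi>] \<phi> that by (auto simp: test_functions_def)
    have e1: "indicator cube x *\<^sub>R (F x $ i * partial_deriv j \<phi> x) = F x $ i * partial_deriv j \<phi> x" for x
      using z(2)[of x] by (cases "x \<in> cube") auto
    have e2: "indicator cube x *\<^sub>R ((\<chi> i j. partial_deriv j (\<lambda>x. F x $ i) x) $ i $ j * \<phi> x) =
        partial_deriv j (\<lambda>x. F x $ i) x * \<phi> x" for x
      using z(1)[of x] by (cases "x \<in> cube") auto
    show ?thesis
      unfolding set_lebesgue_integral_def e1 e2 by (rule integral_by_parts(1)[OF F \<phi>U])
  qed
  then show "has_weak_differential cube F (\<lambda>x. \<chi> i j. partial_deriv j (\<lambda>x. F x $ i) x)"
    unfolding has_weak_differential_def using locally_integrable_continuous[OF fc] locally_integrable_continuous[OF gc]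
    by blast
qed

text \<open>Rises on [1/8, 1/4] and falls on [3/4, 7/8]; it is 1 in between and 0 further
  out.\<close>

definition plateau :: "real \<Rightarrow> real" where
  "plateau t = smooth_step (8 * t + (- 1)) * smooth_step ((- 8) * t + 7)"

lemma plateau_smooth: "smooth_upto k plateau"
proof -
  have "smooth_upto k (\<lambda>t. smooth_step (8 * t + (- 1)) * smooth_step ((- 8) * t + 7))"
    by (intro smooth_upto_mult smooth_upto_compose_affine smooth_step_smooth)
  then show ?thesis by (simp add: plateau_def[abs_def])
qed

lemma plateau_bounds: "0 \<le> plateau t" "plateau t \<le> 1"
  by (auto simp: plateau_def smooth_step_bounds intro!: mult_le_one)

lemma plateau_eq: "t \<le> 0 \<Longrightarrow> plateau t = 0" "1 \<le> t \<Longrightarrow> plateau t = 0"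
  "1/4 \<le> t \<Longrightarrow> t \<le> 3/4 \<Longrightarrow> plateau t = 1"
  by (simp_all add: plateau_def smooth_step_eq_0 smooth_step_eq_1)

definition plateau_prod :: "'n::finite \<Rightarrow> real^'n \<Rightarrow> real" where
  "plateau_prod j x = (\<Prod>i\<in>UNIV - {j}. plateau (x $ i))"

lemma plateau_prod_bounds: "0 \<le> plateau_prod j x" "plateau_prod j x \<le> 1"
  unfolding plateau_prod_def by (auto intro!: prod_nonneg prod_le_1 plateau_bounds)

lemma plateau_prod_cong: "(\<And>i. i \<noteq> j \<Longrightarrow> x $ i = y $ i) \<Longrightarrow> plateau_prod j x = plateau_prod j y"
  unfolding plateau_prod_def by (rule prod.cong) auto

text \<open>\<open>push_map\<close> moves only the j-th coordinate, from t towards t^N, by a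
  fraction that depends on the remaining coordinates. Each line in direction \<open>j\<close> is
  therefore mapped into itself.\<close>

definition push :: "nat \<Rightarrow> 'n::finite \<Rightarrow> real^'n \<Rightarrow> real" where
  "push N j x = plateau_prod j x * ((x $ j) ^ N + (- 1) * x $ j)"

definition push_map :: "nat \<Rightarrow> 'n::finite \<Rightarrow> real \<Rightarrow> real^'n \<Rightarrow> real^'n" where
  "push_map N j \<tau> x = x + (\<tau> * push N j x) *\<^sub>R axis j 1"

lemma Ck_plateau_prod: "Ck k (plateau_prod j)"
  unfolding plateau_prod_def[abs_def] by (intro Ck_prod Ck_coordinate plateau_smooth)

lemma smooth_power_diff: "smooth_upto k (\<lambda>t. t ^ N + (- 1) * t)"
proof -
  have "smooth_upto k (\<lambda>t. t ^ N)"
  proof (induction N)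
    case 0
    then show ?case by (simp add: smooth_upto_const)
  next
    case (Suc N)
    have "smooth_upto k (\<lambda>t. t)" using smooth_upto_affine[of k 1 0] by simp
    from smooth_upto_mult[OF this Suc] show ?case by simp
  qed
  moreover have "smooth_upto k (\<lambda>t. (- 1) * t)" using smooth_upto_affine[of k "- 1" 0] by simp
  ultimately show ?thesis by (rule smooth_upto_add)
qed

lemma Ck_push: "Ck k (push N j)"
  unfolding push_def[abs_def]
  by (intro Ck_mult Ck_plateau_prod Ck_coordinate[OF smooth_power_diff])

text \<open>On the two faces orthogonal to direction \<open>j\<close> because t^N = t for t = 0 and
  t = 1, and on the other faces because the plateau function vanishes there.\<close>

lemma push_eq_0:
  fixes x :: "real^'n::finite"
  assumes "x \<in> cbox 0 1" "x \<notin> cube" "1 \<le> N"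
  shows "push N j x = 0"
proof -
  obtain i where i: "x $ i = 0 \<or> x $ i = 1"
    using assms(1,2) by (force simp: cube_def mem_box_cart not_less intro: antisym)
  show ?thesis
  proof (cases "i = j")
    case True
    then have "(x $ j) ^ N + (- 1) * x $ j = 0" using i assms(3) by (auto simp: power_0_left)
    then show ?thesis by (simp add: push_def)
  next
    case False
    then have "plateau_prod j x = 0"
      unfolding plateau_prod_def using i by (intro prod_zero bexI[of _ i]) (auto simp: plateau_eq)
    then show ?thesis by (simp add: push_def)
  qed
qed

lemma push_map_smooth: "Ck k (\<lambda>x. push_map N j \<tau> x $ i)"
proof -
  have "Ck k (\<lambda>x. x $ i + (\<tau> * axis j 1 $ i) * push N j x)"
    by (intro Ck_add Ck_mult Ck_const Ck_push Ck_component)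
  then show ?thesis by (simp add: push_map_def mult_ac)
qed

lemma push_map_continuous: "continuous_on S (push_map N j \<tau>)"
  unfolding push_map_def[abs_def] by (intro continuous_intros Ck_continuous_on[OF Ck_push])

definition push_grad :: "nat \<Rightarrow> 'n::finite \<Rightarrow> real^'n \<Rightarrow> real^'n^'n" where
  "push_grad N j x = (\<chi> i l. axis j 1 $ i * partial_deriv l (push N j) x)"

lemma push_map_weak_differential:
  "has_weak_differential cube (push_map N j \<tau>) (\<lambda>x. mat 1 + \<tau> *\<^sub>R push_grad N j x)"
proof -
  have "partial_deriv l (\<lambda>x. push_map N j \<tau> x $ i) x = (mat 1 + \<tau> *\<^sub>R push_grad N j x) $ i $ l" for i l x
  proof -
    have "(\<lambda>x. push_map N j \<tau> x $ i) = (\<lambda>x. x $ i + (\<tau> * axis j 1 $ i) * push N j x)"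
      by (simp add: push_map_def mult_ac)
    moreover have "partial_deriv l (\<lambda>x. (\<tau> * axis j 1 $ i) * push N j x) x = (\<tau> * axis j 1 $ i) * partial_deriv l (push N j) x"
      using partial_deriv_mult[OF Ck_const[of "Suc 0" "\<tau> * axis j 1 $ i"] Ck_push[of "Suc 0"], of l N j x]
        partial_deriv_eq[OF has_derivative_const[of "\<tau> * axis j 1 $ i" "at x"], of l] by simp
    ultimately show ?thesis
      using partial_deriv_add[OF Ck_component[of "Suc 0" i] Ck_mult[OF Ck_const[of "Suc 0" "\<tau> * axis j 1 $ i"] Ck_push[of "Suc 0" N j]], of l x]
      by (simp add: partial_deriv_component push_grad_def)
  qed
  then have "(\<lambda>x. \<chi> i l. partial_deriv l (\<lambda>x. push_map N j \<tau> x $ i) x) = (\<lambda>x. mat 1 + \<tau> *\<^sub>R push_grad N j x)"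
    by (auto simp: vec_eq_iff fun_eq_iff)
  then show ?thesis using smooth_weak_differential(1)[OF push_map_smooth[of _ N j \<tau>]] by simp
qed

lemma push_grad_continuous: "continuous_on S (push_grad N j)"
  unfolding push_grad_def[abs_def]
  by (intro continuous_on_vec_lambda continuous_intros Ck_partial_continuous_on[OF Ck_push])

lemma push_map_identity_on_boundary:
  assumes "1 \<le> N"
  shows "identity_on_boundary (push_map N j \<tau>)"
  unfolding identity_on_boundary_def closure_cube
proof (rule continuous_on_eq[OF push_map_continuous])
  show "push_map N j \<tau> x = (if x \<in> cube then push_map N j \<tau> x else x)" if "x \<in> cbox 0 1" for x
    using push_eq_0[OF that _ assms] by (simp add: push_map_def)
qed

lemma continuous_set_integrable_cube:
  fixes F :: "real^'n::finite \<Rightarrow> 'b::{banach, second_countable_topology}"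
  assumes "continuous_on UNIV F"
  shows "set_integrable lebesgue cube F"
proof -
  have "set_integrable lebesgue (cbox 0 1) F"
    using locally_integrable_continuous[OF assms, of UNIV] by (simp add: locally_integrable_def)
  then show ?thesis by (rule set_integrable_subset) (use cube_subset_cbox cube_sets in auto)
qed

definition push_diff :: "nat \<Rightarrow> 'n::finite \<Rightarrow> real \<Rightarrow> real^'n \<Rightarrow> real^'n^'n" where
  "push_diff N j \<tau> x = (if x \<in> cube then \<tau> *\<^sub>R push_grad N j x else 0)"

lemma push_displacement:
  assumes "1 \<le> N"
  shows "displacement (\<lambda>x. if x \<in> cube then push_map N j \<tau> x - x else 0) (push_diff N j \<tau>)"
proof -
  have "set_integrable lebesgue cube (\<lambda>x. mat 1 + \<tau> *\<^sub>R push_grad N j x)"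
    by (intro continuous_set_integrable_cube continuous_intros push_grad_continuous)
  from displacement_zero_extension[OF push_map_identity_on_boundary[OF assms] push_map_weak_differential this]
  show ?thesis by (simp add: push_diff_def[abs_def] cong: if_cong)
qed

lemma push_finite_energy:
  assumes "0 < p"
  shows "finite_energy p (push_diff N j \<tau>)"
proof (rule iffD1[OF energy_eq_excess(1)])
  show "mat 1 + \<tau> *\<^sub>R push_grad N j x = mat 1 + push_diff N j \<tau> x" if "x \<in> cube" for x
    using that by (simp add: push_diff_def)
  show "set_integrable lebesgue cube (\<lambda>x. norm (mat 1 + \<tau> *\<^sub>R push_grad N j x) powr p)"
    using assms
    by (intro continuous_set_integrable_cube continuous_on_powr' continuous_intros push_grad_continuous) auto
qed (simp add: push_diff_def)

lemma excess_push_0: "excess p (push_diff N j 0) = 0"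
  by (simp add: excess_def push_diff_def[abs_def] cong: if_cong)

text \<open>The gradient of \<open>push\<close> is bounded on the closed cube, which supplies the
  dominating function. Continuity in \<open>\<tau>\<close> allows the energy to be tuned by the
  intermediate value theorem.\<close>

lemma excess_push_continuous:
  fixes j :: "'n::finite"
  assumes p: "0 < p"
  shows "continuous_on {0..1} (\<lambda>\<tau>. excess p (push_diff N j \<tau>))"
proof (unfold continuous_on_sequentially, intro allI ballI impI, unfold comp_def)
  fix \<tau>s and \<tau> :: real assume \<tau>: "\<tau> \<in> {0..1}" and l: "(\<forall>n::nat. \<tau>s n \<in> {0..1}) \<and> \<tau>s \<longlonglongrightarrow> \<tau>"
  have "bounded (push_grad N j ` cbox (0::real^'n) 1)"
    by (intro compact_imp_bounded compact_continuous_image push_grad_continuous compact_cbox)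
  then obtain B where B: "\<And>x. x \<in> cbox 0 1 \<Longrightarrow> norm (push_grad N j x) \<le> B" unfolding bounded_iff by blast
  let ?c = "norm (mat 1 :: real^'n^'n)"
  show "(\<lambda>n. excess p (push_diff N j (\<tau>s n))) \<longlonglongrightarrow> excess p (push_diff N j \<tau>)"
    unfolding excess_def
  proof (rule integral_dominated_convergence[where w = "\<lambda>x. indicat_real cube x * ((?c + B) powr p + ?c powr p)"])
    show "integrable lebesgue (\<lambda>x::real^'n. indicat_real cube x * ((?c + B) powr p + ?c powr p))"
      by (intro integrable_mult_left integrable_indicator_cube)
    show "AE x in lebesgue. (\<lambda>n. excess_density p (push_diff N j (\<tau>s n) x)) \<longlonglongrightarrow> excess_density p (push_diff N j \<tau> x)"
    proof (intro AE_I2)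
      fix x :: "real^'n"
      have "(\<lambda>n. push_diff N j (\<tau>s n) x) \<longlonglongrightarrow> push_diff N j \<tau> x"
        unfolding push_diff_def using l by (auto intro!: tendsto_intros)
      then show "(\<lambda>n. excess_density p (push_diff N j (\<tau>s n) x)) \<longlonglongrightarrow> excess_density p (push_diff N j \<tau> x)"
        unfolding excess_density_def using p by (intro tendsto_intros tendsto_powr') auto
    qed
    show "AE x in lebesgue. norm (excess_density p (push_diff N j (\<tau>s n) x))
        \<le> indicat_real cube x * ((?c + B) powr p + ?c powr p)" for n
    proof (intro AE_I2)
      fix x :: "real^'n"
      show "norm (excess_density p (push_diff N j (\<tau>s n) x)) \<le> indicat_real cube x * ((?c + B) powr p + ?c powr p)"
      proof (cases "x \<in> cube")
        case True
        then have x: "x \<in> cbox 0 1" using cube_subset_cbox by blast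
        have \<tau>n: "0 \<le> \<tau>s n" "\<tau>s n \<le> 1" using l by auto
        have "norm (mat 1 + push_diff N j (\<tau>s n) x) \<le> ?c + \<tau>s n * norm (push_grad N j x)"
          using True \<tau>n norm_triangle_ineq[of "mat 1" "\<tau>s n *\<^sub>R push_grad N j x"] by (simp add: push_diff_def)
        also have "\<dots> \<le> ?c + B"
          using B[OF x] \<tau>n mult_mono[of "\<tau>s n" 1 "norm (push_grad N j x)" B] by simp
        finally have "norm (mat 1 + push_diff N j (\<tau>s n) x) powr p \<le> (?c + B) powr p"
          using p by (intro powr_mono2) auto
        moreover have "0 \<le> norm (mat 1 + push_diff N j (\<tau>s n) x) powr p" "0 \<le> ?c powr p" by simp_all
        ultimately have "\<bar>norm (mat 1 + push_diff N j (\<tau>s n) x) powr p - ?c powr p\<bar> \<le> (?c + B) powr p + ?c powr p"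
          by linarith
        then show ?thesis using True by (simp add: excess_density_def)
      qed (simp add: push_diff_def)
    qed
  qed (use push_finite_energy[OF p] in \<open>auto simp: finite_energy_def intro!: borel_measurable_integrable\<close>)
qed

lemma push_derivative:
  fixes x :: "real^'n::finite"
  assumes "1 \<le> N" "\<And>i. i \<noteq> j \<Longrightarrow> 1/4 \<le> x $ i \<and> x $ i \<le> 3/4"
  shows "partial_deriv j (push N j) x = real N * (x $ j) ^ (N - 1) - 1"
proof -
  have "plateau_prod j x = 1"
    unfolding plateau_prod_def using assms(2) by (intro prod.neutral) (auto simp: plateau_eq)
  moreover have "partial_deriv j (plateau_prod j) x = 0"
    unfolding plateau_prod_def[abs_def]
    by (rule partial_deriv_prod_coordinates_eq_0) (auto intro: plateau_smooth simp del: smooth_upto.simps)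
  moreover have "partial_deriv j (\<lambda>x. (x $ j) ^ N + (- 1) * x $ j) x = real N * (x $ j) ^ (N - 1) - 1"
  proof -
    have "((\<lambda>t. t ^ N + (- 1) * t) has_real_derivative real N * (x $ j) ^ (N - 1) - 1) (at (x $ j))"
      by (auto intro!: derivative_eq_intros)
    from partial_deriv_coordinate[OF this, of j] show ?thesis by simp
  qed
  ultimately show ?thesis
    unfolding push_def[abs_def]
    by (subst partial_deriv_mult[OF Ck_plateau_prod[of "Suc 0"] Ck_coordinate[OF smooth_power_diff, of "Suc 0"]]) simp
qed

text \<open>Near the face where the j-th coordinate is 1, the derivative of t^N is of order N on a
  slab of thickness of order 1/N. The energy there is of order N^(p-1), which is unbounded since p >
  1.\<close>

lemma excess_push_large:
  fixes j :: "'n::finite"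
  assumes p: "1 < p"
  shows "\<exists>N\<ge>1. K < excess p (push_diff N j 1)"
proof -
  let ?c = "norm (mat 1 :: real^'n^'n) powr p"
  let ?q = "(1/2) ^ (CARD('n) - 1) :: real"
  have low: "(real N / 2) powr p * (1 / (2 * real N) * ?q) - ?c \<le> excess p (push_diff N j 1)" if N: "1 \<le> N" for N
  proof -
    \<comment> \<open>In this box the other coordinates lie in [1/4, 3/4], where the plateau is 1,
      so the map acts as t -> t^N in direction \<open>j\<close>. The sides of length 1/2 account for
      \<open>?q\<close>.\<close>
    define a b :: "real^'n" where "a = (\<chi> i. if i = j then 1 - 1 / (2 * real N) else 1/4)"
      and "b = (\<chi> i. if i = j then 1 else 3/4)"
    have N': "0 < 1 / (2 * real N)" "1 / (2 * real N) \<le> 1 / 2" using N by (auto simp: field_simps)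
    have ab: "a $ i < b $ i" "0 \<le> a $ i" "b $ i \<le> 1" for i using N' by (auto simp: a_def b_def)
    have "cbox a b \<noteq> {}" using ab(1) by (auto simp: interval_ne_empty_cart less_imp_le)
    then have "measure lborel (cbox a b) = (\<Prod>i\<in>UNIV. b $ i - a $ i)" by (rule content_cbox_cart)
    also have "\<dots> = (b $ j - a $ j) * (\<Prod>i\<in>UNIV - {j}. b $ i - a $ i)" by (simp add: prod.remove[of UNIV j])
    also have "(\<Prod>i\<in>UNIV - {j}. b $ i - a $ i) = (\<Prod>i\<in>UNIV - {j}. 1/2)"
      by (rule prod.cong) (auto simp: a_def b_def)
    finally have mb: "measure lborel (cbox a b) = 1 / (2 * real N) * ?q" by (simp add: a_def b_def card_Diff_singleton)
    have mbox: "measure lebesgue (box a b) = 1 / (2 * real N) * ?q"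
      using mb by (simp add: measure_lborel_box_eq measure_lborel_cbox_eq)
    have sub: "box a b \<subseteq> cube"
    proof
      fix x assume x: "x \<in> box a b"
      have "0 < x $ i \<and> x $ i < 1" for i
        using x ab(2,3)[of i] by (auto simp: mem_box_cart intro: le_less_trans less_le_trans)
      then show "x \<in> cube" by (simp add: cube_def)
    qed
    have pt: "(real N / 2) powr p * indicat_real (box a b) x - ?c * indicat_real cube x \<le> excess_density p (push_diff N j 1 x)" for x
    proof (cases "x \<in> box a b")
      case True
      have xi: "1/4 \<le> x $ i \<and> x $ i \<le> 3/4" if "i \<noteq> j" for i
        using True that by (auto simp: mem_box_cart a_def b_def less_imp_le dest!: spec[of _ i])
      have xj: "1 - 1 / (2 * real N) < x $ j"
        using True by (auto simp: mem_box_cart a_def b_def dest!: spec[of _ j])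
      \<comment> \<open>Bernoulli's inequality: (1 - 1/(2N))^(N-1) is at least 1/2, hence the
        derivative of t^N is at least N/2 throughout the box.\<close>
      have "1 / 2 \<le> 1 + real (N - 1) * (- (1 / (2 * real N)))"
        using N by (simp add: of_nat_diff field_simps)
      also have "\<dots> \<le> (1 + - (1 / (2 * real N))) ^ (N - 1)"
        using N' by (intro Bernoulli_inequality) linarith
      also have "\<dots> \<le> (x $ j) ^ (N - 1)" using N' xj by (intro power_mono) auto
      finally have "real N / 2 \<le> real N * (x $ j) ^ (N - 1)"
        using N by (simp add: field_simps)
      also have "\<dots> = (mat 1 + push_diff N j 1 x) $ j $ j"
        using True sub push_derivative[OF N xi] by (auto simp: push_diff_def push_grad_def mat_def)
      also have "\<dots> \<le> norm (mat 1 + push_diff N j 1 x)"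
        using norm_entry_le[of "mat 1 + push_diff N j 1 x" j j] by linarith
      finally have "(real N / 2) powr p \<le> norm (mat 1 + push_diff N j 1 x) powr p"
        using p by (intro powr_mono2) auto
      then show ?thesis using True sub by (auto simp: excess_density_def)
    next
      case False
      then show ?thesis by (cases "x \<in> cube") (auto simp: excess_density_def push_diff_def)
    qed
    have i1: "integrable lebesgue (indicat_real (box a b))"
      by (intro integrable_real_indicator) (simp_all add: emeasure_lborel_box_finite[unfolded infinity_ennreal_def])
    have "(LINT x|lebesgue. (real N / 2) powr p * indicat_real (box a b) x - ?c * indicat_real cube x)
        \<le> excess p (push_diff N j 1)"
      unfolding excess_def using pt push_finite_energy[of p N j 1] p
      by (intro integral_mono Bochner_Integration.integrable_diff integrable_mult_right i1 integrable_indicator_cube)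
        (auto simp: finite_energy_def)
    moreover have "(LINT x|lebesgue. (real N / 2) powr p * indicat_real (box a b) x - ?c * indicat_real cube x)
        = (real N / 2) powr p * measure lebesgue (box a b) - ?c * measure lebesgue (cube :: (real^'n) set)"
      using i1 integrable_indicator_cube by (subst Bochner_Integration.integral_diff) auto
    ultimately show ?thesis unfolding mbox measure_cube by linarith
  qed
  \<comment> \<open>The lower bound simplifies to (N/2)^(p-1) * ?q / 4 - ?c, so (N/2)^(p-1) must
    exceed this threshold. The maximum with 1 keeps the base of the power positive.\<close>
  define L where "L = max ((K + ?c) * 4 / ?q) 1"
  obtain N0 :: nat where N0: "2 * L powr (1 / (p - 1)) < real N0" using reals_Archimedean2 by blast
  define N where "N = max N0 1"
  have "L = (L powr (1 / (p - 1))) powr (p - 1)" using p by (simp add: powr_powr L_def)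
  also have "\<dots> < (real N / 2) powr (p - 1)"
    using p N0 by (intro powr_less_mono2) (auto simp: N_def)
  finally have N: "1 \<le> N" "(K + ?c) * 4 / ?q < (real N / 2) powr (p - 1)"
    by (auto simp: N_def L_def)
  have "(real N / 2) powr p = (real N / 2) powr (p - 1) * (real N / 2) powr 1"
    by (subst powr_add[symmetric]) simp
  then have P: "(real N / 2) powr p = (real N / 2) powr (p - 1) * (real N / 2)" by simp
  have "(real N / 2) powr p * (1 / (2 * real N) * ?q) = (real N / 2) powr (p - 1) * ?q / 4"
    unfolding P using N(1) by (simp add: field_simps)
  moreover have "K + ?c < (real N / 2) powr (p - 1) * ?q / 4"
    using N(2) by (simp add: field_simps)
  ultimately have "K < excess p (push_diff N j 1)" using low[OF N(1)] by linarith
  then show ?thesis using N(1) by blast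
qed

section \<open>Gluing scaled copies of maps of the cube\<close>

definition zero_ext :: "(real^'n::finite \<Rightarrow> real^'n) \<Rightarrow> real^'n \<Rightarrow> real^'n" where
  "zero_ext f x = (if x \<in> cube then f x - x else 0)"

text \<open>The conjugate of \<open>f\<close> by y -> a + c y on the cube a + c Q, and the identity
  elsewhere. Written through the displacement so that it matches
  \<open>displacement_scaled\<close>.\<close>

definition scaled_copy :: "real^'n::finite \<Rightarrow> real \<Rightarrow> (real^'n \<Rightarrow> real^'n) \<Rightarrow> real^'n \<Rightarrow> real^'n" where
  "scaled_copy a c f x = x + c *\<^sub>R zero_ext f (inverse c *\<^sub>R (x - a))"

lemma scaled_copy_inside:
  assumes "0 < c" "y \<in> cube"
  shows "scaled_copy a c f (a + c *\<^sub>R y) = a + c *\<^sub>R f y"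
  using assms by (simp add: scaled_copy_def zero_ext_def algebra_simps)

lemma scaled_copy_outside: "inverse c *\<^sub>R (x - a) \<notin> cube \<Longrightarrow> scaled_copy a c f x = x"
  by (simp add: scaled_copy_def zero_ext_def)

lemma scaled_copy_cases:
  assumes "0 < c"
  obtains y where "y \<in> cube" "x = a + c *\<^sub>R y" | "inverse c *\<^sub>R (x - a) \<notin> cube"
proof (cases "inverse c *\<^sub>R (x - a) \<in> cube")
  case True
  then show ?thesis using that(1)[of "inverse c *\<^sub>R (x - a)"] assms by simp
next
  case False
  then show ?thesis by (rule that(2))
qed

lemma scaled_copy_maps:
  assumes c: "0 < c" and f: "f ` cube \<subseteq> cube" and a: "\<And>x. x \<in> cube \<Longrightarrow> a + c *\<^sub>R x \<in> cube"
    and x: "x \<in> cube"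
  shows "scaled_copy a c f x \<in> cube"
proof -
  from scaled_copy_cases[OF c, of x a] show ?thesis
  proof cases
    case (1 y)
    then show ?thesis using scaled_copy_inside[OF c 1(1)] a f by auto
  next
    case 2
    then show ?thesis using scaled_copy_outside[OF 2, of f] x by simp
  qed
qed

lemma scaled_copy_inverse:
  assumes c: "0 < c" and f: "g ` cube \<subseteq> cube" and fg: "\<And>y. y \<in> cube \<Longrightarrow> f (g y) = y"
  shows "scaled_copy a c f (scaled_copy a c g x) = x"
proof -
  from scaled_copy_cases[OF c, of x a] show ?thesis
  proof cases
    case (1 y)
    then have "g y \<in> cube" using f by auto
    then show ?thesis
      unfolding 1(2) scaled_copy_inside[OF c 1(1)] by (simp add: scaled_copy_inside[OF c] fg[OF 1(1)])
  next
    case 2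
    then show ?thesis using scaled_copy_outside[OF 2] by simp
  qed
qed

text \<open>The two copies live in the cubes \<open>(0,c)^n\<close> and \<open>(c,1)^n\<close>, which are disjoint.\<close>

definition glue :: "real \<Rightarrow> (real^'n::finite \<Rightarrow> real^'n) \<Rightarrow> (real^'n \<Rightarrow> real^'n) \<Rightarrow> real^'n \<Rightarrow> real^'n" where
  "glue c f u x = x + c *\<^sub>R zero_ext f (inverse c *\<^sub>R (x - 0))
     + (1 - c) *\<^sub>R zero_ext u (inverse (1 - c) *\<^sub>R (x - (\<chi> i. c)))"

lemma cube_scaled_mem:
  fixes x :: "real^'n::finite"
  assumes "0 < c" "c < 1" "x \<in> cube"
  shows "0 + c *\<^sub>R x \<in> cube" "(\<chi> i. c) + (1 - c) *\<^sub>R x \<in> cube"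
proof -
  have x: "0 < x $ i" "x $ i < 1" for i using assms(3) by (auto simp: cube_def)
  have l: "c * x $ i < c" "(1 - c) * x $ i < 1 - c" "0 < c * x $ i" "0 < (1 - c) * x $ i" for i
    using x[of i] assms(1,2) by simp_all
  have "0 < c * x $ i \<and> c * x $ i < 1" "0 < c + (1 - c) * x $ i \<and> c + (1 - c) * x $ i < 1" for i
    using l[of i] assms(1,2) by linarith+
  then show "0 + c *\<^sub>R x \<in> cube" "(\<chi> i. c) + (1 - c) *\<^sub>R x \<in> cube"
    by (simp_all add: cube_def)
qed

lemma cube_scaled_disjoint:
  fixes x :: "real^'n::finite"
  assumes "0 < c" "c < 1"
  shows "inverse c *\<^sub>R (x - 0) \<notin> cube \<or> inverse (1 - c) *\<^sub>R (x - (\<chi> i. c)) \<notin> cube"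
proof (rule ccontr)
  assume "\<not> ?thesis"
  then have "inverse c * x $ i < 1" "0 < inverse (1 - c) * (x $ i - c)" for i
    by (auto simp: cube_def)
  then have "x $ i < c \<and> 0 < x $ i - c" for i
    using assms by (auto simp: field_simps zero_less_mult_iff inverse_eq_divide)
  from this[of undefined] show False by linarith
qed

text \<open>Each copy preserves its own cube and is the identity on the other one, so the additive
  formula agrees with the composition in either order. The additive form serves the energy, the
  composed forms serve invertibility.\<close>

lemma glue_eq_compose:
  fixes f u :: "real^'n::finite \<Rightarrow> real^'n"
  assumes c: "0 < c" "c < 1"
  shows "u ` cube \<subseteq> cube \<Longrightarrow> scaled_copy 0 c f (scaled_copy (\<chi> i. c) (1 - c) u x) = glue c f u x"
    and "f ` cube \<subseteq> cube \<Longrightarrow> scaled_copy (\<chi> i. c) (1 - c) u (scaled_copy 0 c f x) = glue c f u x"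
proof -
  let ?b = "(\<chi> i. c) :: real^'n"
  have c': "0 < 1 - c" using c by simp
  show "scaled_copy 0 c f (scaled_copy ?b (1 - c) u x) = glue c f u x" if u: "u ` cube \<subseteq> cube"
  proof -
    from scaled_copy_cases[OF c', of x ?b] show ?thesis
    proof cases
      case (1 y)
      have e: "inverse (1 - c) *\<^sub>R (?b + (1 - c) *\<^sub>R z - ?b) = z" for z using c' by simp
      have key: "inverse c *\<^sub>R (?b + (1 - c) *\<^sub>R z - 0) \<notin> cube" if "z \<in> cube" for z
        using cube_scaled_disjoint[OF c, of "?b + (1 - c) *\<^sub>R z"] that unfolding e by blast
      have uy: "u y \<in> cube" using 1(1) u by auto
      have "scaled_copy ?b (1 - c) u x = ?b + (1 - c) *\<^sub>R u y"
        unfolding 1(2) by (rule scaled_copy_inside[OF c' 1(1)])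
      then have "inverse c *\<^sub>R (scaled_copy ?b (1 - c) u x - 0) \<notin> cube" using key[OF uy] by simp
      note out = scaled_copy_outside[OF this]
      have "inverse c *\<^sub>R (x - 0) \<notin> cube" unfolding 1(2) by (rule key[OF 1(1)])
      then show ?thesis
        unfolding out by (simp add: glue_def scaled_copy_def zero_ext_def)
    next
      case 2
      then show ?thesis
        unfolding scaled_copy_outside[OF 2] by (simp add: glue_def scaled_copy_def zero_ext_def)
    qed
  qed
  show "scaled_copy ?b (1 - c) u (scaled_copy 0 c f x) = glue c f u x" if f: "f ` cube \<subseteq> cube"
  proof -
    from scaled_copy_cases[OF c(1), of x 0] show ?thesis
    proof cases
      case (1 y)
      have e: "inverse c *\<^sub>R (0 + c *\<^sub>R z - 0) = z" for z :: "real^'n" using c by simp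
      have key: "inverse (1 - c) *\<^sub>R (0 + c *\<^sub>R z - ?b) \<notin> cube" if "z \<in> cube" for z
        using cube_scaled_disjoint[OF c, of "0 + c *\<^sub>R z"] that unfolding e by blast
      have fy: "f y \<in> cube" using 1(1) f by auto
      have "scaled_copy 0 c f x = 0 + c *\<^sub>R f y"
        unfolding 1(2) by (rule scaled_copy_inside[OF c(1) 1(1)])
      then have "inverse (1 - c) *\<^sub>R (scaled_copy 0 c f x - ?b) \<notin> cube" using key[OF fy] by simp
      note out = scaled_copy_outside[OF this]
      have "inverse (1 - c) *\<^sub>R (x - ?b) \<notin> cube" unfolding 1(2) by (rule key[OF 1(1)])
      then show ?thesis
        unfolding out by (simp add: glue_def scaled_copy_def zero_ext_def)
    next
      case 2
      then show ?thesis
        unfolding scaled_copy_outside[OF 2] by (simp add: glue_def scaled_copy_def zero_ext_def)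
    qed
  qed
qed

text \<open>Inverting a composition reverses its order, which is why both orders of
  \<open>glue_eq_compose\<close> are used. Since the inverse is again a \<open>glue\<close>,
  \<open>glue_close\<close> also estimates the distance between inverses.\<close>

lemma glue_bij:
  fixes f u :: "real^'n::finite \<Rightarrow> real^'n"
  assumes c: "0 < c" "c < 1" and f: "bij_betw f cube cube" and u: "bij_betw u cube cube"
  shows "bij_betw (glue c f u) cube cube"
    "\<And>y. y \<in> cube \<Longrightarrow> inv_into cube (glue c f u) y = glue c (inv_into cube f) (inv_into cube u) y"
proof -
  let ?b = "(\<chi> i. c) :: real^'n" and ?f = "inv_into cube f" and ?u = "inv_into cube u"
  have c': "0 < 1 - c" using c by simp
  note mem = cube_scaled_mem[OF c]
  have im: "f ` cube \<subseteq> cube" "u ` cube \<subseteq> cube" "?f ` cube \<subseteq> cube" "?u ` cube \<subseteq> cube"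
    using f u bij_betw_inv_into[OF f] bij_betw_inv_into[OF u] by (auto simp: bij_betw_def)
  have inv: "f (?f y) = y" "?f (f y) = y" "u (?u y) = y" "?u (u y) = y" if "y \<in> cube" for y
    using that f u by (auto simp: bij_betw_inv_into_left bij_betw_inv_into_right)
  have gm: "glue c h w x \<in> cube" if "h ` cube \<subseteq> cube" "w ` cube \<subseteq> cube" "x \<in> cube" for h w x
    unfolding glue_eq_compose(1)[OF c that(2), symmetric]
    by (intro scaled_copy_maps[OF c(1) that(1)] scaled_copy_maps[OF c' that(2)] mem that(3))
  have gg: "glue c f u (glue c ?f ?u y) = y" for y
    unfolding glue_eq_compose(1)[OF c im(2), symmetric] glue_eq_compose(2)[OF c im(3), symmetric]
    by (simp add: scaled_copy_inverse[OF c' im(4) inv(3)] scaled_copy_inverse[OF c(1) im(3) inv(1)])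
  have gg': "glue c ?f ?u (glue c f u y) = y" for y
    unfolding glue_eq_compose(1)[OF c im(2), symmetric] glue_eq_compose(2)[OF c im(3), symmetric]
    by (simp add: scaled_copy_inverse[OF c' im(2) inv(4)] scaled_copy_inverse[OF c(1) im(1) inv(2)])
  show b: "bij_betw (glue c f u) cube cube"
    by (rule bij_betw_byWitness[where f' = "glue c ?f ?u"])
      (simp_all add: gg gg' image_subset_iff gm[OF im(1,2)] gm[OF im(3,4)])
  show "inv_into cube (glue c f u) y = glue c ?f ?u y" if "y \<in> cube" for y
  proof (rule inv_into_f_eq)
    show "inj_on (glue c f u) cube" using b by (simp add: bij_betw_def)
    show "glue c ?f ?u y \<in> cube" by (rule gm[OF im(3,4) that])
  qed (rule gg)
qed

lemma zero_ext_bound: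
  fixes h :: "real^'n::finite \<Rightarrow> real^'n"
  assumes "h ` cube \<subseteq> cube"
  shows "norm (zero_ext h x) \<le> real CARD('n)"
proof (cases "x \<in> cube")
  case True
  then have "h x \<in> cube" using assms by auto
  then have "\<bar>(h x - x) $ i\<bar> \<le> 1" for i
    using True by (auto simp: cube_def abs_le_iff dest!: spec[of _ i])
  then have "(\<Sum>i\<in>UNIV. \<bar>(h x - x) $ i\<bar>) \<le> (\<Sum>i\<in>(UNIV::'n set). 1)" by (intro sum_mono)
  then show ?thesis using norm_le_l1_cart[of "h x - x"] True by (simp add: zero_ext_def)
qed (simp add: zero_ext_def)

text \<open>The threshold must not depend on \<open>u\<close>, because \<open>u\<close> is chosen
  after \<open>c\<close> to correct the energy. This is possible since the copy of \<open>u\<close>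
  moves points by at most (1 - c) times the dimension; the copy of \<open>f\<close> is handled by
  uniform continuity of its displacement.\<close>

lemma glue_close:
  fixes f :: "real^'n::finite \<Rightarrow> real^'n"
  assumes f: "f ` cube \<subseteq> cube" and cont: "continuous_on UNIV (zero_ext f)" and e: "0 < e"
  shows "\<exists>c0<1. 0 < c0 \<and> (\<forall>c. c0 \<le> c \<and> c < 1 \<longrightarrow>
    (\<forall>u. u ` cube \<subseteq> cube \<longrightarrow> (\<forall>x\<in>cube. norm (f x - glue c f u x) \<le> e)))"
proof -
  let ?n = "real CARD('n)"
  have n: "1 \<le> ?n" by (simp add: Suc_le_eq)
  \<comment> \<open>For c at least 1/2 the point x/c stays in [0,2]^n, a compact set on which the
    extended displacement is uniformly continuous.\<close>
  define two :: "real^'n" where "two = (\<chi> i. 2)"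
  have "uniformly_continuous_on (cbox 0 two) (zero_ext f)"
    by (intro compact_uniformly_continuous continuous_on_subset[OF cont]) auto
  then obtain \<delta> where \<delta>: "0 < \<delta>" "\<And>x y. x \<in> cbox 0 two \<Longrightarrow> y \<in> cbox 0 two \<Longrightarrow>
      dist x y < \<delta> \<Longrightarrow> dist (zero_ext f x) (zero_ext f y) < e / 2"
    unfolding uniformly_continuous_on_def using e by (metis half_gt_zero)
  \<comment> \<open>These bounds give |x/c - x| at most \<delta>/2 and (1 - c) * ?n at most e/8. The
    last quantity occurs twice, once for each copy, besides the e/2 from uniform continuity.\<close>
  define c0 where "c0 = 1 - min (1/2) (min (\<delta> / (4 * ?n)) (e / (8 * ?n)))"
  have "0 < min (\<delta> / (4 * ?n)) (e / (8 * ?n))" using \<delta>(1) e n by simp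
  then have c0: "c0 < 1" "1/2 \<le> c0" "1 - c0 \<le> \<delta> / (4 * ?n)" "1 - c0 \<le> e / (8 * ?n)"
    unfolding c0_def by linarith+
  have "norm (f x - glue c f u x) \<le> e"
    if c: "c0 \<le> c" "c < 1" and u: "u ` cube \<subseteq> cube" and x: "x \<in> cube" for c u x
  proof -
    have ch: "1/2 \<le> c" "0 < c" using c c0 by linarith+
    have xi: "0 < x $ i" "x $ i < 1" for i using x by (auto simp: cube_def)
    have nx: "norm x \<le> ?n"
    proof -
      have "(\<Sum>i\<in>UNIV. \<bar>x $ i\<bar>) \<le> (\<Sum>i\<in>(UNIV::'n set). 1)"
        using xi by (intro sum_mono) (simp add: less_imp_le)
      then show ?thesis using norm_le_l1_cart[of x] by simp
    qed
    let ?y = "inverse c *\<^sub>R x"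
    have ci: "1 \<le> inverse c" "inverse c \<le> 2" using ch c by (auto simp: field_simps)
    have y2: "?y \<in> cbox 0 two" "x \<in> cbox 0 two"
    proof -
      have "0 \<le> inverse c * x $ i" for i using ch xi[of i] by (intro mult_nonneg_nonneg) auto
      moreover have "inverse c * x $ i \<le> 2 * 1" for i using ci xi[of i] by (intro mult_mono) auto
      ultimately have "0 \<le> inverse c * x $ i \<and> inverse c * x $ i \<le> 2" for i by simp
      then show "?y \<in> cbox 0 two" by (simp add: mem_box_cart two_def)
      have "0 \<le> x $ i \<and> x $ i \<le> 2" for i using xi[of i] by linarith
      then show "x \<in> cbox 0 two" by (simp add: mem_box_cart two_def)
    qed
    have "dist ?y x < \<delta>"
    proof -
      have "?y - x = (inverse c - 1) *\<^sub>R x" by (simp add: scaleR_left_diff_distrib)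
      then have "dist ?y x = (inverse c - 1) * norm x" using ci by (simp add: dist_norm)
      also have "inverse c - 1 = inverse c * (1 - c)" using ch by (simp add: field_simps)
      also have "inverse c * (1 - c) * norm x \<le> 2 * (\<delta> / (4 * ?n)) * ?n"
        using ci c c0 nx by (intro mult_mono[OF mult_mono]) auto
      also have "\<dots> < \<delta>" using n \<delta>(1) by (simp add: field_simps)
      finally show ?thesis .
    qed
    from \<delta>(2)[OF y2 this] have d1: "norm (zero_ext f ?y - zero_ext f x) < e / 2" by (simp add: dist_norm)
    have zb: "norm (zero_ext f ?y) \<le> ?n" by (rule zero_ext_bound[OF f])
    have ub: "norm (zero_ext u w) \<le> ?n" for w by (rule zero_ext_bound[OF u])
    have small: "(1 - c) * ?n \<le> e / 8"
    proof -
      have "(1 - c) * ?n \<le> e / (8 * ?n) * ?n" using c c0 n by (intro mult_right_mono) auto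
      then show ?thesis using n by simp
    qed
    let ?w = "inverse (1 - c) *\<^sub>R (x - (\<chi> i. c))"
    have "f x - glue c f u x = (zero_ext f x - zero_ext f ?y) + (1 - c) *\<^sub>R zero_ext f ?y - (1 - c) *\<^sub>R zero_ext u ?w"
      using x by (simp add: glue_def zero_ext_def[of f x] algebra_simps)
    also have "norm \<dots> \<le> norm (zero_ext f x - zero_ext f ?y) + norm ((1 - c) *\<^sub>R zero_ext f ?y) + norm ((1 - c) *\<^sub>R zero_ext u ?w)"
      by (intro order_trans[OF norm_triangle_ineq4] add_right_mono norm_triangle_ineq)
    also have "\<dots> \<le> e / 2 + (1 - c) * ?n + (1 - c) * ?n"
      using d1 zb ub[of ?w] c by (intro add_mono) (auto simp: norm_minus_commute intro!: mult_left_mono)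
    also have "\<dots> \<le> e" using small e by linarith
    finally show ?thesis .
  qed
  then show ?thesis using c0 by (intro exI[of _ c0]) auto
qed

lemma zero_ext_continuous: "identity_on_boundary f \<Longrightarrow> continuous_on UNIV (zero_ext f)"
  using displacement_continuous[of f] by (simp add: zero_ext_def[abs_def])

lemma identity_on_boundary_if_continuous:
  assumes "continuous_on UNIV (\<lambda>x. x + zero_ext f x)"
  shows "identity_on_boundary f"
  unfolding identity_on_boundary_def
  by (rule continuous_on_eq[OF continuous_on_subset[OF assms]]) (auto simp: zero_ext_def)

text \<open>The extension of \<open>f\<close> by the identity is a continuous bijection of the
  closed cube, so compactness makes its inverse continuous there.\<close>

lemma inv_into_identity_on_boundary:
  fixes f :: "real^'n::finite \<Rightarrow> real^'n"
  assumes f: "bij_betw f cube cube" and id: "identity_on_boundary f"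
  shows "identity_on_boundary (inv_into cube f)"
proof -
  let ?F = "\<lambda>x. if x \<in> cube then f x else x" and ?G = "\<lambda>x. if x \<in> cube then inv_into cube f x else x"
  have fm: "f x \<in> cube" "inv_into cube f x \<in> cube" if "x \<in> cube" for x
    using that f bij_betw_inv_into[OF f] by (auto simp: bij_betw_def)
  have inv: "f (inv_into cube f y) = y" "inv_into cube f (f y) = y" if "y \<in> cube" for y
    using that f by (auto simp: bij_betw_inv_into_left bij_betw_inv_into_right)
  have im: "?F ` cbox 0 1 = cbox 0 1"
  proof
    show "?F ` cbox 0 1 \<subseteq> cbox 0 1" using fm(1) cube_subset_cbox by auto
    show "cbox 0 1 \<subseteq> ?F ` cbox 0 1"
    proof
      fix y :: "real^'n" assume "y \<in> cbox 0 1"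
      then show "y \<in> ?F ` cbox 0 1"
        using fm(2)[of y] inv(1)[of y] cube_subset_cbox by (intro image_eqI[of _ _ "?G y"]) auto
    qed
  qed
  have "continuous_on (?F ` cbox 0 1) ?G"
  proof (rule continuous_on_inv)
    show "continuous_on (cbox 0 1) ?F" using id by (simp add: identity_on_boundary_def closure_cube)
    show "\<forall>x\<in>cbox 0 1. ?G (?F x) = x" using fm(1) inv(2) by auto
  qed simp
  then show ?thesis unfolding identity_on_boundary_def closure_cube im .
qed

text \<open>The map is a convex combination of t and t^N, hence strictly increasing with fixed
  points 0 and 1; surjectivity is the intermediate value theorem.\<close>

lemma power_interpolation_bij:
  fixes b :: real
  assumes b: "0 \<le> b" "b \<le> 1" and N: "1 \<le> N"
  shows "bij_betw (\<lambda>s. s + b * (s ^ N - s)) {0<..<1} {0<..<1}"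
proof -
  let ?h = "\<lambda>s. s + b * (s ^ N - s)"
  have e: "?h s = (1 - b) * s + b * s ^ N" for s by (simp add: algebra_simps)
  have mono: "?h s < ?h t" if "0 \<le> s" "s < t" for s t
  proof -
    have p: "s ^ N < t ^ N" using that N by (intro power_strict_mono) auto
    show ?thesis
    proof (cases "b = 0")
      case False
      then have "b * s ^ N < b * t ^ N" "(1 - b) * s \<le> (1 - b) * t"
        using p b that by (auto intro: mult_left_mono)
      then show ?thesis unfolding e by linarith
    qed (use that in simp)
  qed
  have z: "(0::real) ^ N = 0" using N by (simp add: power_0_left)
  then have h01: "?h 0 = 0" "?h 1 = 1" by simp_all
  have inj: "inj_on ?h {0<..<1}"
    by (rule strict_mono_on_imp_inj_on) (use mono in \<open>auto simp: strict_mono_on_def\<close>)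
  have "?h ` {0<..<1} = {0<..<1}"
  proof
    have "0 < ?h s \<and> ?h s < 1" if "0 < s" "s < 1" for s
    proof -
      have "?h 0 < ?h s" "?h s < ?h 1" using that by (intro mono; simp)+
      then show ?thesis unfolding h01 by blast
    qed
    then show "?h ` {0<..<1} \<subseteq> {0<..<1}" by auto
    show "{0<..<1} \<subseteq> ?h ` {0<..<1}"
    proof
      fix y :: real assume y: "y \<in> {0<..<1}"
      have "\<exists>x\<ge>0. x \<le> 1 \<and> ?h x = y"
      proof (rule IVT')
        show "?h 0 \<le> y" "y \<le> ?h 1" unfolding h01 using y by simp_all
      qed (auto intro!: continuous_intros)
      then obtain x where x: "0 \<le> x" "x \<le> 1" "?h x = y" by blast
      have "x \<noteq> 0" "x \<noteq> 1" using x(3) y h01 by (metis greaterThanLessThan_iff less_irrefl)+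
      then show "y \<in> ?h ` {0<..<1}" using x by (intro image_eqI[of _ _ x]) auto
    qed
  qed
  then show ?thesis using inj by (simp add: bij_betw_def)
qed

text \<open>The map keeps all coordinates but the j-th, so \<open>plateau_prod\<close> is constant
  along each line in direction \<open>j\<close>. Both injectivity and surjectivity reduce to
  \<open>power_interpolation_bij\<close> on such lines.\<close>

lemma push_map_bij:
  fixes j :: "'n::finite"
  assumes \<tau>: "0 \<le> \<tau>" "\<tau> \<le> 1" and N: "1 \<le> N"
  shows "bij_betw (push_map N j \<tau>) cube cube"
proof -
  let ?h = "\<lambda>b s. s + b * (s ^ N - s)"
  have comp: "push_map N j \<tau> x $ i = (if i = j then ?h (\<tau> * plateau_prod j x) (x $ j) else x $ i)" for x i
    by (auto simp: push_map_def push_def axis_def)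
  have b: "0 \<le> \<tau> * plateau_prod j x" "\<tau> * plateau_prod j x \<le> 1" for x
    using \<tau> plateau_prod_bounds[of j x] by (auto intro: mult_le_one)
  have bij: "bij_betw (?h (\<tau> * plateau_prod j x)) {0<..<1} {0<..<1}" for x
    by (rule power_interpolation_bij[OF b N])
  have pp: "plateau_prod j (push_map N j \<tau> x) = plateau_prod j x" for x
    by (rule plateau_prod_cong) (simp add: comp)
  have inj: "inj_on (push_map N j \<tau>) cube"
  proof (rule inj_onI)
    fix x y :: "real^'n" assume xy: "x \<in> cube" "y \<in> cube" and eq: "push_map N j \<tau> x = push_map N j \<tau> y"
    have pe: "plateau_prod j x = plateau_prod j y" using pp[of x] pp[of y] eq by simp
    have ne: "x $ i = y $ i" if "i \<noteq> j" for i using comp[of x i] comp[of y i] eq that by simp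
    have "?h (\<tau> * plateau_prod j x) (x $ j) = ?h (\<tau> * plateau_prod j x) (y $ j)"
      using comp[of x j] comp[of y j] eq pe by simp
    then have "x $ j = y $ j"
      using bij_betw_imp_inj_on[OF bij[of x]] xy by (auto simp: cube_def inj_on_def)
    then show "x = y" using ne by (metis vec_eq_iff)
  qed
  moreover have "push_map N j \<tau> ` cube = cube"
  proof
    show "push_map N j \<tau> ` cube \<subseteq> cube"
    proof
      fix y assume "y \<in> push_map N j \<tau> ` cube"
      then obtain x where x: "x \<in> cube" "y = push_map N j \<tau> x" by blast
      have "?h (\<tau> * plateau_prod j x) (x $ j) \<in> {0<..<1}"
        using bij_betwE[OF bij[of x]] x(1) by (auto simp: cube_def)
      then show "y \<in> cube" using x by (auto simp: cube_def comp)
    qed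
    show "cube \<subseteq> push_map N j \<tau> ` cube"
    proof
      fix y :: "real^'n" assume y: "y \<in> cube"
      then have "y $ j \<in> ?h (\<tau> * plateau_prod j y) ` {0<..<1}"
        using bij[of y] by (auto simp: bij_betw_def cube_def)
      then obtain s where s: "0 < s" "s < 1" "?h (\<tau> * plateau_prod j y) s = y $ j" by auto
      define x where "x = (\<chi> i. if i = j then s else y $ i)"
      have "plateau_prod j x = plateau_prod j y" by (rule plateau_prod_cong) (simp add: x_def)
      then have "push_map N j \<tau> x = y" using s(3) by (simp add: vec_eq_iff comp) (simp add: x_def)
      moreover have "x \<in> cube" using y s by (auto simp: cube_def x_def)
      ultimately show "y \<in> push_map N j \<tau> ` cube" by blast
    qed
  qed
  ultimately show ?thesis by (simp add: bij_betw_def)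
qed

section \<open>Density of nonsingular maps of maximal energy, passage to limits, and
  category\<close>

section \<open>The space of Sobolev homeomorphisms\<close>

lemma has_weak_differential_cong:
  fixes f g :: "real^'n::finite \<Rightarrow> real^'m::finite"
  assumes "\<And>x. x \<in> U \<Longrightarrow> f x = g x" "has_weak_differential U f G"
  shows "has_weak_differential U g G"
proof -
  have "set_integrable lebesgue K g" if K: "K \<subseteq> U" "set_integrable lebesgue K f" for K
  proof -
    have "(\<lambda>x. indicator K x *\<^sub>R g x) = (\<lambda>x. indicator K x *\<^sub>R f x)"
      using assms(1) K(1) by (auto simp: indicator_def fun_eq_iff)
    then show ?thesis using K(2) by (simp add: set_integrable_def)
  qed
  moreover have "(LINT x:U|lebesgue. g x $ i * \<psi> x) = (LINT x:U|lebesgue. f x $ i * \<psi> x)" for i \<psi>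
    unfolding set_lebesgue_integral_def
    by (rule Bochner_Integration.integral_cong) (auto simp: indicator_def assms(1))
  ultimately show ?thesis
    using assms(2) unfolding has_weak_differential_def locally_integrable_def by auto
qed

lemma Y_space_displacement:
  fixes f :: "real^'n::finite \<Rightarrow> real^'n"
  assumes p: "1 < p" and f: "identity_on_boundary f" and G: "has_weak_differential cube f G" "in_Lp p cube G"
  defines "V \<equiv> \<lambda>x. if x \<in> cube then G x - mat 1 else 0"
  shows "displacement (zero_ext f) V" "finite_energy p V"
    "(LINT x:cube|lebesgue. norm (G x) powr p) = norm (mat 1 :: real^'n^'n) powr p + excess p V"
proof -
  have "set_integrable lebesgue cube G" using p by (intro in_Lp_integrable[OF _ G(2)]) simp
  from displacement_zero_extension[OF f G(1) this] show "displacement (zero_ext f) V"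
    by (simp add: zero_ext_def[abs_def] V_def)
  have e: "G x = mat 1 + V x" if "x \<in> cube" for x using that by (simp add: V_def)
  have o: "V x = 0" if "x \<notin> cube" for x using that by (simp add: V_def)
  show fe: "finite_energy p V"
    using energy_eq_excess(1)[OF e o, where p = p] G(2) by (simp add: in_Lp_def)
  show "(LINT x:cube|lebesgue. norm (G x) powr p) = norm (mat 1 :: real^'n^'n) powr p + excess p V"
    by (rule energy_eq_excess(2)[OF e o fe])
qed

text \<open>The converse of \<open>Y_space_displacement\<close>: a bijection whose displacement has
  a controlled excess is a member of the space.\<close>

lemma displacement_in_Y_space:
  fixes g :: "real^'n::finite \<Rightarrow> real^'n"
  assumes p: "0 < p" and ext: "g \<in> extensional cube" and b: "bij_betw g cube cube"
    and v: "displacement (zero_ext g) V" and fe: "finite_energy p V"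
    and M: "norm (mat 1 :: real^'n^'n) powr p + excess p V \<le> M"
  defines "G \<equiv> \<lambda>x. mat 1 + V x"
  shows "g \<in> Y_space p M" "has_weak_differential cube g G" "in_Lp p cube G"
    "(LINT x:cube|lebesgue. norm (G x) powr p) = norm (mat 1 :: real^'n^'n) powr p + excess p V"
proof -
  have zc: "continuous_on UNIV (\<lambda>x. x + zero_ext g x)"
    using v by (intro continuous_intros) (simp add: displacement_def)
  have ge: "x + zero_ext g x = g x" if "x \<in> cube" for x using that by (simp add: zero_ext_def)
  have gc: "continuous_on cube g"
    by (rule continuous_on_eq[OF continuous_on_subset[OF zc]]) (auto simp: ge)
  have out: "V x = 0" if "x \<notin> cube" for x using v that by (simp add: displacement_def)
  show wd: "has_weak_differential cube g G"
    unfolding G_def by (rule has_weak_differential_cong[OF ge displacement_weak_differential[OF v]])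
  show Lp: "in_Lp p cube G" unfolding G_def by (rule finite_energy_in_Lp[OF v fe refl])
  show E: "(LINT x:cube|lebesgue. norm (G x) powr p) = norm (mat 1 :: real^'n^'n) powr p + excess p V"
    unfolding G_def by (rule energy_eq_excess(2)[OF refl out fe])
  \<comment> \<open>Continuity of the inverse comes from invariance of domain.\<close>
  have "\<exists>h. homeomorphism cube cube g h"
    using invariance_of_domain_homeomorphism[OF cube_open gc order_refl] b by (metis bij_betw_def)
  moreover have "in_Lp p cube g"
  proof -
    have "set_integrable lebesgue cube (\<lambda>x. x + zero_ext g x)"
      by (rule continuous_set_integrable_cube[OF zc])
    then have "set_borel_measurable lebesgue cube (\<lambda>x. x + zero_ext g x)"
      unfolding set_integrable_def set_borel_measurable_def by (rule borel_measurable_integrable)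
    moreover have "(\<lambda>x. indicat_real cube x *\<^sub>R (x + zero_ext g x)) = (\<lambda>x. indicat_real cube x *\<^sub>R g x)"
      using ge by (auto simp: indicator_def fun_eq_iff)
    ultimately have "set_borel_measurable lebesgue cube g" by (simp add: set_borel_measurable_def)
    moreover have "set_integrable lebesgue cube (\<lambda>x. norm (x + zero_ext g x) powr p)"
      using p by (intro continuous_set_integrable_cube continuous_on_powr' continuous_on_norm zc continuous_on_const) auto
    moreover have "(\<lambda>x. indicat_real cube x *\<^sub>R norm (x + zero_ext g x) powr p) = (\<lambda>x. indicat_real cube x *\<^sub>R norm (g x) powr p)"
      using ge by (auto simp: indicator_def fun_eq_iff)
    ultimately show ?thesis by (simp add: in_Lp_def set_integrable_def)
  qed
  ultimately have "sobolev_homeo p g" using wd Lp by (auto simp: sobolev_homeo_def sobolev_def)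
  then show "g \<in> Y_space p M"
    using ext wd Lp E M identity_on_boundary_if_continuous[OF zc] unfolding Y_space_def by auto
qed

text \<open>The vanishing determinant and the energy bound are stated for separately quantified
  differentials; uniqueness allows both to be used for the same one.\<close>

lemma zero_jacobian_differential:
  assumes "f \<in> zero_jacobian_maps p M" "has_weak_differential cube f G"
  shows "AE x in lebesgue. x \<in> cube \<longrightarrow> det (G x) = 0"
proof -
  obtain H where H: "has_weak_differential cube f H" "AE x in lebesgue. x \<in> cube \<longrightarrow> det (H x) = 0"
    using assms(1) by (auto simp: zero_jacobian_maps_def)
  show ?thesis
    using weak_differential_unique[OF H(1) assms(2)] H(2) by eventually_elim auto
qed

lemma Y_space_dense:
  fixes f :: "real^'n::finite \<Rightarrow> real^'n"
  assumes n: "2 \<le> CARD('n)" and p: "1 < p" and f: "f \<in> Y_space p M" and e: "0 < e"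
  shows "\<exists>g\<in>Y_space p M - zero_jacobian_maps p M. dist_Y f g < e \<and>
    (\<exists>G. has_weak_differential cube g G \<and> in_Lp p cube G \<and> (LINT x:cube|lebesgue. norm (G x) powr p) = M)"
proof -
  let ?I = "norm (mat 1 :: real^'n^'n) powr p" and ?n = "CARD('n)"
  have fb: "bij_betw f cube cube" and fid: "identity_on_boundary f"
    using Y_space_bij[OF f] f by (auto simp: Y_space_def)
  obtain G where G: "has_weak_differential cube f G" "in_Lp p cube G" "(LINT x:cube|lebesgue. norm (G x) powr p) \<le> M"
    using f by (auto simp: Y_space_def)
  define V where "V x = (if x \<in> cube then G x - mat 1 else 0)" for x
  note V = Y_space_displacement[OF p fid G(1,2), folded V_def[abs_def]]
  have XM: "?I + excess p V \<le> M" using V(3) G(3) by simp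
  have X0: "0 \<le> excess p V" by (rule excess_nonneg[OF p V(1,2)])
  have im: "f ` cube \<subseteq> cube" "inv_into cube f ` cube \<subseteq> cube"
    using fb bij_betw_inv_into[OF fb] by (auto simp: bij_betw_def)
  have e3: "0 < e / 3" using e by simp
  obtain c1 where c1: "c1 < 1" "0 < c1" "\<And>c u x. c1 \<le> c \<Longrightarrow> c < 1 \<Longrightarrow> u ` cube \<subseteq> cube \<Longrightarrow> x \<in> cube \<Longrightarrow>
      norm (f x - glue c f u x) \<le> e / 3"
    using glue_close[OF im(1) zero_ext_continuous[OF fid] e3] by metis
  obtain c2 where c2: "c2 < 1" "0 < c2" "\<And>c u x. c2 \<le> c \<Longrightarrow> c < 1 \<Longrightarrow> u ` cube \<subseteq> cube \<Longrightarrow> x \<in> cube \<Longrightarrow>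
      norm (inv_into cube f x - glue c (inv_into cube f) u x) \<le> e / 3"
    using glue_close[OF im(2) zero_ext_continuous[OF inv_into_identity_on_boundary[OF fb fid]] e3] by metis
  define c where "c = max c1 c2"
  have c: "0 < c" "c < 1" "c1 \<le> c" "c2 \<le> c" using c1(1,2) c2(1,2) by (auto simp: c_def)
  have c': "0 < 1 - c" using c by simp
  define j :: 'n where "j = undefined"
  \<comment> \<open>The excess that the second copy must have, obtained by solving
    \<open>?I + c ^ ?n * excess p V + (1 - c) ^ ?n * K = M\<close>.\<close>
  define K where "K = (M - ?I - c ^ ?n * excess p V) / (1 - c) ^ ?n"
  obtain N where N: "1 \<le> N" "K < excess p (push_diff N j 1)" using excess_push_large[OF p] by blast
  \<comment> \<open>At \<open>\<tau>\<close> = 0 the map is the identity with excess 0, and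
    \<open>K\<close> is nonnegative because shrinking \<open>f\<close> does not increase its excess;
    at \<open>\<tau>\<close> = 1 the excess exceeds \<open>K\<close>.\<close>
  have "\<exists>\<tau>\<ge>0. \<tau> \<le> 1 \<and> excess p (push_diff N j \<tau>) = K"
  proof (rule IVT')
    have "c ^ ?n * excess p V \<le> excess p V"
      using X0 c by (intro mult_left_le_one_le) (auto simp: power_le_one)
    then have "0 \<le> K" unfolding K_def using XM c' by (intro divide_nonneg_nonneg) auto
    then show "excess p (push_diff N j 0) \<le> K" by (simp add: excess_push_0)
  qed (use N p in \<open>auto intro: excess_push_continuous\<close>)
  then obtain \<tau> where \<tau>: "0 \<le> \<tau>" "\<tau> \<le> 1" "excess p (push_diff N j \<tau>) = K" by blast
  define u where "u = push_map N j \<tau>"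
  define U where "U = push_diff N j \<tau>"
  have ub: "bij_betw u cube cube" unfolding u_def by (rule push_map_bij[OF \<tau>(1,2) N(1)])
  have uim: "u ` cube \<subseteq> cube" "inv_into cube u ` cube \<subseteq> cube"
    using ub bij_betw_inv_into[OF ub] by (auto simp: bij_betw_def)
  have Ud: "displacement (zero_ext u) U" "finite_energy p U"
    using push_displacement[OF N(1), of j \<tau>] push_finite_energy[of p N j \<tau>] p
    by (simp_all add: u_def U_def zero_ext_def[abs_def])
  \<comment> \<open>The form \<open>x - 0\<close> is the instance of
    \<open>displacement_scaled\<close> for the offset 0, which is also the shape used in
    \<open>glue\<close>.\<close>
  define V1 where "V1 x = V (inverse c *\<^sub>R (x - 0))" for x
  define V2 where "V2 x = U (inverse (1 - c) *\<^sub>R (x - (\<chi> i. c)))" for x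
  define g where "g = restrict (glue c f u) cube"
  have gb: "bij_betw g cube cube"
    using glue_bij(1)[OF c(1,2) fb ub] bij_betw_cong[of cube g "glue c f u" cube] by (simp add: g_def)
  have d1: "displacement (\<lambda>x. c *\<^sub>R zero_ext f (inverse c *\<^sub>R (x - 0))) V1"
    unfolding V1_def[abs_def] by (rule displacement_scaled[OF V(1) c(1) cube_scaled_mem(1)[OF c(1,2)]])
  have d2: "displacement (\<lambda>x. (1 - c) *\<^sub>R zero_ext u (inverse (1 - c) *\<^sub>R (x - (\<chi> i. c)))) V2"
    unfolding V2_def[abs_def] by (rule displacement_scaled[OF Ud(1) c' cube_scaled_mem(2)[OF c(1,2)]])
  note d = displacement_add[OF d1 d2]
  have "zero_ext g = (\<lambda>x. c *\<^sub>R zero_ext f (inverse c *\<^sub>R (x - 0)) + (1 - c) *\<^sub>R zero_ext u (inverse (1 - c) *\<^sub>R (x - (\<chi> i. c))))"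
  proof
    fix x
    show "zero_ext g x = c *\<^sub>R zero_ext f (inverse c *\<^sub>R (x - 0)) + (1 - c) *\<^sub>R zero_ext u (inverse (1 - c) *\<^sub>R (x - (\<chi> i. c)))"
    proof (cases "x \<in> cube")
      case True
      then have "zero_ext g x = glue c f u x - x" by (simp add: zero_ext_def g_def)
      then show ?thesis by (simp add: glue_def)
    next
      case False
      then have "zero_ext g x = 0" by (simp add: zero_ext_def)
      then show ?thesis using d False by (simp add: displacement_def)
    qed
  qed
  then have gd: "displacement (zero_ext g) (\<lambda>x. V1 x + V2 x)" using d by simp
  have Vint: "integrable lebesgue V" "integrable lebesgue U" using V(1) Ud(1) by (auto simp: displacement_def)
  have Vout: "V x = 0" "U x = 0" if "x \<notin> cube" for x using V(1) Ud(1) that by (auto simp: displacement_def)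
  have dj: "V1 x = 0 \<or> V2 x = 0" for x
    using cube_scaled_disjoint[OF c(1,2), of x] Vout unfolding V1_def V2_def by blast
  note s1 = excess_scaled[OF Vint(1) V(2) c(1), of 0, folded V1_def[abs_def]]
  note s2 = excess_scaled[OF Vint(2) Ud(2) c', of "\<chi> i. c", folded V2_def[abs_def]]
  note s = excess_add_disjoint[OF s1(1) s2(1) dj]
  have "excess p U = K" using \<tau>(3) by (simp add: U_def)
  then have EM: "?I + excess p (\<lambda>x. V1 x + V2 x) = M"
    unfolding s(2) s1(2) s2(2) using c' by (simp add: K_def)
  have p0: "0 < p" using p by simp
  have ext: "g \<in> extensional cube" by (simp add: g_def)
  note Yg = displacement_in_Y_space[OF p0 ext gb gd s(1) eq_refl[OF EM]]
  have "dist_Y f g \<le> e / 3 + e / 3"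
    unfolding dist_Y_eq[OF f Yg(1)]
  proof (intro add_mono cSUP_least cube_nonempty)
    show "norm (f x - g x) \<le> e / 3" if "x \<in> cube" for x
      using c1(3)[OF c(3,2) uim(1) that] that by (simp add: g_def)
    show "norm (inv_into cube f y - inv_into cube g y) \<le> e / 3" if y: "y \<in> cube" for y
    proof -
      have "inv_into cube g y = inv_into cube (glue c f u) y"
        unfolding inv_into_def g_def by (rule arg_cong[of _ _ Eps]) auto
      also have "\<dots> = glue c (inv_into cube f) (inv_into cube u) y"
        by (rule glue_bij(2)[OF c(1,2) fb ub y])
      finally show ?thesis using c2(3)[OF c(4,2) uim(2) y] by simp
    qed
  qed
  then have dist: "dist_Y f g < e" using e by linarith
  have "g \<notin> zero_jacobian_maps p M"
  proof
    assume "g \<in> zero_jacobian_maps p M"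
    from zero_jacobian_differential[OF this Yg(2)]
    have ae: "AE x in lebesgue. x \<in> cube \<longrightarrow> det (mat 1 + (V1 x + V2 x)) = 0" .
    obtain i where i: "i \<noteq> j"
    proof -
      have "\<not> UNIV \<subseteq> {j}" using n card_mono[of "{j}" "UNIV :: 'n set"] by auto
      then show ?thesis using that by blast
    qed
    \<comment> \<open>An open region outside both copies: \<open>c < x $ j\<close> excludes the
      first cube and \<open>x $ i < c\<close> the second. There \<open>V1\<close> and
      \<open>V2\<close> vanish, so the differential is \<open>mat 1\<close>, with determinant
      1.\<close>
    define W where "W = {x \<in> cube. x $ i < c \<and> c < x $ j}"
    have "open W"
    proof -
      have "open {x::real^'n. x $ i < c}" "open {x::real^'n. c < x $ j}"
        by (auto intro!: open_Collect_less continuous_intros)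
      then have "open (cube \<inter> {x::real^'n. x $ i < c} \<inter> {x. c < x $ j})" by (intro open_Int cube_open)
      moreover have "cube \<inter> {x::real^'n. x $ i < c} \<inter> {x. c < x $ j} = W" by (auto simp: W_def)
      ultimately show ?thesis by simp
    qed
    moreover have "(\<chi> l. if l = i then c / 2 else (1 + c) / 2) \<in> W"
      using c i by (auto simp: W_def cube_def)
    ultimately have "\<not> negligible W" using open_not_negligible by blast
    moreover have "AE x in lebesgue. x \<notin> W"
      using ae
    proof eventually_elim
      case (elim x)
      show ?case
      proof
        assume x: "x \<in> W"
        have "inverse c *\<^sub>R (x - 0) \<notin> cube"
        proof
          assume "inverse c *\<^sub>R (x - 0) \<in> cube"
          then have "inverse c * x $ j < 1" by (auto simp: cube_def)
          then show False using x c by (auto simp: W_def field_simps)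
        qed
        moreover have "inverse (1 - c) *\<^sub>R (x - (\<chi> i. c)) \<notin> cube"
        proof
          assume "inverse (1 - c) *\<^sub>R (x - (\<chi> i. c)) \<in> cube"
          then have "0 < inverse (1 - c) * (x $ i - c)" by (auto simp: cube_def)
          then show False using x c by (auto simp: W_def zero_less_mult_iff)
        qed
        ultimately have "V1 x = 0" "V2 x = 0" using Vout by (auto simp: V1_def V2_def)
        then show False using elim x by (simp add: W_def)
      qed
    qed
    ultimately show False
      using AE_iff_null_sets[of W lebesgue] \<open>open W\<close> by (auto simp: negligible_iff_null_sets)
  qed
  then show ?thesis using Yg dist EM by auto
qed

section \<open>Limits in the space\<close>

text \<open>Against a test function the derivative moves to the test function, where uniform
  convergence of the maps suffices. Bounded energies give uniform integrability, through which the
  convergence extends to measurable sets and on to bounded functions, entry by entry.\<close>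

lemma weakly_convergent_if_uniform_limit:
  fixes f :: "real^'n::finite \<Rightarrow> real^'n" and fk :: "nat \<Rightarrow> real^'n \<Rightarrow> real^'n"
  assumes p: "1 < p"
    and G: "has_weak_differential cube f G" "in_Lp p cube G"
    and Gk: "\<And>k. has_weak_differential cube (fk k) (Gk k)" "\<And>k. in_Lp p cube (Gk k)"
      "\<And>k. (LINT x:cube|lebesgue. norm (Gk k x) powr p) \<le> M"
    and unif: "\<And>k x. x \<in> cube \<Longrightarrow> norm (f x - fk k x) \<le> \<epsilon> k" "\<epsilon> \<longlonglongrightarrow> 0"
  shows "weakly_convergent p lebesgue (\<lambda>x. indicator cube x *\<^sub>R G x) (\<lambda>k x. indicator cube x *\<^sub>R Gk k x)"
proof -
  let ?H = "\<lambda>x. indicat_real cube x *\<^sub>R G x" and ?Hk = "\<lambda>k x. indicat_real cube x *\<^sub>R Gk k x"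
  have ni: "norm (indicat_real cube x *\<^sub>R A) powr p = indicat_real cube x *\<^sub>R norm A powr p" for x :: "real^'n" and A :: "real^'n^'n"
    by (simp add: indicator_def)
  have int: "integrable lebesgue ?H" "integrable lebesgue (?Hk k)" for k
    using in_Lp_integrable[OF _ G(2)] in_Lp_integrable[OF _ Gk(2)] p by (simp_all add: set_integrable_def)
  have Lp: "integrable lebesgue (\<lambda>x. norm (?H x) powr p)" "integrable lebesgue (\<lambda>x. norm (?Hk k x) powr p)" for k
    unfolding ni using G(2) Gk(2)[of k] by (simp_all add: in_Lp_def set_integrable_def)
  have EM: "(LINT x|lebesgue. norm (?Hk k x) powr p) \<le> M" for k
    unfolding ni using Gk(3)[of k] by (simp add: set_lebesgue_integral_def)
  let ?E = "(LINT x|lebesgue. norm (?H x) powr p)"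
  \<comment> \<open>Bounds the p-energy of every difference, since (s + t)^p is at most 2^p
    max(s,t)^p, hence at most 2^p (s^p + t^p).\<close>
  define C where "C = 2 powr p * (M + ?E)"
  have entry: "(\<lambda>k. (LINT x|lebesgue. \<psi> x * (?Hk k x $ i $ j - ?H x $ i $ j))) \<longlonglongrightarrow> 0"
    if \<psi>: "\<psi> \<in> borel_measurable lebesgue" "\<And>x. \<bar>\<psi> x\<bar> \<le> B" for \<psi> B i j
  proof -
    define D where "D k x = ?Hk k x $ i $ j - ?H x $ i $ j" for k x
    have Di: "integrable lebesgue (D k)" for k
      unfolding D_def[abs_def]
      by (rule Bochner_Integration.integrable_diff[OF integrable_entry[OF int(2)] integrable_entry[OF int(1)]])
    have zero: "D k x = 0" if "x \<notin> box 0 1" for k x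
      using that by (simp add: D_def flip: cube_eq_box)
    have pt: "\<bar>D k x\<bar> powr p \<le> 2 powr p * (norm (?Hk k x) powr p + norm (?H x) powr p)" for k x
    proof -
      let ?m = "max (norm (?Hk k x)) (norm (?H x))"
      have "\<bar>D k x\<bar> \<le> norm (?Hk k x) + norm (?H x)"
        using norm_entry_le[of "?Hk k x" i j] norm_entry_le[of "?H x" i j] unfolding D_def by linarith
      then have "\<bar>D k x\<bar> \<le> 2 * ?m" by linarith
      then have "\<bar>D k x\<bar> powr p \<le> (2 * ?m) powr p" using p by (intro powr_mono2) auto
      also have "\<dots> = 2 powr p * ?m powr p" by (rule powr_mult)
      also have "?m powr p \<le> norm (?Hk k x) powr p + norm (?H x) powr p"
        by (cases "norm (?Hk k x) \<le> norm (?H x)") (simp_all add: max_def)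
      finally show ?thesis by simp
    qed
    have bi: "integrable lebesgue (\<lambda>x. 2 powr p * (norm (?Hk k x) powr p + norm (?H x) powr p))" for k
      by (intro integrable_mult_right Bochner_Integration.integrable_add Lp)
    have DLp: "integrable lebesgue (\<lambda>x. \<bar>D k x\<bar> powr p)" for k
    proof (rule Bochner_Integration.integrable_bound[OF bi[of k]])
      show "(\<lambda>x. \<bar>D k x\<bar> powr p) \<in> borel_measurable lebesgue"
        using borel_measurable_integrable[OF Di[of k]] by measurable
      show "AE x in lebesgue. norm (\<bar>D k x\<bar> powr p) \<le> norm (2 powr p * (norm (?Hk k x) powr p + norm (?H x) powr p))"
      proof (intro AE_I2)
        fix x
        show "norm (\<bar>D k x\<bar> powr p) \<le> norm (2 powr p * (norm (?Hk k x) powr p + norm (?H x) powr p))"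
          using order_trans[OF pt[of k x] abs_ge_self] by simp
      qed
    qed
    have DC: "(LINT x|lebesgue. \<bar>D k x\<bar> powr p) \<le> C" for k
    proof -
      have "(LINT x|lebesgue. \<bar>D k x\<bar> powr p)
          \<le> (LINT x|lebesgue. 2 powr p * (norm (?Hk k x) powr p + norm (?H x) powr p))"
        by (rule integral_mono[OF DLp bi pt])
      also have "\<dots> = 2 powr p * ((LINT x|lebesgue. norm (?Hk k x) powr p) + ?E)"
        by (simp only: integral_mult_right_zero Bochner_Integration.integral_add[OF Lp(2) Lp(1)])
      also have "\<dots> \<le> C" unfolding C_def using EM[of k] by (intro mult_left_mono) auto
      finally show ?thesis .
    qed
    have D1: "(LINT x|lebesgue. \<bar>D k x\<bar>) \<le> 1 + C" for k
    proof -
      have "\<bar>D k x\<bar> \<le> indicat_real cube x + \<bar>D k x\<bar> powr p" for x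
        using le_one_plus_powr[of p "\<bar>D k x\<bar>"] p zero[of x k] by (cases "x \<in> cube") (auto simp: cube_eq_box)
      then have "(LINT x|lebesgue. \<bar>D k x\<bar>) \<le> (LINT x|lebesgue. indicat_real cube x + \<bar>D k x\<bar> powr p)"
        by (intro integral_mono integrable_abs Di Bochner_Integration.integrable_add integrable_indicator_cube DLp)
      also have "\<dots> = integral\<^sup>L lebesgue (indicat_real (cube :: (real^'n) set)) + (LINT x|lebesgue. \<bar>D k x\<bar> powr p)"
        by (rule Bochner_Integration.integral_add[OF integrable_indicator_cube DLp])
      also have "integral\<^sup>L lebesgue (indicat_real (cube :: (real^'n) set)) = 1" by (simp add: measure_cube)
      finally show ?thesis using DC[of k] by linarith
    qed
    have test: "(\<lambda>k. (LINT x|lebesgue. \<phi> x * D k x)) \<longlonglongrightarrow> 0"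
      if \<phi>': "\<phi> \<in> test_functions (box 0 1)" for \<phi>
    proof -
      have \<phi>: "\<phi> \<in> test_functions cube" using \<phi>' by (simp add: cube_eq_box)
      obtain B' where B': "0 \<le> B'" "\<And>x. \<bar>partial_deriv j \<phi> x\<bar> \<le> B'"
        using test_function_partial_bounded[OF \<phi>, of j] by blast
      note w = weak_differential_test[OF G(1) \<phi>, where i = i and j = j]
      note wk = weak_differential_test[OF Gk(1) \<phi>, where i = i and j = j]
      have b: "norm ((LINT x|lebesgue. \<phi> x * D k x)) \<le> B' * \<epsilon> k" for k
      proof -
        have e: "\<phi> x * D k x = indicator cube x * (\<phi> x * Gk k x $ i $ j) - indicator cube x * (\<phi> x * G x $ i $ j)" for x
          by (simp add: D_def indicator_def right_diff_distrib)
        have df: "indicator cube x * (partial_deriv j \<phi> x * f x $ i) - indicator cube x * (partial_deriv j \<phi> x * fk k x $ i)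
            = indicat_real cube x * (partial_deriv j \<phi> x * (f x - fk k x) $ i)" for x
          by (simp add: algebra_simps)
        have "(LINT x|lebesgue. \<phi> x * D k x) =
            (LINT x|lebesgue. indicator cube x * (partial_deriv j \<phi> x * f x $ i))
            - (LINT x|lebesgue. indicator cube x * (partial_deriv j \<phi> x * fk k x $ i))"
          unfolding e Bochner_Integration.integral_diff[OF wk(3) w(3)] using w(1) wk(1)[of k] by linarith
        also have "\<dots> = (LINT x|lebesgue. indicat_real cube x * (partial_deriv j \<phi> x * (f x - fk k x) $ i))"
          unfolding Bochner_Integration.integral_diff[OF w(2) wk(2), symmetric] df ..
        also have "norm \<dots> \<le> (LINT x|lebesgue. norm (indicat_real cube x * (partial_deriv j \<phi> x * (f x - fk k x) $ i)))"
          by (rule integral_norm_bound)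
        also have "\<dots> \<le> integral\<^sup>L lebesgue (\<lambda>x::real^'n. indicat_real cube x * (B' * \<epsilon> k))"
        proof (rule integral_mono)
          show "integrable lebesgue (\<lambda>x. norm (indicat_real cube x * (partial_deriv j \<phi> x * (f x - fk k x) $ i)))"
            unfolding df[symmetric] by (intro integrable_norm Bochner_Integration.integrable_diff w(2) wk(2))
          show "integrable lebesgue (\<lambda>x::real^'n. indicat_real cube x * (B' * \<epsilon> k))"
            by (intro integrable_mult_left integrable_indicator_cube)
          show "norm (indicat_real cube x * (partial_deriv j \<phi> x * (f x - fk k x) $ i)) \<le> indicat_real cube x * (B' * \<epsilon> k)" for x
          proof (cases "x \<in> cube")
            case True
            have "\<bar>(f x - fk k x) $ i\<bar> \<le> \<epsilon> k"
              using component_le_norm_cart[of "f x - fk k x" i] unif(1)[OF True, of k] by linarith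
            then have "\<bar>partial_deriv j \<phi> x\<bar> * \<bar>(f x - fk k x) $ i\<bar> \<le> B' * \<epsilon> k"
              by (rule mult_mono[OF B'(2)]) (use B' in auto)
            then show ?thesis using True by (simp add: abs_mult)
          qed simp
        qed
        also have "\<dots> = B' * \<epsilon> k" by (simp add: measure_cube)
        finally show ?thesis .
      qed
      have "(\<lambda>k. B' * \<epsilon> k) \<longlonglongrightarrow> B' * 0" by (intro tendsto_intros unif(2))
      then show ?thesis by (intro Lim_null_comparison[OF always_eventually[OF allI[OF b]]]) simp
    qed
    have sets: "(\<lambda>k. (LINT x|lebesgue. indicator S x * D k x)) \<longlonglongrightarrow> 0" if "S \<in> sets lebesgue" for S
      by (rule set_integrals_tendsto_0[OF Di zero
            uniformly_integrable_if_bounded_Lp[OF p Di zero DLp DC] test that])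
    show ?thesis
      using bounded_integrals_tendsto_0[OF Di D1 sets \<psi>] by (simp only: D_def)
  qed
  show ?thesis
  proof
    fix \<Psi> :: "real^'n \<Rightarrow> real^'n^'n" assume \<Psi>: "\<Psi> \<in> borel_measurable lebesgue" "bounded (range \<Psi>)"
    obtain B where B: "\<And>x. norm (\<Psi> x) \<le> B" using \<Psi>(2) unfolding bounded_iff by blast
    have m: "(\<lambda>x. \<Psi> x $ i $ j) \<in> borel_measurable lebesgue" for i j
      using measurable_compose[OF \<Psi>(1) borel_measurable_continuous_onI[OF linear_continuous_on[OF bounded_linear_entry[of i j], of UNIV]]] .
    have b: "\<bar>\<Psi> x $ i $ j\<bar> \<le> B" for i j x using norm_entry_le[of "\<Psi> x" i j] B[of x] by linarith
    have "\<Psi> x \<bullet> (?Hk k x - ?H x) = (\<Sum>i\<in>UNIV. \<Sum>j\<in>UNIV. \<Psi> x $ i $ j * (?Hk k x $ i $ j - ?H x $ i $ j))" for k x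
      by (simp add: inner_vec_def)
    moreover have "integrable lebesgue (\<lambda>x. \<Psi> x $ i $ j * (?Hk k x $ i $ j - ?H x $ i $ j))" for i j k
      by (intro integrable_bounded_mult[OF _ m b] Bochner_Integration.integrable_diff integrable_entry int)
    ultimately have "(LINT x|lebesgue. \<Psi> x \<bullet> (?Hk k x - ?H x)) =
        (\<Sum>i\<in>UNIV. \<Sum>j\<in>UNIV. (LINT x|lebesgue. \<Psi> x $ i $ j * (?Hk k x $ i $ j - ?H x $ i $ j)))" for k
      by (simp only: Bochner_Integration.integral_sum Bochner_Integration.integrable_sum)
    moreover have "(\<lambda>k. \<Sum>i\<in>UNIV. \<Sum>j\<in>UNIV. (LINT x|lebesgue. \<Psi> x $ i $ j * (?Hk k x $ i $ j - ?H x $ i $ j)))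
        \<longlonglongrightarrow> (\<Sum>i\<in>(UNIV::'n set). \<Sum>j\<in>(UNIV::'n set). 0)"
      by (intro tendsto_sum entry[OF m b])
    ultimately show "(\<lambda>k. (LINT x|lebesgue. \<Psi> x \<bullet> (?Hk k x - ?H x))) \<longlonglongrightarrow> 0" by simp
  qed (use p int Lp in auto)
qed

lemma Y_space_norm_diff_le:
  assumes f: "f \<in> Y_space p M" and g: "g \<in> Y_space p M" and x: "x \<in> cube"
  shows "norm (f x - g x) \<le> dist_Y f g"
proof -
  have b: "bdd_above ((\<lambda>x. norm (h x - k x)) ` cube)"
    if "h ` cube \<subseteq> cube" "k ` cube \<subseteq> cube" for h k :: "real^'a \<Rightarrow> real^'a"
  proof -
    obtain B where B: "\<And>x::real^'a. x \<in> cube \<Longrightarrow> norm x \<le> B"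
      using bounded_subset[OF bounded_cbox cube_subset_cbox] unfolding bounded_iff by blast
    have "norm (h x - k x) \<le> B + B" if "x \<in> cube" for x
      using norm_triangle_ineq4[of "h x" "k x"] B[of "h x"] B[of "k x"] that \<open>h ` cube \<subseteq> cube\<close> \<open>k ` cube \<subseteq> cube\<close>
      by (smt (verit) image_subset_iff)
    then show ?thesis by (intro bdd_aboveI2)
  qed
  note bij = Y_space_bij[OF f] Y_space_bij[OF g]
  have im: "f ` cube \<subseteq> cube" "g ` cube \<subseteq> cube" "inv_into cube f ` cube \<subseteq> cube" "inv_into cube g ` cube \<subseteq> cube"
    using bij bij_betw_inv_into[OF bij(1)] bij_betw_inv_into[OF bij(2)] by (auto simp: bij_betw_def)
  have "norm (f x - g x) \<le> (SUP x\<in>cube. norm (f x - g x))"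
    by (rule cSUP_upper[OF x b[OF im(1,2)]])
  moreover have "0 \<le> (SUP y\<in>cube. norm (inv_into cube f y - inv_into cube g y))"
    using cSUP_upper[OF x b[OF im(3,4)]] norm_ge_zero order_trans by blast
  ultimately show ?thesis unfolding dist_Y_eq[OF f g] by linarith
qed

text \<open>The determinant is a polynomial in the entries, so it passes to almost everywhere
  limits. The subsequence depends on the level \<open>n\<close>, but the conclusion on each level
  set does not, and countably many levels exhaust the cube.\<close>

lemma zero_jacobian_limit:
  fixes f :: "real^'n::finite \<Rightarrow> real^'n"
  assumes p: "1 < p" and f: "f \<in> Y_space p M"
    and G: "has_weak_differential cube f G" "in_Lp p cube G"
    and fk: "\<And>k. fk k \<in> Y_space p M" "\<And>k. dist_Y f (fk k) < inverse (real (Suc k))"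
    and Gk: "\<And>k. has_weak_differential cube (fk k) (Gk k)" "\<And>k. in_Lp p cube (Gk k)"
      "\<And>k. (LINT x:cube|lebesgue. norm (Gk k x) powr p) \<le> c"
    and Ec: "(LINT x:cube|lebesgue. norm (G x) powr p) = c"
    and dk: "\<And>k. AE x in lebesgue. x \<in> cube \<longrightarrow> det (Gk k x) = 0"
  shows "AE x in lebesgue. x \<in> cube \<longrightarrow> det (G x) = 0"
proof -
  interpret weakly_convergent p lebesgue "\<lambda>x. indicat_real cube x *\<^sub>R G x" "\<lambda>k x. indicat_real cube x *\<^sub>R Gk k x"
  proof (rule weakly_convergent_if_uniform_limit[OF p G Gk])
    show "norm (f x - fk k x) \<le> inverse (real (Suc k))" if "x \<in> cube" for k x
      using Y_space_norm_diff_le[OF f fk(1) that] fk(2) by (meson less_imp_le order_trans)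
  qed (rule LIMSEQ_inverse_real_of_nat)
  have E: "(LINT x|lebesgue. norm (indicat_real cube x *\<^sub>R F x) powr p) = (LINT x:cube|lebesgue. norm (F x) powr p)"
    for F :: "real^'n \<Rightarrow> real^'n^'n"
    unfolding set_lebesgue_integral_def
    by (rule Bochner_Integration.integral_cong) (auto simp: indicator_def)
  have "AE x in lebesgue. norm (indicat_real cube x *\<^sub>R G x) \<le> real n \<longrightarrow> x \<in> cube \<longrightarrow> det (G x) = 0" for n
  proof -
    obtain r where r: "AE x in lebesgue. norm (indicat_real cube x *\<^sub>R G x) \<le> real n \<longrightarrow>
        (\<lambda>k. indicat_real cube x *\<^sub>R Gk (r k) x) \<longlonglongrightarrow> indicat_real cube x *\<^sub>R G x"
      using AE_convergent_subsequence[of n] Gk(3) unfolding E Ec by blast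
    have "AE x in lebesgue. \<forall>k. x \<in> cube \<longrightarrow> det (Gk k x) = 0"
      unfolding AE_all_countable using dk by blast
    with r show ?thesis
    proof eventually_elim
      case (elim x)
      show ?case
      proof (intro impI)
        assume "norm (indicat_real cube x *\<^sub>R G x) \<le> real n" and x: "x \<in> cube"
        then have l: "(\<lambda>k. Gk (r k) x) \<longlonglongrightarrow> G x" using elim(1) by simp
        have "(\<lambda>k. det (Gk (r k) x)) \<longlonglongrightarrow> det (G x)"
          unfolding det_def by (intro tendsto_intros l)
        then show "det (G x) = 0" using elim(2) x by (simp add: LIMSEQ_const_iff)
      qed
    qed
  qed
  then have "AE x in lebesgue. \<forall>n. norm (indicat_real cube x *\<^sub>R G x) \<le> real n \<longrightarrow> x \<in> cube \<longrightarrow> det (G x) = 0"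
    unfolding AE_all_countable by blast
  then show "AE x in lebesgue. x \<in> cube \<longrightarrow> det (G x) = 0"
  proof eventually_elim
    case (elim x)
    obtain n where "norm (indicat_real cube x *\<^sub>R G x) \<le> real n" using real_arch_simple by blast
    then show ?case using elim by blast
  qed
qed

section \<open>First category\<close>

lemma zero_jacobian_maps_nowhere_dense:
  fixes M p :: real
  assumes n: "2 \<le> CARD('n::finite)" and p: "1 < p"
    and X: "X = Metric_space.mtopology (Y_space p M :: (real^'n \<Rightarrow> real^'n) set) dist_Y"
  shows "X interior_of (X closure_of (zero_jacobian_maps p M)) = {}"
proof -
  interpret Y: Metric_space "Y_space p M :: (real^'n \<Rightarrow> real^'n) set" dist_Y
    by (rule Metric_space_Y)
  have "f \<notin> X interior_of (X closure_of (zero_jacobian_maps p M))" for f :: "real^'n \<Rightarrow> real^'n"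
  proof
    assume "f \<in> X interior_of (X closure_of (zero_jacobian_maps p M))"
    then obtain e where e: "0 < e" and f: "f \<in> Y_space p M"
      and sub: "Y.mball f e \<subseteq> X closure_of (zero_jacobian_maps p M)"
      unfolding X Y.metric_interior_of by blast
    \<comment> \<open>The energy of \<open>g\<close> is the maximal value \<open>M\<close>, so
      approximants of \<open>g\<close> in the space never have larger energy, as
      \<open>zero_jacobian_limit\<close> demands.\<close>
    obtain g G where g: "g \<in> Y_space p M" "g \<notin> zero_jacobian_maps p M" "dist_Y f g < e"
      and G: "has_weak_differential cube g G" "in_Lp p cube G" "(LINT x:cube|lebesgue. norm (G x) powr p) = M"
      using Y_space_dense[OF n p f e] by blast
    have "g \<in> X closure_of (zero_jacobian_maps p M)" using sub g f by auto
    then have cl: "\<And>r. 0 < r \<Longrightarrow> \<exists>h\<in>zero_jacobian_maps p M. h \<in> Y.mball g r"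
      unfolding X Y.metric_closure_of by blast
    \<comment> \<open>The differentials \<open>H\<close> are the ones whose energy
      \<open>Y_space\<close> bounds; \<open>zero_jacobian_differential\<close> supplies the
      vanishing of their determinants below.\<close>
    have "\<exists>h H. h \<in> zero_jacobian_maps p M \<and> h \<in> Y_space p M \<and> dist_Y g h < inverse (real (Suc k)) \<and>
        has_weak_differential cube h H \<and> in_Lp p cube H \<and> (LINT x:cube|lebesgue. norm (H x) powr p) \<le> M" for k
    proof -
      have "0 < inverse (real (Suc k))" by simp
      from cl[OF this] obtain h where h: "h \<in> zero_jacobian_maps p M" "h \<in> Y_space p M" "dist_Y g h < inverse (real (Suc k))"
        by (auto simp del: of_nat_Suc)
      then show ?thesis by (auto simp: Y_space_def simp del: of_nat_Suc)
    qed
    then obtain h H where h: "\<And>k. h k \<in> zero_jacobian_maps p M" "\<And>k. h k \<in> Y_space p M"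
        "\<And>k. dist_Y g (h k) < inverse (real (Suc k))"
      and H: "\<And>k. has_weak_differential cube (h k) (H k)" "\<And>k. in_Lp p cube (H k)"
        "\<And>k. (LINT x:cube|lebesgue. norm (H k x) powr p) \<le> M"
      by metis
    have "AE x in lebesgue. x \<in> cube \<longrightarrow> det (G x) = 0"
      by (rule zero_jacobian_limit[OF p g(1) G(1,2) h(2,3) H G(3)
            zero_jacobian_differential[OF h(1) H(1)]])
    then show False using g G(1) by (auto simp: zero_jacobian_maps_def)
  qed
  then show ?thesis by blast
qed

theorem theorem5p3:
  fixes p M :: real
  assumes "CARD('n::finite) \<ge> 2"
    and "1 < p" and "p < real CARD('n)" and "M > 1"
  shows "first_category_in
           (Metric_space.mtopology (Y_space p M :: (real^'n \<Rightarrow> real^'n) set) dist_Y)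
           (zero_jacobian_maps p M) \<and>
         residual_in
           (Metric_space.mtopology (Y_space p M :: (real^'n \<Rightarrow> real^'n) set) dist_Y)
           (Y_space p M - zero_jacobian_maps p M)"
proof -
  interpret Y: Metric_space "Y_space p M :: (real^'n \<Rightarrow> real^'n) set" dist_Y
    by (rule Metric_space_Y)
  define X where "X = Y.mtopology"
  let ?A = "zero_jacobian_maps p M :: (real^'n \<Rightarrow> real^'n) set"
  have top: "topspace X = Y_space p M" by (simp add: X_def)
  have sub: "?A \<subseteq> topspace X" unfolding top by (auto simp: zero_jacobian_maps_def)
  have nd: "X interior_of (X closure_of ?A) = {}"
    by (rule zero_jacobian_maps_nowhere_dense[OF assms(1,2) X_def])
  have "first_category_in X ?A"
    \<comment> \<open>A nowhere dense set is the union of a constant sequence; correspondingly the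
      complement of its closure is a single open dense set, repeated in the residual half.\<close>
    unfolding first_category_in_def using sub nd by (intro exI[of _ "\<lambda>_. ?A"]) auto
  moreover have "residual_in X (Y_space p M - ?A)"
    unfolding residual_in_def
  proof (intro conjI exI[of _ "\<lambda>_. topspace X - X closure_of ?A"] allI)
    show "openin X (topspace X - X closure_of ?A)" by (simp add: openin_diff)
    show "X closure_of (topspace X - X closure_of ?A) = topspace X"
      using nd by (simp add: closure_of_complement)
    show "(\<Inter>k::nat. topspace X - X closure_of ?A) \<subseteq> Y_space p M - ?A"
      using closure_of_subset[OF sub] unfolding top by blast
  qed (auto simp: top)
  ultimately show ?thesis by (simp add: X_def)
qed

end
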